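(* Let $\Lambda$ be a finite alphabet and $\mathbf{T}$ a vector tree of infinite height. Then for every finite Souslin measurable coloring of the set $\mathrm{W}^{[\infty]}(\Lambda,\mathbf{T})$ and every subspace $X$ of $\mathrm{W}(\Lambda,\mathbf{T})$ there exists a subspace $X'$ of $\mathrm{W}(\Lambda,\mathbf{T})$ with $X'\leqslant X$ such that the set $[X']^{[\infty]}_\Lambda$ is monochromatic.
   Context: Trees. A tree is a partially ordered set $(T,\leqslant_T)$ with a minimum (root), such that for every $t\in T$ the set of strict predecessors is finite and well ordered, every non-maximal $t$ has finitely many immediate successors, and all maximal chains have the same cardinality, called the height of $T$. Infinite height means height $\omega$. $T(n)$ is the set of nodes with exactly $n$ strict predecessors; for $A\subseteq T$, $L_T(A)=\{n: T(n)\cap A\neq\emptyset\}$. A level subset of $T$ is a nonempty subset of some $T(n)$; a level subset $D_1$ dominates a level subset $D_2$ if for every $t\in D_2$ there is $s\in D_1$ with $t\leqslant_T s$. Vector trees. A vector tree $\mathbf{T}=(T_1,\dots,T_d)$ ($d\geq1$) is a finite sequence of trees of the same height. Its level product $\otimes\mathbf{T}=\bigcup_n T_1(n)\times\dots\times T_d(n)$ is ordered coordinatewise; it is a tree whose $n$-th level is $T_1(n)\times\dots\times T_d(n)$. A vector level subset of $\mathbf{T}$ is $\mathbf{D}=(D_1,\dots,D_d)$ for which there is $n$ with $\emptyset\neq D_i\subseteq T_i(n)$ for all $i$; then $L_{\mathbf{T}}(\mathbf{D})=\{n\}$ and $\otimes\mathbf{D}=D_1\times\dots\times D_d$. It dominates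 another vector level subset $\mathbf{D}'=(D'_1,\dots,D'_d)$ if $D_i$ dominates $D'_i$ for all $i$. $\mathbf{T}(n)=(T_1(n),\dots,T_d(n))$. For $m\leqslant n$, $\otimes\mathbf{T}\upharpoonright[m,n)$ is the set of elements of $\otimes\mathbf{T}$ lying on levels $m,\dots,n-1$ (empty if $m=n$). Words. $\mathrm{W}(\Lambda,\mathbf{T},m,n)=\Lambda^{\otimes\mathbf{T}\upharpoonright[m,n)}$ and $\mathrm{W}(\Lambda,\mathbf{T})=\bigcup_{m\leqslant n}\mathrm{W}(\Lambda,\mathbf{T},m,n)$ (constant words; the empty function is included). Fix distinct symbols $(v_{\mathbf{s}})_{\mathbf{s}\in\otimes\mathbf{T}}$ not in $\Lambda$. For a vector level subset $\mathbf{D}$ of $\mathbf{T}$ with $L_{\mathbf{T}}(\mathbf{D})\subset[m,n)$, $\mathrm{W}_v(\Lambda,\mathbf{T},\mathbf{D},m,n)$ is the set of functions $f:\otimes\mathbf{T}\upharpoonright[m,n)\to\Lambda\cup\{v_{\mathbf{s}}:\mathbf{s}\in\otimes\mathbf{D}\}$ such that (1) for every $\mathbf{s}\in\otimes\mathbf{D}$, $f^{-1}(\{v_{\mathbf{s}}\})$ is nonempty and has $\mathbf{s}$ as its minimum in $\otimes\mathbf{T}$, and (2) $L_{\otimes\mathbf{T}}(f^{-1}(\{v_{\mathbf{s}}\}))=L_{\otimes\mathbf{T}}(f^{-1}(\{v_{\mathbf{s}'}\}))$ for all $\mathbf{s},\mathbf{s}'\in\otimes\mathbf{D}$. $\mathrm{W}_v(\Lambda,\mathbf{T})$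 (variable words) is the union of these sets over all $m<n$ and such $\mathbf{D}$; for $f$ in it, $\mathrm{ws}(f)$ is the unique corresponding $\mathbf{D}$. For a nonempty constant or variable word $f$ with domain $\otimes\mathbf{T}\upharpoonright[m,n)$, $\mathrm{bot}(f)=m$ and $\mathrm{top}(f)=n$. Spans. For $f\in\mathrm{W}_v(\Lambda,\mathbf{T})$ and $\mathbf{a}=(a_{\mathbf{s}})_{\mathbf{s}\in\otimes\mathrm{ws}(f)}$ in $\Lambda$, $f(\mathbf{a})$ is the constant word obtained by replacing each occurrence of $v_{\mathbf{s}}$ by $a_{\mathbf{s}}$; $[f]_\Lambda$ is the set of all such $f(\mathbf{a})$. A sequence $(f_i)$ of nonempty (constant or variable) words is compatible if $\mathrm{top}(f_i)=\mathrm{bot}(f_{i+1})$ for all consecutive indices. For compatible sequences of variable words, $[(f_i)_{i=0}^{q-1}]_\Lambda=\{g_0\cup\dots\cup g_{q-1}: g_i\in[f_i]_\Lambda\}$ and $[(f_i)_{i=0}^\infty]_\Lambda=\bigcup_{q\geq1}[(f_i)_{i=0}^{q-1}]_\Lambda$. Subspaces. A subspace of $\mathrm{W}(\Lambda,\mathbf{T})$ is a compatible infinite sequence $X=(f_i)_{i=0}^\infty$ in $\mathrm{W}_v(\Lambda,\mathbf{T})$ with $\mathrm{bot}(f_0)=0$ and such that $\mathrm{ws}(f_i)$ dominates $\mathbf{T}(i)$ for every $i$. $Y\leqslant X$ means $[Y]_\Lambda\subseteq[X]_\Lambda$. Infinite sequences of words. $\mathrm{W}^{[\infty]}(\Lambda,\mathbf{T})$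 is the set of all compatible sequences $(f_n)_{n=0}^\infty$ in $\mathrm{W}(\Lambda,\mathbf{T})\setminus\{\emptyset\}$ with $\mathrm{bot}(f_0)=0$, with the topology induced from the product topology on $\mathrm{W}(\Lambda,\mathbf{T})^\omega$, where $\mathrm{W}(\Lambda,\mathbf{T})$ is discrete. For a subspace $X$, $[X]^{[\infty]}_\Lambda$ is the set of all $(f_n)_{n=0}^\infty\in\mathrm{W}^{[\infty]}(\Lambda,\mathbf{T})$ such that $f_0\cup\dots\cup f_{n-1}\in[X]_\Lambda$ for every positive integer $n$. Souslin measurability. The Souslin measurable subsets of a topological space are the members of the smallest algebra of subsets that contains all open sets and is closed under the Souslin operation $(X_s)_{s\in\omega^{<\infty}}\mapsto\bigcup_{\sigma\in\omega^\omega}\bigcap_{n\in\omega}X_{\sigma\upharpoonright n}$. A coloring is Souslin measurable if the preimage of every color is Souslin measurable. *)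

theory Defs
  imports "HOL-Analysis.Analysis"
begin

section \<open>Trees\<close>

text \<open>A partially ordered set is given by its reflexive order relation \<open>T\<close>; its set of nodes is
  \<open>Field T\<close>.\<close>

definition max_chains :: "'a rel \<Rightarrow> 'a set set" where
  "max_chains T = {C \<in> Chains T. \<forall>D\<in>Chains T. C \<subseteq> D \<longrightarrow> D = C}"

definition imm_succs :: "'a rel \<Rightarrow> 'a \<Rightarrow> 'a set" where
  "imm_succs T t = {s \<in> aboveS T t. \<not> (\<exists>u\<in>aboveS T t. u \<noteq> s \<and> (u, s) \<in> T)}"

definition tree :: "'a rel \<Rightarrow> bool" where
  "tree T \<longleftrightarrow>
     Partial_order T \<and>
     (\<exists>r\<in>Field T. \<forall>t\<in>Field T. (r, t) \<in> T) \<and>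
     (\<forall>t\<in>Field T. finite (underS T t) \<and> well_order_on (underS T t) (Restr T (underS T t))) \<and>
     (\<forall>t\<in>Field T. aboveS T t \<noteq> {} \<longrightarrow> finite (imm_succs T t)) \<and>
     (\<forall>C\<in>max_chains T. \<forall>D\<in>max_chains T. C \<approx> D)"

definition infinite_height :: "'a rel \<Rightarrow> bool" where
  "infinite_height T \<longleftrightarrow> (\<forall>C\<in>max_chains T. C \<approx> (UNIV :: nat set))"

definition level :: "'a rel \<Rightarrow> nat \<Rightarrow> 'a set" where
  "level T n = {t \<in> Field T. card (underS T t) = n}"

definition dominates :: "'a rel \<Rightarrow> 'a set \<Rightarrow> 'a set \<Rightarrow> bool" where
  "dominates T D1 D2 \<longleftrightarrow> (\<forall>t\<in>D2. \<exists>s\<in>D1. (t, s) \<in> T)"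


section \<open>Vector trees\<close>

text \<open>The trees of a vector tree share one node type. This is no restriction: trees over different
  types embed into the sum of these types.\<close>

definition vector_tree :: "'a rel list \<Rightarrow> bool" where
  "vector_tree Ts \<longleftrightarrow>
     Ts \<noteq> [] \<and> (\<forall>T\<in>set Ts. tree T) \<and>
     (\<forall>S\<in>set Ts. \<forall>T\<in>set Ts. \<forall>C\<in>max_chains S. \<forall>D\<in>max_chains T. C \<approx> D)"

definition vector_infinite_height :: "'a rel list \<Rightarrow> bool" where
  "vector_infinite_height Ts \<longleftrightarrow> (\<forall>T\<in>set Ts. infinite_height T)"

definition vlevel :: "'a rel list \<Rightarrow> nat \<Rightarrow> 'a set list" where
  "vlevel Ts n = map (\<lambda>T. level T n) Ts"

definition level_product :: "'a rel list \<Rightarrow> 'a list set" where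
  "level_product Ts = (\<Union>n. listset (vlevel Ts n))"

definition product_order :: "'a rel list \<Rightarrow> 'a list rel" where
  "product_order Ts =
     {(s, t) \<in> level_product Ts \<times> level_product Ts. \<forall>i<length Ts. (s ! i, t ! i) \<in> Ts ! i}"

definition segment :: "'a rel list \<Rightarrow> nat \<Rightarrow> nat \<Rightarrow> 'a list set" where
  "segment Ts m n = (\<Union>k\<in>{m..<n}. listset (vlevel Ts k))"

definition product_levels :: "'a rel list \<Rightarrow> 'a list set \<Rightarrow> nat set" where
  "product_levels Ts A = {n. listset (vlevel Ts n) \<inter> A \<noteq> {}}"

definition vector_level_subset_at :: "'a rel list \<Rightarrow> nat \<Rightarrow> 'a set list \<Rightarrow> bool" where
  "vector_level_subset_at Ts n Ds \<longleftrightarrow> list_all2 (\<lambda>D T. D \<noteq> {} \<and> D \<subseteq> level T n) Ds Ts"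

definition vdominates :: "'a rel list \<Rightarrow> 'a set list \<Rightarrow> 'a set list \<Rightarrow> bool" where
  "vdominates Ts Ds Es \<longleftrightarrow> (\<forall>i<length Ts. dominates (Ts ! i) (Ds ! i) (Es ! i))"


section \<open>Words\<close>

text \<open>Words are partial functions on the level product. The symbol \<open>Var s\<close> is the variable
  \<open>v\<^sub>s\<close>.\<close>

datatype ('l, 'a) symbol = Letter 'l | Var "'a list"

type_synonym ('l, 'a) word = "'a list \<rightharpoonup> 'l"
type_synonym ('l, 'a) vword = "'a list \<rightharpoonup> ('l, 'a) symbol"

definition words_between :: "'l set \<Rightarrow> 'a rel list \<Rightarrow> nat \<Rightarrow> nat \<Rightarrow> ('l, 'a) word set" where
  "words_between L Ts m n = {f. dom f = segment Ts m n \<and> ran f \<subseteq> L}"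

definition words :: "'l set \<Rightarrow> 'a rel list \<Rightarrow> ('l, 'a) word set" where
  "words L Ts = (\<Union>m. \<Union>n\<in>{m..}. words_between L Ts m n)"

definition occurrences :: "('l, 'a) vword \<Rightarrow> 'a list \<Rightarrow> 'a list set" where
  "occurrences f s = {t. f t = Some (Var s)}"

definition vwords_between ::
  "'l set \<Rightarrow> 'a rel list \<Rightarrow> 'a set list \<Rightarrow> nat \<Rightarrow> nat \<Rightarrow> ('l, 'a) vword set" where
  "vwords_between L Ts Ds m n =
     {f. dom f = segment Ts m n \<and> ran f \<subseteq> Letter ` L \<union> Var ` listset Ds \<and>
         (\<forall>s\<in>listset Ds. occurrences f s \<noteq> {} \<and> s \<in> occurrences f s \<and>
            (\<forall>t\<in>occurrences f s. (s, t) \<in> product_order Ts)) \<and>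
         (\<forall>s\<in>listset Ds. \<forall>s'\<in>listset Ds.
            product_levels Ts (occurrences f s) = product_levels Ts (occurrences f s'))}"

definition is_vword_with ::
  "'l set \<Rightarrow> 'a rel list \<Rightarrow> 'a set list \<Rightarrow> ('l, 'a) vword \<Rightarrow> bool" where
  "is_vword_with L Ts Ds f \<longleftrightarrow>
     (\<exists>m n. m < n \<and> (\<exists>k\<in>{m..<n}. vector_level_subset_at Ts k Ds) \<and>
            f \<in> vwords_between L Ts Ds m n)"

definition vwords :: "'l set \<Rightarrow> 'a rel list \<Rightarrow> ('l, 'a) vword set" where
  "vwords L Ts = {f. \<exists>Ds. is_vword_with L Ts Ds f}"

definition ws :: "'l set \<Rightarrow> 'a rel list \<Rightarrow> ('l, 'a) vword \<Rightarrow> 'a set list" where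
  "ws L Ts f = (THE Ds. is_vword_with L Ts Ds f)"

definition word_bot :: "'a rel list \<Rightarrow> ('a list \<rightharpoonup> 'b) \<Rightarrow> nat" where
  "word_bot Ts f = (THE m. \<exists>n. m < n \<and> dom f = segment Ts m n)"

definition word_top :: "'a rel list \<Rightarrow> ('a list \<rightharpoonup> 'b) \<Rightarrow> nat" where
  "word_top Ts f = (THE n. \<exists>m. m < n \<and> dom f = segment Ts m n)"

definition compatible :: "'a rel list \<Rightarrow> (nat \<Rightarrow> 'a list \<rightharpoonup> 'b) \<Rightarrow> bool" where
  "compatible Ts f \<longleftrightarrow> (\<forall>i. word_top Ts (f i) = word_bot Ts (f (Suc i)))"


section \<open>Spans and subspaces\<close>

definition subst_word :: "('l, 'a) vword \<Rightarrow> ('a list \<Rightarrow> 'l) \<Rightarrow> ('l, 'a) word" where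
  "subst_word f a =
     (\<lambda>t. map_option (\<lambda>x. case x of Letter l \<Rightarrow> l | Var s \<Rightarrow> a s) (f t))"

definition span1 :: "'l set \<Rightarrow> 'a rel list \<Rightarrow> ('l, 'a) vword \<Rightarrow> ('l, 'a) word set" where
  "span1 L Ts f = {subst_word f a |a. a \<in> listset (ws L Ts f) \<rightarrow> L}"

text \<open>The union of the first \<open>q\<close> words of a sequence. It is only used for words with pairwise
  disjoint domains, where overriding is the union of partial functions.\<close>

primrec join :: "(nat \<Rightarrow> 'a list \<rightharpoonup> 'b) \<Rightarrow> nat \<Rightarrow> ('a list \<rightharpoonup> 'b)" where
  "join g 0 = Map.empty"
| "join g (Suc q) = join g q ++ g q"

definition word_span_upto ::
  "'l set \<Rightarrow> 'a rel list \<Rightarrow> (nat \<Rightarrow> ('l, 'a) vword) \<Rightarrow> nat \<Rightarrow> ('l, 'a) word set" where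
  "word_span_upto L Ts f q = {join g q |g. \<forall>i<q. g i \<in> span1 L Ts (f i)}"

definition word_span :: "'l set \<Rightarrow> 'a rel list \<Rightarrow> (nat \<Rightarrow> ('l, 'a) vword) \<Rightarrow> ('l, 'a) word set" where
  "word_span L Ts f = (\<Union>q\<in>{1..}. word_span_upto L Ts f q)"

definition word_subspace :: "'l set \<Rightarrow> 'a rel list \<Rightarrow> (nat \<Rightarrow> ('l, 'a) vword) \<Rightarrow> bool" where
  "word_subspace L Ts X \<longleftrightarrow>
     (\<forall>i. X i \<in> vwords L Ts) \<and> compatible Ts X \<and> word_bot Ts (X 0) = 0 \<and>
     (\<forall>i. vdominates Ts (ws L Ts (X i)) (vlevel Ts i))"

definition subspace_le ::
  "'l set \<Rightarrow> 'a rel list \<Rightarrow> (nat \<Rightarrow> ('l, 'a) vword) \<Rightarrow> (nat \<Rightarrow> ('l, 'a) vword) \<Rightarrow> bool" where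
  "subspace_le L Ts Y X \<longleftrightarrow> word_span L Ts Y \<subseteq> word_span L Ts X"


section \<open>Infinite sequences of words\<close>

definition word_seqs :: "'l set \<Rightarrow> 'a rel list \<Rightarrow> (nat \<Rightarrow> ('l, 'a) word) set" where
  "word_seqs L Ts =
     {f. (\<forall>n. f n \<in> words L Ts - {Map.empty}) \<and> compatible Ts f \<and> word_bot Ts (f 0) = 0}"

definition word_seq_topology ::
  "'l set \<Rightarrow> 'a rel list \<Rightarrow> (nat \<Rightarrow> ('l, 'a) word) topology" where
  "word_seq_topology L Ts =
     subtopology (product_topology (\<lambda>_. discrete_topology (words L Ts)) UNIV) (word_seqs L Ts)"

definition span_seqs ::
  "'l set \<Rightarrow> 'a rel list \<Rightarrow> (nat \<Rightarrow> ('l, 'a) vword) \<Rightarrow> (nat \<Rightarrow> ('l, 'a) word) set" where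
  "span_seqs L Ts X = {f \<in> word_seqs L Ts. \<forall>n>0. join f n \<in> word_span L Ts X}"


section \<open>Souslin measurability\<close>

definition souslin_operation :: "(nat list \<Rightarrow> 'b set) \<Rightarrow> 'b set" where
  "souslin_operation A = (\<Union>\<sigma> :: nat \<Rightarrow> nat. \<Inter>n. A (map \<sigma> [0..<n]))"

definition souslin_sets :: "'b topology \<Rightarrow> 'b set set" where
  "souslin_sets X =
     \<Inter>{M. algebra (topspace X) M \<and> {U. openin X U} \<subseteq> M \<and>
          (\<forall>A. range A \<subseteq> M \<longrightarrow> souslin_operation A \<in> M)}"

definition souslin_coloring :: "'b topology \<Rightarrow> ('b \<Rightarrow> 'c) \<Rightarrow> bool" where
  "souslin_coloring X c \<longleftrightarrow> (\<forall>k. {x \<in> topspace X. c x = k} \<in> souslin_sets X)"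


section \<open>Well-definedness\<close>

lemma topspace_word_seq_topology [simp]:
  "topspace (word_seq_topology L Ts) = word_seqs L Ts"
  by (auto simp: word_seq_topology_def word_seqs_def)

lemma algebra_souslin_sets: "algebra (topspace X) (souslin_sets X)"
proof -
  have pow: "Pow (topspace X) \<in> {M. algebra (topspace X) M \<and> {U. openin X U} \<subseteq> M \<and>
          (\<forall>A. range A \<subseteq> M \<longrightarrow> souslin_operation A \<in> M)}"
  proof -
    have "souslin_operation A \<in> Pow (topspace X)" if "range A \<subseteq> Pow (topspace X)" for A
      using that unfolding souslin_operation_def by blast
    then show ?thesis
      using openin_subset[of X] by (auto simp: algebra_Pow)
  qed
  show ?thesis
    unfolding algebra_iff_Un
  proof (intro conjI ballI)
    show "souslin_sets X \<subseteq> Pow (topspace X)"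
      unfolding souslin_sets_def using pow by (rule Inter_lower)
  qed (auto simp: souslin_sets_def algebra_iff_Un)
qed

lemma openin_souslin_sets: "openin X U \<Longrightarrow> U \<in> souslin_sets X"
  by (auto simp: souslin_sets_def)

lemma souslin_operation_souslin_sets:
  "range A \<subseteq> souslin_sets X \<Longrightarrow> souslin_operation A \<in> souslin_sets X"
  unfolding souslin_sets_def by blast

lemma in_listset_iff:
  "s \<in> listset As \<longleftrightarrow> length s = length As \<and> (\<forall>i<length As. s ! i \<in> As ! i)"
proof (induction As arbitrary: s)
  case (Cons A As)
  show ?case
  proof (cases s)
    case (Cons x xs)
    have "(\<forall>i<length (A # As). (x # xs) ! i \<in> (A # As) ! i) \<longleftrightarrow>
        x \<in> A \<and> (\<forall>i<length As. xs ! i \<in> As ! i)"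
      by (simp only: length_Cons All_less_Suc2 nth_Cons_0 nth_Cons_Suc)
    then show ?thesis using Cons.IH[of xs] Cons by (auto simp: set_Cons_def)
  qed (auto simp: set_Cons_def)
qed auto

lemma listset_eqD:
  assumes eq: "listset As = listset Bs"
    and As: "\<forall>i<length As. As ! i \<noteq> {}" and Bs: "\<forall>i<length Bs. Bs ! i \<noteq> {}"
  shows "As = Bs"
proof -
  have sub: "length As = length Bs \<and> (\<forall>i<length As. As ! i \<subseteq> Bs ! i)"
    if eq: "listset As = listset Bs" and As: "\<forall>i<length As. As ! i \<noteq> {}" for As Bs :: "'a set list"
  proof -
    define s where "s = map (\<lambda>A. SOME x. x \<in> A) As"
    have s: "s \<in> listset As"
      using As by (auto simp: in_listset_iff s_def some_in_eq)
    then have len: "length As = length Bs"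
      using eq in_listset_iff by metis
    moreover have "x \<in> Bs ! i" if "i < length As" "x \<in> As ! i" for i x
    proof -
      have "s[i := x] \<in> listset As"
        using s that by (auto simp: in_listset_iff nth_list_update)
      then have "s[i := x] \<in> listset Bs" using eq by simp
      moreover have "length s = length As" using s by (simp add: in_listset_iff)
      ultimately show ?thesis
        using that len by (metis in_listset_iff nth_list_update_eq)
    qed
    ultimately show ?thesis by blast
  qed
  show ?thesis
    using sub[OF eq As] sub[OF eq[symmetric] Bs] by (intro nth_equalityI) auto
qed

lemma ws_eq:
  assumes "is_vword_with L Ts Ds f"
  shows "ws L Ts f = Ds"
  unfolding ws_def
proof (rule the_equality)
  have *: "listset Es = {s. Var s \<in> ran f} \<and> (\<forall>i<length Es. Es ! i \<noteq> {})"
    if "is_vword_with L Ts Es f" for Es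
    using that
    by (fastforce simp: is_vword_with_def vwords_between_def occurrences_def ran_def
        vector_level_subset_at_def list_all2_conv_all_nth)
  show "Es = Ds" if "is_vword_with L Ts Es f" for Es
    using *[OF that] *[OF assms] by (intro listset_eqD) auto
qed fact

lemma tree_under_total:
  assumes T: "tree T" and "(y, x) \<in> T" "(z, x) \<in> T"
  shows "(y, z) \<in> T \<or> (z, y) \<in> T"
proof -
  have x: "x \<in> Field T" and po: "Partial_order T" and f: "y \<in> Field T"
    using assms by (auto simp: tree_def Field_def)
  have "total_on (underS T x) (Restr T (underS T x))"
    using T x by (auto simp: tree_def well_order_on_def linear_order_on_def)
  moreover have "(y, y) \<in> T"
    using po f by (auto simp: partial_order_on_def preorder_on_def refl_on_def)
  ultimately show ?thesis
    using assms(2,3) by (cases "y = x"; cases "z = x"; cases "y = z")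
      (auto simp: total_on_def underS_def)
qed

lemma level_nonempty:
  assumes T: "tree T" and inf: "infinite_height T"
  shows "level T n \<noteq> {}"
proof -
  have refl: "\<And>x. x \<in> Field T \<Longrightarrow> (x, x) \<in> T" and trans: "trans T" and anti: "antisym T"
    using T by (auto simp: tree_def partial_order_on_def preorder_on_def refl_on_def)
  have fin: "finite (underS T x)" if "x \<in> Field T" for x
    using T that by (auto simp: tree_def)
  have strict: "underS T x \<subset> underS T y" if "(x, y) \<in> T" "x \<noteq> y" for x y
    using that trans anti by (auto simp: underS_def trans_def antisym_def)
  have "\<exists>C. C \<in> max_chains T"
  proof -
    have "\<exists>M\<in>Chains T. \<forall>X\<in>Chains T. M \<subseteq> X \<longrightarrow> X = M"
    proof (rule subset_Zorn_nonempty)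
      show "Chains T \<noteq> {}" by (auto simp: Chains_def)
      fix K assume K: "K \<noteq> {}" "subset.chain (Chains T) K"
      have "(a, b) \<in> T \<or> (b, a) \<in> T" if ab: "a \<in> A" "A \<in> K" "b \<in> B" "B \<in> K" for a b A B
      proof -
        have "A \<subseteq> B \<or> B \<subseteq> A" and "A \<in> Chains T" "B \<in> Chains T"
          using K(2) ab by (auto simp: subset_chain_def)
        then show ?thesis
          using ab(1,3) unfolding Chains_def by blast
      qed
      then show "\<Union>K \<in> Chains T"
        unfolding Chains_def by blast
    qed
    then show ?thesis by (auto simp: max_chains_def)
  qed
  then obtain C where C: "C \<in> max_chains T" by blast
  then have ch: "C \<in> Chains T" and "infinite C"
    using inf by (auto simp: max_chains_def infinite_height_def eqpoll_finite_iff)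
  have CF: "C \<subseteq> Field T" using ch by (auto simp: Chains_def Field_def)
  have card_less: "card (underS T x) < card (underS T y)" if "(x, y) \<in> T" "x \<noteq> y" for x y
  proof (rule psubset_card_mono)
    show "finite (underS T y)" using that by (intro fin) (auto simp: Field_def)
  qed (use strict that in blast)
  have "inj_on (\<lambda>x. card (underS T x)) C"
  proof (rule inj_onI, rule ccontr)
    fix x y assume xy: "x \<in> C" "y \<in> C" "card (underS T x) = card (underS T y)" "x \<noteq> y"
    then consider "(x, y) \<in> T" | "(y, x) \<in> T" using ch by (auto simp: Chains_def)
    then show False
      using xy card_less by cases fastforce+
  qed
  then have "infinite ((\<lambda>x. card (underS T x)) ` C)"
    using \<open>infinite C\<close> finite_imageD by blast
  then obtain x where x: "x \<in> C" "n \<le> card (underS T x)"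
    unfolding infinite_nat_iff_unbounded_le by blast
  have "n \<le> card (underS T x) \<Longrightarrow> x \<in> Field T \<Longrightarrow> level T n \<noteq> {}" for x
  proof (induction "card (underS T x)" arbitrary: x rule: less_induct)
    case (less x)
    show ?case
    proof (cases "card (underS T x) = n")
      case True
      then show ?thesis using less by (auto simp: level_def)
    next
      case False
      define h where "h = (\<lambda>z. card (underS T z))"
      have f: "finite (underS T x)" using fin less by blast
      have ne: "underS T x \<noteq> {}" using less False by auto
      have "Max (h ` underS T x) \<in> h ` underS T x"
        using f ne by (intro Max_in) auto
      then obtain y where y: "y \<in> underS T x" and hy: "h y = Max (h ` underS T x)"
        by auto
      have ymax: "h z \<le> h y" if "z \<in> underS T x" for z
        unfolding hy using f that by (intro Max_ge) auto
      have yF: "y \<in> Field T" and yx: "(y, x) \<in> T" "y \<noteq> x" using y by (auto simp: underS_def Field_def)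
      have "underS T x \<subseteq> insert y (underS T y)"
      proof
        fix z assume z: "z \<in> underS T x"
        then have "(y, z) \<in> T \<or> (z, y) \<in> T"
          using tree_under_total[OF T yx(1)] by (auto simp: underS_def)
        then show "z \<in> insert y (underS T y)"
          using ymax[OF z] card_less[of y z] by (auto simp: underS_def h_def)
      qed
      then have "card (underS T x) \<le> card (insert y (underS T y))"
        using fin[OF yF] by (intro card_mono) auto
      also have "\<dots> = Suc (card (underS T y))"
        using fin[OF yF] by (subst card_insert_disjoint) (auto simp: underS_def)
      finally have "n \<le> card (underS T y)" using False less.prems by linarith
      then show ?thesis using less.hyps[OF card_less[OF yx]] yF by blast
    qed
  qed
  then show ?thesis using x CF by blast
qed

lemma product_level_nonempty:
  assumes "vector_tree Ts" "vector_infinite_height Ts"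
  shows "listset (vlevel Ts n) \<noteq> {}"
proof -
  have "level (Ts ! i) n \<noteq> {}" if "i < length Ts" for i
    using assms level_nonempty nth_mem[OF that]
    unfolding vector_tree_def vector_infinite_height_def by blast
  then have "map (\<lambda>T. SOME x. x \<in> level T n) Ts \<in> listset (vlevel Ts n)"
    by (auto simp: in_listset_iff vlevel_def some_in_eq)
  then show ?thesis by blast
qed

lemma product_levels_segment:
  assumes "vector_tree Ts" "vector_infinite_height Ts"
  shows "product_levels Ts (segment Ts m n) = {m..<n}"
proof -
  have "k = l" if "s \<in> listset (vlevel Ts k)" "s \<in> listset (vlevel Ts l)" for s k l
    using that assms(1) by (cases Ts) (auto simp: vector_tree_def vlevel_def level_def set_Cons_def)
  then show ?thesis
    using product_level_nonempty[OF assms] by (fastforce simp: product_levels_def segment_def)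
qed

lemma segment_eqD:
  assumes "vector_tree Ts" "vector_infinite_height Ts"
    and "segment Ts m n = segment Ts m' n'" "m < n" "m' < n'"
  shows "m = m' \<and> n = n'"
  using assms product_levels_segment by (metis atLeastLessThan_eq_iff)

lemma word_bot_eq:
  assumes "vector_tree Ts" "vector_infinite_height Ts" "m < n" "dom f = segment Ts m n"
  shows "word_bot Ts f = m"
proof -
  have "m' = m \<and> n' = n" if "m' < n'" "dom f = segment Ts m' n'" for m' n'
    using segment_eqD[OF assms(1,2) _ that(1) assms(3)] that(2) assms(4) by simp
  then show ?thesis
    unfolding word_bot_def using assms(3,4) by (intro the_equality) blast+
qed

lemma word_top_eq:
  assumes "vector_tree Ts" "vector_infinite_height Ts" "m < n" "dom f = segment Ts m n"
  shows "word_top Ts f = n"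
proof -
  have "m' = m \<and> n' = n" if "m' < n'" "dom f = segment Ts m' n'" for m' n'
    using segment_eqD[OF assms(1,2) _ that(1) assms(3)] that(2) assms(4) by simp
  then show ?thesis
    unfolding word_top_def using assms(3,4) by (intro the_equality) blast+
qed

end

theory Submission
  imports Defs
begin

text \<open>
  The proof separates the trees from the combinatorics of words.

  \<^bold>\<open>Trees.\<close> Let \<open>D\<^sub>j\<close> be the wildcard sets of the given subspace. Every level of a tree of infinite
  height is finite and every node extends to all higher levels, so among the blocks of the subspace
  one can select indices \<open>J 0 < J 1 < \<dots>\<close> such that every node of a selected \<open>D\<^sub>j\<close> has an extension
  in the next selected one. Hence each node of level \<open>i\<close> starts a thread, that is, an increasing
  sequence of nodes through all later selected wildcard sets, and the threads of the components
  single out a copy of \<open>\<otimes>T(i)\<close> in each later selected \<open>\<otimes>D\<^sub>j\<close>. A function \<open>a : \<otimes>T(i) \<rightarrow> \<Lambda>\<close> can now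
  be written on a block: the variables of the copy get the values of \<open>a\<close>, all other variables get one
  fixed letter. With the functions \<open>a\<close> as letters of a new kind, a word over the tree is coded by a
  word over an increasing sequence of finite alphabets \<open>A\<^sub>0 \<subseteq> A\<^sub>1 \<subseteq> \<dots>\<close>, where the letters at position
  \<open>j\<close> come from \<open>A\<^sub>j\<close> and the variable of a word that starts at \<open>m\<close> ranges over \<open>A\<^sub>m\<close>. Since a thread
  is increasing, a variable word of this kind decodes to a variable word of the tree, and its wildcard
  set dominates \<open>T(m)\<close>. The \<open>i\<close>-th word of a compatible sequence starts at a position \<open>m \<ge> i\<close>, so
  sequences of coded variable words decode to subspaces (\<open>decode_vword\<close>, \<open>decode_subspace\<close>), and every
  sequence in the span is decoded from a sequence of coded words (\<open>span_seqs_decode\<close>). All this takes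
  place below one coded space (\<open>base_space\<close>), which has its variables at the selected positions only.

  \<^bold>\<open>Colorings of words.\<close> For increasing alphabets, every set \<open>C\<close> of constant words that start at \<open>N\<close> is
  decided by some subspace: either all of its words that start at \<open>N\<close> are in \<open>C\<close>, or none is
  (\<open>pigeonhole_words\<close>). If no subspace avoids \<open>C\<close>, then \<open>C\<close> is large, and one builds a subspace inside
  \<open>C\<close> block by block. The step is that largeness of a set \<open>D\<close> is inherited by
  \<open>{v. g(a) \<odot> v \<in> D for all letters a}\<close> for some variable word \<open>g\<close> (\<open>large_residual\<close>). Otherwise fusion gives
  a subspace on which this set is avoided for all \<open>g\<close> at once, and the Hales-Jewett theorem then builds a
  further subspace that avoids \<open>D\<close>.

  \<^bold>\<open>Colorings of sequences.\<close> Call a set of sequences of words Ramsey if, after any finite sequence,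
  every subspace has a subspace whose sequences all belong to the set or all miss it. By the
  pigeonhole principle and a Galvin-Prikry argument open sets are Ramsey (\<open>ramsey_seq_open\<close>). Fusion
  gives countable unions (\<open>ramsey_UN\<close>) and, by way of hulls that differ from the given sets only in
  sets that can be avoided, the Souslin operation (\<open>ramsey_souslin\<close>). So all Souslin measurable sets are
  Ramsey, and finitely many of them, one for each color, are decided by a common subspace.
\<close>

section \<open>The Hales-Jewett theorem\<close>

text \<open>Words are lists over \<^typ>\<open>'b option\<close>, in which \<^const>\<open>None\<close> is the variable.\<close>

definition fill :: "'b \<Rightarrow> 'b option list \<Rightarrow> 'b option list" where
  "fill a w = map (\<lambda>x. Some (case x of None \<Rightarrow> a | Some b \<Rightarrow> b)) w"

definition part :: "'b option \<Rightarrow> 'b option list \<Rightarrow> 'b option list" where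
  "part x w = (case x of None \<Rightarrow> w | Some a \<Rightarrow> fill a w)"

definition assemble :: "'b option list \<Rightarrow> 'b option list list \<Rightarrow> 'b option list" where
  "assemble xs gs = concat (map2 part xs gs)"

lemma fill_simps [simp]:
  "fill a [] = []" "fill a (x # w) = Some (case x of None \<Rightarrow> a | Some b \<Rightarrow> b) # fill a w"
  "fill a (v @ w) = fill a v @ fill a w" "length (fill a w) = length w"
  "fill a (fill b w) = fill b w"
  by (simp_all add: fill_def)

lemma None_notin_fill [simp]: "None \<notin> set (fill a w)"
  by (auto simp: fill_def)

lemma set_fill: "set w \<subseteq> insert None (Some ` A) \<Longrightarrow> a \<in> A \<Longrightarrow> set (fill a w) \<subseteq> Some ` A"
  by (induction w) auto

lemma assemble_snoc:
  "length xs = length gs \<Longrightarrow> assemble (xs @ [x]) (gs @ [g]) = assemble xs gs @ part x g"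
  by (simp add: assemble_def)

lemma fill_part [simp]: "fill a (part x g) = part (Some (case x of None \<Rightarrow> a | Some b \<Rightarrow> b)) g"
  by (cases x) (auto simp: part_def)

lemma length_part [simp]: "length (part x g) = length g"
  by (auto simp: part_def split: option.split)

lemma fill_assemble: "fill a (assemble xs gs) = assemble (fill a xs) gs"
proof (induction xs arbitrary: gs)
  case (Cons x xs)
  then show ?case by (cases gs) (auto simp: assemble_def)
qed (simp add: assemble_def)

definition template :: "'b set \<Rightarrow> 'b option list \<Rightarrow> bool" where
  "template A g \<longleftrightarrow> None \<in> set g \<and> set g \<subseteq> insert None (Some ` A)"

text \<open>\<open>L\<close> is a Hales-Jewett number of the alphabet \<open>A\<close> for \<open>r\<close> colors. The colorings are total on lists,
  which spares side conditions when they are restricted or combined.\<close>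
definition line_bound :: "'b set \<Rightarrow> nat \<Rightarrow> nat \<Rightarrow> bool" where
  "line_bound A r L \<longleftrightarrow> (\<forall>c::'b option list \<Rightarrow> nat. (\<forall>w. c w < r) \<longrightarrow>
     (\<exists>g. length g = L \<and> template A g \<and> (\<forall>a\<in>A. \<forall>a'\<in>A. c (fill a g) = c (fill a' g))))"

text \<open>In each block of \<open>gs\<close> separately, the letters of \<open>A\<close> are interchangeable for \<open>c\<close>; the color depends
  only on the set of blocks that carry the additional letter \<open>b\<close>.\<close>
definition insensitive ::
  "'b set \<Rightarrow> 'b \<Rightarrow> ('b option list \<Rightarrow> nat) \<Rightarrow> 'b option list list \<Rightarrow> bool" where
  "insensitive A b c gs \<longleftrightarrow> (\<forall>xs ys. set xs \<subseteq> Some ` insert b A \<longrightarrow> set ys \<subseteq> Some ` insert b A \<longrightarrow>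
     list_all2 (\<lambda>x y. x = y \<or> x \<in> Some ` A \<and> y \<in> Some ` A) xs ys \<longrightarrow> length xs = length gs \<longrightarrow>
     c (assemble xs gs) = c (assemble ys gs))"

definition insensitive_bound :: "'b set \<Rightarrow> 'b \<Rightarrow> nat \<Rightarrow> nat \<Rightarrow> nat \<Rightarrow> bool" where
  "insensitive_bound A b n r L \<longleftrightarrow> (\<forall>c::'b option list \<Rightarrow> nat. (\<forall>w. c w < r) \<longrightarrow>
     (\<exists>gs. length gs = n \<and> length (concat gs) = L \<and> (\<forall>g\<in>set gs. template A g) \<and> insensitive A b c gs))"

lemma length_assemble: "length xs = length gs \<Longrightarrow> length (assemble xs gs) = length (concat gs)"
  by (induction xs gs rule: list_induct2) (auto simp: assemble_def)

lemma set_part: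
  assumes "set g \<subseteq> insert None (Some ` B)" "x \<in> insert None (Some ` B)"
  shows "set (part x g) \<subseteq> insert None (Some ` B)" "x \<noteq> None \<Longrightarrow> set (part x g) \<subseteq> Some ` B"
proof -
  show "set (part x g) \<subseteq> insert None (Some ` B)"
    using assms set_fill[OF assms(1)] by (cases x) (auto simp: part_def subset_iff)
  show "set (part x g) \<subseteq> Some ` B" if "x \<noteq> None"
    using assms set_fill[OF assms(1)] that by (cases x) (auto simp: part_def subset_iff)
qed

lemma set_assemble:
  assumes "\<forall>g\<in>set gs. set g \<subseteq> insert None (Some ` B)" "set xs \<subseteq> insert None (Some ` B)"
  shows "set (assemble xs gs) \<subseteq> insert None (Some ` B)" "None \<notin> set xs \<Longrightarrow> set (assemble xs gs) \<subseteq> Some ` B"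
proof -
  have "set (assemble xs gs) \<subseteq> insert None (Some ` B) \<and>
    (None \<notin> set xs \<longrightarrow> set (assemble xs gs) \<subseteq> Some ` B)"
    using assms
  proof (induction xs arbitrary: gs)
    case (Cons x xs)
    show ?case
    proof (cases gs)
      case (Cons g hs)
      have x: "x \<in> insert None (Some ` B)" and g: "set g \<subseteq> insert None (Some ` B)"
        using Cons.prems Cons by auto
      have "set (assemble xs hs) \<subseteq> insert None (Some ` B) \<and>
        (None \<notin> set xs \<longrightarrow> set (assemble xs hs) \<subseteq> Some ` B)"
        using Cons.prems Cons by (intro Cons.IH) auto
      moreover have "set (part x g) \<subseteq> Some ` B" if "None \<noteq> x"
        using set_part(2)[OF g x] that by auto
      moreover have "set (assemble (x # xs) gs) = set (part x g) \<union> set (assemble xs hs)"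
        using Cons by (simp add: assemble_def)
      ultimately show ?thesis using set_part(1)[OF g x] by auto
    qed (simp add: assemble_def)
  qed (simp add: assemble_def)
  then show "set (assemble xs gs) \<subseteq> insert None (Some ` B)" "None \<notin> set xs \<Longrightarrow> set (assemble xs gs) \<subseteq> Some ` B"
    by blast+
qed

text \<open>A finite family of bounded colorings is one bounded coloring, and the new bound depends only on
  the index set and the old bound. This matters below, where a length has to be fixed before the colorings are known.\<close>
lemma encode_family:
  assumes "finite Q"
  obtains e :: "('q \<Rightarrow> nat) \<Rightarrow> nat" and R where "\<And>f. \<forall>q. f q < r \<Longrightarrow> e f < R"
    "\<And>f f' q. \<forall>q. f q < r \<Longrightarrow> \<forall>q. f' q < r \<Longrightarrow> e f = e f' \<Longrightarrow> q \<in> Q \<Longrightarrow> f q = f' q"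
proof -
  let ?K = "PiE Q (\<lambda>_. {..<r})"
  have "finite ?K" using assms by (intro finite_PiE) auto
  from finite_imp_inj_to_nat_seg[OF this]
  obtain h :: "('q \<Rightarrow> nat) \<Rightarrow> nat" and R where h: "h ` ?K = {i. i < R}" "inj_on h ?K"
    by (elim exE conjE)
  have K: "restrict f Q \<in> ?K" if "\<forall>q. f q < r" for f
    using that by (simp add: restrict_PiE_iff)
  show ?thesis
  proof (rule that)
    show "h (restrict f Q) < R" if "\<forall>q. f q < r" for f
      using h(1) K[OF that] by (metis (no_types, lifting) image_eqI mem_Collect_eq)
    fix f f' :: "'q \<Rightarrow> nat" and q
    assume a: "\<forall>q. f q < r" "\<forall>q. f' q < r" "h (restrict f Q) = h (restrict f' Q)" "q \<in> Q"
    have "restrict f Q = restrict f' Q"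
      using h(2) a(3) K[OF a(1)] K[OF a(2)] by (rule inj_onD)
    then show "f q = f' q" using a(4) by (metis restrict_apply')
  qed
qed

text \<open>The blocks are chosen from the last one to the first one, but their lengths are fixed in the opposite
  order: the last block must be long enough to be insensitive in front of every word of the total length
  \<open>L'\<close> of the other blocks, and the other blocks are found for the coloring of words \<open>p\<close> by the family
  \<open>c (p @ fill x g)\<close>, whose number of colors depends only on \<open>r\<close>, \<open>A\<close> and \<open>b\<close>.\<close>
lemma insensitive_blocks:
  fixes A :: "'b set"
  assumes fin: "finite A" and HJ: "\<And>r. \<exists>L. line_bound A r L"
  shows "\<exists>L. insensitive_bound A b n r L"
proof (induction n arbitrary: r)
  case 0
  show ?case by (intro exI[of _ 0]) (simp add: insensitive_bound_def insensitive_def assemble_def)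
next
  case (Suc n)
  let ?B = "insert b A"
  have finB: "finite ?B" using fin by simp
  obtain e2 :: "('b \<Rightarrow> nat) \<Rightarrow> nat" and R2 where
    e2: "\<And>f. \<forall>q. f q < r \<Longrightarrow> e2 f < R2"
    "\<And>f f' q. \<forall>q. f q < r \<Longrightarrow> \<forall>q. f' q < r \<Longrightarrow> e2 f = e2 f' \<Longrightarrow> q \<in> ?B \<Longrightarrow> f q = f' q"
    using encode_family[OF finB, of r] by blast
  obtain L' where L': "insensitive_bound A b n R2 L'" using Suc.IH by blast
  let ?Q = "{q. set q \<subseteq> Some ` ?B \<and> length q = L'}"
  have "finite ?Q" using fin by (intro finite_lists_length_eq) auto
  then obtain e1 :: "('b option list \<Rightarrow> nat) \<Rightarrow> nat" and R1 where
    e1: "\<And>f. \<forall>q. f q < r \<Longrightarrow> e1 f < R1"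
    "\<And>f f' q. \<forall>q. f q < r \<Longrightarrow> \<forall>q. f' q < r \<Longrightarrow> e1 f = e1 f' \<Longrightarrow> q \<in> ?Q \<Longrightarrow> f q = f' q"
    using encode_family[of ?Q r] by blast
  obtain N where N: "line_bound A R1 N" using HJ by blast
  have "insensitive_bound A b (Suc n) r (L' + N)"
    unfolding insensitive_bound_def
  proof (intro allI impI)
    fix c :: "'b option list \<Rightarrow> nat" assume c: "\<forall>w. c w < r"
    have "e1 (\<lambda>q. c (q @ w)) < R1" for w by (rule e1(1)) (simp add: c)
    then obtain g where g: "length g = N" "template A g"
      and g_eq: "\<And>a a'. a \<in> A \<Longrightarrow> a' \<in> A \<Longrightarrow>
        e1 (\<lambda>q. c (q @ fill a g)) = e1 (\<lambda>q. c (q @ fill a' g))"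
      using N[unfolded line_bound_def, rule_format, of "\<lambda>w. e1 (\<lambda>q. c (q @ w))"] by auto
    let ?c2 = "\<lambda>p. e2 (\<lambda>x. c (p @ fill x g))"
    have "?c2 p < R2" for p by (rule e2(1)) (simp add: c)
    then obtain gs where gs: "length gs = n" "length (concat gs) = L'" "\<forall>g\<in>set gs. template A g"
      and gs_eq: "insensitive A b ?c2 gs"
      using L'[unfolded insensitive_bound_def, rule_format, of ?c2] by auto
    have "insensitive A b c (gs @ [g])"
      unfolding insensitive_def
    proof (intro allI impI)
      fix xs ys :: "'b option list"
      assume xy: "set xs \<subseteq> Some ` ?B" "set ys \<subseteq> Some ` ?B"
        and rel: "list_all2 (\<lambda>x y. x = y \<or> x \<in> Some ` A \<and> y \<in> Some ` A) xs ys"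
        and len: "length xs = length (gs @ [g])"
      obtain xs' x where xs: "xs = xs' @ [Some x]" "length xs' = length gs"
        using xy(1) len by (cases xs rule: rev_cases) auto
      obtain ys' y where ys: "ys = ys' @ [Some y]"
        using xy(2) rel xs by (cases ys rule: rev_cases) auto
      have rel': "list_all2 (\<lambda>x y. x = y \<or> x \<in> Some ` A \<and> y \<in> Some ` A) xs' ys'"
        and x: "x = y \<or> x \<in> A \<and> y \<in> A"
        using rel xs ys list_all2_lengthD[OF rel] by (auto simp: list_all2_append)
      have ly: "length ys' = length gs" using rel' xs(2) by (auto dest: list_all2_lengthD)
      have xB: "x \<in> ?B" using xy(1) xs by auto
      have "?c2 (assemble xs' gs) = ?c2 (assemble ys' gs)"
        using gs_eq[unfolded insensitive_def, rule_format, of xs' ys'] rel' xy xs ys by simp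
      then have 1: "c (assemble xs' gs @ fill x g) = c (assemble ys' gs @ fill x g)"
        using e2(2)[of "\<lambda>x. c (assemble xs' gs @ fill x g)" "\<lambda>x. c (assemble ys' gs @ fill x g)" x]
          c xB by blast
      have "set (assemble ys' gs) \<subseteq> Some ` ?B"
        using gs(3) xy(2) ys by (intro set_assemble(2)) (auto simp: template_def)
      moreover have "length (assemble ys' gs) = L'"
        using ly gs by (simp add: length_assemble)
      ultimately have Q: "assemble ys' gs \<in> ?Q" by simp
      have "c (assemble ys' gs @ fill x g) = c (assemble ys' gs @ fill y g)"
      proof (cases "x = y")
        case False
        then show ?thesis
          using x g_eq[of x y] e1(2)[OF _ _ _ Q, of "\<lambda>q. c (q @ fill x g)" "\<lambda>q. c (q @ fill y g)"] c
          by blast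
      qed simp
      with 1 show "c (assemble xs (gs @ [g])) = c (assemble ys (gs @ [g]))"
        using xs ys ly by (simp add: assemble_snoc part_def)
    qed
    then show "\<exists>gs. length gs = Suc n \<and> length (concat gs) = L' + N \<and>
        (\<forall>g\<in>set gs. template A g) \<and> insensitive A b c gs"
      using gs g by (intro exI[of _ "gs @ [g]"]) auto
  qed
  then show ?case by blast
qed

text \<open>The induction step adds a letter \<open>b\<close> to \<open>A\<close>. On \<open>r\<close> insensitive blocks, two of the \<open>r + 1\<close> words
  \<open>a0 \<dots> a0 b \<dots> b\<close> have the same color, say those with \<open>i < j\<close> letters \<open>a0\<close>. Putting the variable into
  the blocks \<open>i, \<dots>, j - 1\<close> gives the line: its point \<open>b\<close> is the word with \<open>i\<close> letters \<open>a0\<close>, and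
  its other points have the color of the word with \<open>j\<close> letters \<open>a0\<close> by insensitivity.\<close>
theorem hales_jewett:
  fixes A :: "'b set"
  shows "finite A \<Longrightarrow> \<exists>L. line_bound A r L"
proof (induction A arbitrary: r rule: finite_induct)
  case empty
  show ?case
    by (intro exI[of _ 1]) (auto simp: line_bound_def template_def intro!: exI[of _ "[None]"])
next
  case (insert b A)
  show ?case
  proof (cases "A = {}")
    case True
    then show ?thesis
      by (intro exI[of _ 1]) (auto simp: line_bound_def template_def intro!: exI[of _ "[None]"])
  next
    case False
    then obtain a0 where a0: "a0 \<in> A" by blast
    let ?B = "insert b A"
    obtain L where L: "insensitive_bound A b r r L"
      using insensitive_blocks[OF insert.hyps(1) insert.IH] by blast
    have "line_bound ?B r L"
      unfolding line_bound_def
    proof (intro allI impI)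
      fix c :: "'b option list \<Rightarrow> nat" assume c: "\<forall>w. c w < r"
      then obtain gs where gs: "length gs = r" "length (concat gs) = L" "\<forall>g\<in>set gs. template A g"
        and gs_eq: "insensitive A b c gs"
        using L[unfolded insensitive_bound_def] by blast
      define e where "e i = replicate i (Some a0) @ replicate (r - i) (Some b)" for i
      \<comment> \<open>there are \<open>r + 1\<close> of these words, but only \<open>r\<close> colors\<close>
      have "\<not> inj_on (\<lambda>i. c (assemble (e i) gs)) {..r}"
      proof (rule pigeonhole)
        have "(\<lambda>i. c (assemble (e i) gs)) ` {..r} \<subseteq> {..<r}" using c by auto
        then have "card ((\<lambda>i. c (assemble (e i) gs)) ` {..r}) \<le> card {..<r}" by (intro card_mono) auto
        then show "card ((\<lambda>i. c (assemble (e i) gs)) ` {..r}) < card {..r}" by simp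
      qed
      then obtain i j where ij: "i < j" "j \<le> r" "c (assemble (e i) gs) = c (assemble (e j) gs)"
        unfolding inj_on_def by (metis atMost_iff linorder_neqE_nat)
      define v where "v = replicate i (Some a0) @ replicate (j - i) None @ replicate (r - j) (Some b)"
      have lv: "length v = r" using ij by (simp add: v_def)
      have fv: "fill x v = replicate i (Some a0) @ replicate (j - i) (Some x) @ replicate (r - j) (Some b)" for x
        by (simp add: v_def fill_def)
      define G where "G = assemble v gs"
      have eq: "c (fill x G) = c (assemble (e j) gs)" if "x \<in> ?B" for x
      proof (cases "x = b")
        case True
        have "replicate (r - i) (Some b) = replicate (j - i) (Some b) @ replicate (r - j) (Some b)"
          using ij by (simp flip: replicate_add)
        then have "fill x v = e i" unfolding fv e_def True by simp
        then show ?thesis using ij(3) by (simp add: G_def fill_assemble)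
      next
        case False
        then have x: "x \<in> A" using that by simp
        have "replicate j (Some a0) = replicate i (Some a0) @ replicate (j - i) (Some a0)"
          using ij by (simp flip: replicate_add)
        then have "list_all2 (\<lambda>x y. x = y \<or> x \<in> Some ` A \<and> y \<in> Some ` A) (fill x v) (e j)"
          unfolding fv e_def using x a0
          by (auto intro!: list_all2_appendI list_all2_refl simp: list_all2_conv_all_nth[of _ "replicate _ _" "replicate _ _"])
        moreover have "set (fill x v) \<subseteq> Some ` ?B" "set (e j) \<subseteq> Some ` ?B"
          using x a0 by (auto simp: fv e_def)
        ultimately have "c (assemble (fill x v) gs) = c (assemble (e j) gs)"
          using gs_eq[unfolded insensitive_def, rule_format, of "fill x v" "e j"] lv gs(1) by simp
        then show ?thesis by (simp add: G_def fill_assemble)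
      qed
      have "None \<in> set G"
      proof -
        have i: "v ! i = None" "i < length v" using ij by (auto simp: v_def nth_append)
        then have "map2 part v gs ! i = gs ! i" using lv gs(1) by (simp add: part_def)
        then have "gs ! i \<in> set (map2 part v gs)"
          using lv gs(1) i(2) nth_mem[of i "map2 part v gs"] by simp
        moreover have "None \<in> set (gs ! i)" using gs(1,3) i lv by (auto simp: template_def)
        ultimately show ?thesis unfolding G_def assemble_def set_concat by blast
      qed
      moreover have "set G \<subseteq> insert None (Some ` ?B)"
        unfolding G_def
      proof (rule set_assemble(1))
        show "\<forall>g\<in>set gs. set g \<subseteq> insert None (Some ` ?B)"
          using gs(3) unfolding template_def by blast
        show "set v \<subseteq> insert None (Some ` ?B)" using a0 by (auto simp: v_def)
      qed
      moreover have "length G = L" using length_assemble[of v gs] lv gs(1,2) by (simp add: G_def)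
      ultimately show "\<exists>g. length g = L \<and> template ?B g \<and>
           (\<forall>a\<in>?B. \<forall>a'\<in>?B. c (fill a g) = c (fill a' g))"
        using eq by (intro exI[of _ G]) (simp add: template_def)
    qed
    then show ?thesis by blast
  qed
qed

section \<open>Located words over increasing alphabets\<close>

text \<open>The pair \<open>(m, w)\<close> is the word \<open>w\<close> placed at the positions \<open>m, m + 1, \<dots>\<close>. Both constant words and
  variable words have this type; there is one variable, \<^const>\<open>None\<close>.\<close>
type_synonym 'b lword = "nat \<times> 'b option list"

definition start :: "'b lword \<Rightarrow> nat" where "start u = fst u"
definition stop :: "'b lword \<Rightarrow> nat" where "stop u = fst u + length (snd u)"
definition lcat :: "'b lword \<Rightarrow> 'b lword \<Rightarrow> 'b lword" (infixr \<open>\<odot>\<close> 65) where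
  "u \<odot> v = (fst u, snd u @ snd v)"
definition linst :: "'b lword \<Rightarrow> 'b \<Rightarrow> 'b lword" where "linst u a = (fst u, fill a (snd u))"
definition isvar :: "'b lword \<Rightarrow> bool" where "isvar u \<longleftrightarrow> None \<in> set (snd u)"

lemma start_stop_simps [simp]:
  "start (linst u a) = start u" "stop (linst u a) = stop u" "start (u \<odot> v) = start u"
  by (simp_all add: start_def stop_def linst_def lcat_def)

lemma stop_lcat [simp]: "stop u = start v \<Longrightarrow> stop (u \<odot> v) = stop v"
  by (simp add: start_def stop_def lcat_def)

lemma linst_simps [simp]:
  "linst (linst u a) b = linst u a" "linst (u \<odot> v) a = linst u a \<odot> linst v a"
  "isvar (u \<odot> v) \<longleftrightarrow> isvar u \<or> isvar v" "\<not> isvar (linst u a)"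
  by (simp_all add: linst_def lcat_def isvar_def)

lemma linst_const: "\<not> isvar u \<Longrightarrow> linst u a = u"
proof -
  have "None \<notin> set w \<Longrightarrow> fill a w = w" for w
    by (induction w) (auto split: option.split intro: option.exhaust)
  then show "\<not> isvar u \<Longrightarrow> linst u a = u" by (simp add: linst_def isvar_def prod_eq_iff)
qed

lemma lcat_assoc [simp]: "(u \<odot> v) \<odot> w = u \<odot> v \<odot> w"
  by (simp add: lcat_def)

locale alphabets =
  fixes A :: "nat \<Rightarrow> 'b set"
  assumes finite_alphabet: "finite (A n)"
    and alphabet_nonempty: "A n \<noteq> {}"
    and alphabet_mono: "m \<le> n \<Longrightarrow> A m \<subseteq> A n"
begin

definition valid :: "'b lword \<Rightarrow> bool" where
  "valid u \<longleftrightarrow> snd u \<noteq> [] \<and>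
     (\<forall>i<length (snd u). \<forall>b. snd u ! i = Some b \<longrightarrow> b \<in> A (start u + i))"

text \<open>All words, constant or with variable, that can be obtained from \<open>S\<close>. In a concatenation of several
  variable words the variables are identified, so the new variable ranges over the alphabet of the first
  position; as the alphabets increase, its letters are allowed at all later positions.\<close>
inductive_set gen :: "'b lword set \<Rightarrow> 'b lword set" for S where
  base: "u \<in> S \<Longrightarrow> u \<in> gen S"
| inst: "u \<in> gen S \<Longrightarrow> a \<in> A (start u) \<Longrightarrow> linst u a \<in> gen S"
| cat: "u \<in> gen S \<Longrightarrow> v \<in> gen S \<Longrightarrow> stop u = start v \<Longrightarrow> u \<odot> v \<in> gen S"

lemma valid_linst:
  assumes "valid u" "a \<in> A (start u)"
  shows "valid (linst u a)"
  unfolding valid_def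
proof (intro conjI allI impI)
  show "snd (linst u a) \<noteq> []" using assms(1) by (auto simp: valid_def linst_def fill_def)
  fix i b assume i: "i < length (snd (linst u a))" and b: "snd (linst u a) ! i = Some b"
  have "i < length (snd u)" using i by (simp add: linst_def)
  then have "b = a \<or> snd u ! i = Some b"
    using b by (auto simp: linst_def fill_def split: option.splits)
  then show "b \<in> A (start (linst u a) + i)"
    using assms \<open>i < length (snd u)\<close> alphabet_mono[of "start u" "start u + i"] by (auto simp: valid_def)
qed

lemma valid_lcat:
  assumes "valid u" "valid v" "stop u = start v"
  shows "valid (u \<odot> v)"
  unfolding valid_def
proof (intro conjI allI impI)
  show "snd (u \<odot> v) \<noteq> []" using assms(1) by (auto simp: valid_def lcat_def)
  fix i b assume i: "i < length (snd (u \<odot> v))" and b: "snd (u \<odot> v) ! i = Some b"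
  show "b \<in> A (start (u \<odot> v) + i)"
  proof (cases "i < length (snd u)")
    case True
    then show ?thesis using assms(1) b by (simp add: valid_def lcat_def start_def nth_append)
  next
    case False
    then have "start u + i = start v + (i - length (snd u))"
      using assms(3) by (simp add: start_def stop_def)
    moreover have "snd v ! (i - length (snd u)) = Some b" "i - length (snd u) < length (snd v)"
      using b i False by (auto simp: lcat_def nth_append)
    then have "b \<in> A (start v + (i - length (snd u)))"
      using assms(2) unfolding valid_def by blast
    ultimately show ?thesis by simp
  qed
qed

lemma valid_start_less_stop: "valid u \<Longrightarrow> start u < stop u"
  by (simp add: valid_def start_def stop_def)

lemma valid_gen: "u \<in> gen S \<Longrightarrow> (\<And>v. v \<in> S \<Longrightarrow> valid v) \<Longrightarrow> valid u"
  by (induction rule: gen.induct) (auto intro: valid_linst valid_lcat)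

lemma gen_subset: "u \<in> gen S \<Longrightarrow> S \<subseteq> gen T \<Longrightarrow> u \<in> gen T"
  by (induction rule: gen.induct) (auto intro: gen.intros)

lemma gen_mono: "S \<subseteq> T \<Longrightarrow> gen S \<subseteq> gen T"
  using gen_subset gen.base by blast

text \<open>Splitting off a block from the left is the step of all inductions on constant words.\<close>
lemma gen_split:
  assumes "u \<in> gen S"
  shows "\<exists>x\<in>S. \<exists>e. (e = x \<or> (\<exists>a\<in>A (start x). e = linst x a)) \<and>
    (u = e \<or> (\<exists>v\<in>gen S. stop e = start v \<and> u = e \<odot> v))"
  using assms
proof (induction rule: gen.induct)
  case (inst u a)
  then obtain x e where x: "x \<in> S" "e = x \<or> (\<exists>a\<in>A (start x). e = linst x a)"
    "u = e \<or> (\<exists>v\<in>gen S. stop e = start v \<and> u = e \<odot> v)" by blast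
  have start: "start u = start x" using x by auto
  have e: "linst e a = x \<or> (\<exists>b\<in>A (start x). linst e a = linst x b)"
    using x(2) inst(2) start by auto
  have split: "linst u a = linst e a \<or> (\<exists>v\<in>gen S. stop (linst e a) = start v \<and> linst u a = linst e a \<odot> v)"
    using x(3)
  proof
    assume "\<exists>v\<in>gen S. stop e = start v \<and> u = e \<odot> v"
    then obtain v where v: "v \<in> gen S" "stop e = start v" "u = e \<odot> v" by blast
    have "start u \<le> start v"
      using v by (simp add: start_def stop_def lcat_def)
    then have "linst v a \<in> gen S"
      using v(1) inst(2) alphabet_mono by (blast intro: gen.inst)
    then show ?thesis using v by (intro disjI2 bexI[of _ "linst v a"]) auto
  qed simp
  show ?case
    by (intro bexI[of _ x] exI[of _ "linst e a"] conjI e split x(1))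
next
  case (cat u v)
  then obtain x e where x: "x \<in> S" "e = x \<or> (\<exists>a\<in>A (start x). e = linst x a)"
    "u = e \<or> (\<exists>v\<in>gen S. stop e = start v \<and> u = e \<odot> v)" by blast
  have "\<exists>w\<in>gen S. stop e = start w \<and> u \<odot> v = e \<odot> w"
    using x(3)
  proof
    assume "\<exists>v\<in>gen S. stop e = start v \<and> u = e \<odot> v"
    then obtain w where w: "w \<in> gen S" "stop e = start w" "u = e \<odot> w" by blast
    then have "stop w = start v" using cat(3) by simp
    then show ?thesis using w cat(2) by (intro bexI[of _ "w \<odot> v"]) (auto intro: gen.cat)
  qed (use cat in auto)
  with x(1,2) show ?case by blast
qed blast

lemma finite_gen:
  assumes "finite S" "\<And>u. u \<in> S \<Longrightarrow> valid u"
  shows "finite (gen S)"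
proof -
  define N where "N = Max (insert 0 (stop ` S))"
  have N: "stop u \<le> N" if "u \<in> S" for u
    unfolding N_def using assms(1) that by (intro Max_ge) auto
  have "stop u \<le> N" if "u \<in> gen S" for u
    using that by (induction rule: gen.induct) (use N in auto)
  moreover have "valid u" if "u \<in> gen S" for u
    using that assms(2) by (rule valid_gen)
  ultimately have "gen S \<subseteq> {..N} \<times> {w. set w \<subseteq> insert None (Some ` A N) \<and> length w \<le> N}"
  proof (intro subsetI)
    fix u assume u: "u \<in> gen S"
    have v: "valid u" "stop u \<le> N"
      using u \<open>\<And>u. u \<in> gen S \<Longrightarrow> valid u\<close> \<open>\<And>u. u \<in> gen S \<Longrightarrow> stop u \<le> N\<close> by auto
    have "x \<in> insert None (Some ` A N)" if x: "x \<in> set (snd u)" for x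
    proof -
      obtain i where i: "i < length (snd u)" "x = snd u ! i" using x by (auto simp: in_set_conv_nth)
      have "start u + i \<le> N" using i v(2) by (simp add: start_def stop_def)
      then have sub: "A (start u + i) \<subseteq> A N" by (rule alphabet_mono)
      show ?thesis
      proof (cases x)
        case (Some b)
        then have "b \<in> A (start u + i)" using i v(1) unfolding valid_def by metis
        then show ?thesis using sub Some by auto
      qed simp
    qed
    then show "u \<in> {..N} \<times> {w. set w \<subseteq> insert None (Some ` A N) \<and> length w \<le> N}"
      using v(2) by (cases u) (auto simp: stop_def)
  qed
  moreover have "finite ({..N} \<times> {w. set w \<subseteq> insert None (Some ` A N) \<and> length w \<le> N})"
    using finite_alphabet by (intro finite_cartesian_product finite_lists_length_le) auto
  ultimately show ?thesis by (rule finite_subset)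
qed

text \<open>Coded subspaces: sequences of adjacent variable words. The notion includes the tails that start at an
  arbitrary position \<open>N\<close>.\<close>
definition space :: "nat \<Rightarrow> (nat \<Rightarrow> 'b lword) \<Rightarrow> bool" where
  "space N X \<longleftrightarrow> (\<forall>i. valid (X i) \<and> isvar (X i) \<and> stop (X i) = start (X (Suc i))) \<and> start (X 0) = N"

abbreviation spn :: "(nat \<Rightarrow> 'b lword) \<Rightarrow> 'b lword set" where "spn X \<equiv> gen (range X)"

lemma space_shift: "space N X \<Longrightarrow> space (start (X q)) (\<lambda>i. X (q + i))"
  by (simp add: space_def)

lemma space_valid: "space N X \<Longrightarrow> valid (X i)"
  and space_isvar: "space N X \<Longrightarrow> isvar (X i)"
  and space_stop: "space N X \<Longrightarrow> stop (X i) = start (X (Suc i))"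
  and space_start: "space N X \<Longrightarrow> start (X 0) = N"
  by (auto simp: space_def)

lemma valid_spn: "space N X \<Longrightarrow> u \<in> spn X \<Longrightarrow> valid u"
  by (rule valid_gen) (auto simp: space_def)

lemma start_strict_mono: "space N X \<Longrightarrow> strict_mono (\<lambda>i. start (X i))"
  by (metis space_valid space_stop strict_mono_Suc_iff valid_start_less_stop)

lemma start_less: "space N X \<Longrightarrow> start (X p) < start (X q) \<longleftrightarrow> p < q"
  using start_strict_mono strict_mono_less by blast

lemma start_le: "space N X \<Longrightarrow> start (X p) \<le> start (X q) \<longleftrightarrow> p \<le> q"
  using start_strict_mono strict_mono_less_eq by blast

lemma start_eq: "space N X \<Longrightarrow> start (X p) = start (X q) \<longleftrightarrow> p = q"
  using start_strict_mono strict_mono_eq by blast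

lemma start_ge: "space N X \<Longrightarrow> N + i \<le> start (X i)"
proof (induction i)
  case (Suc i)
  then show ?case using start_less[of N X i "Suc i"] by simp
qed (simp add: space_def)

text \<open>A generated word consists of whole blocks of the space. Therefore positions are enough to tell which
  blocks were used, and a tail of a space need not be mentioned as a sequence of its own.\<close>
lemma spn_ends:
  assumes X: "space N X" and u: "u \<in> spn X"
  obtains p q where "p < q" "start u = start (X p)" "stop u = start (X q)" "u \<in> gen (X ` {p..<q})"
proof -
  have "\<exists>p q. p < q \<and> start u = start (X p) \<and> stop u = start (X q) \<and> u \<in> gen (X ` {p..<q})"
    using u
  proof (induction rule: gen.induct)
    case (base u)
    then obtain p where "u = X p" by auto
    then show ?case using space_stop[OF X]
      by (intro exI[of _ p] exI[of _ "Suc p"]) (auto intro: gen.base)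
  next
    case (inst u a)
    then show ?case by (auto intro: gen.inst)
  next
    case (cat u v)
    then obtain p q q' r where pq: "p < q" "start u = start (X p)" "stop u = start (X q)"
      "u \<in> gen (X ` {p..<q})" "q' < r" "start v = start (X q')" "stop v = start (X r)"
      "v \<in> gen (X ` {q'..<r})" by blast
    have "q' = q" using cat(3) pq start_eq[OF X] by metis
    moreover have "gen (X ` {p..<q}) \<subseteq> gen (X ` {p..<r})" "gen (X ` {q..<r}) \<subseteq> gen (X ` {p..<r})"
      using pq \<open>q' = q\<close> by (auto intro!: gen_mono)
    ultimately have "u \<odot> v \<in> gen (X ` {p..<r})" using cat(3) pq by (blast intro: gen.cat)
    then show ?case using pq cat(3) \<open>q' = q\<close> by (intro exI[of _ p] exI[of _ r]) auto
  qed
  then show ?thesis using that by blast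
qed

lemma spn_below:
  assumes "space N X" "u \<in> spn X" "stop u \<le> start (X q)"
  shows "u \<in> gen (X ` {..<q})"
proof -
  obtain p r where "p < r" "stop u = start (X r)" "u \<in> gen (X ` {p..<r})"
    using spn_ends[OF assms(1,2)] by metis
  moreover have "r \<le> q" using calculation assms(3) start_le[OF assms(1)] by simp
  then have "gen (X ` {p..<r}) \<subseteq> gen (X ` {..<q})" by (intro gen_mono) auto
  ultimately show ?thesis by blast
qed

lemma spn_above:
  assumes "space N X" "u \<in> spn X" "start (X q) \<le> start u"
  shows "u \<in> spn (\<lambda>i. X (q + i))"
proof -
  obtain p r where "p < r" "start u = start (X p)" "u \<in> gen (X ` {p..<r})"
    using spn_ends[OF assms(1,2)] by metis
  moreover have "q \<le> p" using calculation assms(3) start_le[OF assms(1)] by simp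
  then have "X ` {p..<r} \<subseteq> range (\<lambda>i. X (q + i))"
    by (intro image_subsetI) (metis atLeastLessThan_iff le_Suc_ex order_trans rangeI)
  then have "gen (X ` {p..<r}) \<subseteq> spn (\<lambda>i. X (q + i))" by (intro gen_mono)
  ultimately show ?thesis by blast
qed

section \<open>Fusion\<close>

text \<open>For \<open>G = spn X\<close> these are the subspaces of the tail of \<open>X\<close> that starts at \<open>N\<close>.\<close>
definition subspaces :: "nat \<Rightarrow> 'b lword set \<Rightarrow> (nat \<Rightarrow> 'b lword) set" where
  "subspaces N G = {Y. space N Y \<and> range Y \<subseteq> G}"

lemma subspaces_self: "space N X \<Longrightarrow> X \<in> subspaces N (spn X)"
  by (auto simp: subspaces_def intro: gen.base)

lemma subspaces_spn: "Y \<in> subspaces N (spn X) \<Longrightarrow> spn Y \<subseteq> spn X"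
  using gen_subset by (auto simp: subspaces_def)

lemma subspaces_trans: "Y \<in> subspaces N (spn X) \<Longrightarrow> Z \<in> subspaces M (spn Y) \<Longrightarrow> Z \<in> subspaces M (spn X)"
  using subspaces_spn[of Y N X] by (auto simp: subspaces_def)

lemma subspaces_space: "Y \<in> subspaces N G \<Longrightarrow> space N Y"
  by (simp add: subspaces_def)

lemma subspaces_shift: "Y \<in> subspaces N G \<Longrightarrow> (\<lambda>i. Y (q + i)) \<in> subspaces (start (Y q)) G"
  by (auto simp: subspaces_def space_shift)

text \<open>Inherited by subspaces of tails: only the words of \<open>G\<close> that start at \<open>M\<close> or later matter.\<close>
definition hereditary :: "('o \<Rightarrow> nat \<Rightarrow> 'b lword set \<Rightarrow> bool) \<Rightarrow> bool" where
  "hereditary P \<longleftrightarrow> (\<forall>p M G G'. P p M G \<longrightarrow> (\<forall>u\<in>G'. M \<le> start u \<longrightarrow> u \<in> G) \<longrightarrow> P p M G')"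

lemma refine_finite:
  assumes her: "hereditary P" and fin: "finite Q"
    and dense: "\<And>p Z. Z \<in> subspaces M G \<Longrightarrow> \<exists>Y\<in>subspaces M (spn Z). P p M (spn Y)"
    and G: "gen G = G" and Z: "Z \<in> subspaces M G"
  shows "\<exists>Y\<in>subspaces M (spn Z). \<forall>p\<in>Q. P p M (spn Y)"
  using fin
proof (induction Q)
  case empty
  show ?case using Z subspaces_self subspaces_space by blast
next
  case (insert p Q)
  then obtain Y where Y: "Y \<in> subspaces M (spn Z)" "\<forall>p\<in>Q. P p M (spn Y)" by blast
  have "spn Z \<subseteq> G" using Z gen_mono[of "range Z" G] G by (auto simp: subspaces_def)
  then have "Y \<in> subspaces M G" using Y(1) by (auto simp: subspaces_def)
  then obtain Y' where Y': "Y' \<in> subspaces M (spn Y)" "P p M (spn Y')" using dense by blast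
  have "P q M (spn Y')" if "q \<in> Q" for q
    using her Y(2) that subspaces_spn[OF Y'(1)] unfolding hereditary_def by blast
  then show ?case using Y' subspaces_trans[OF Y(1) Y'(1)] by blast
qed

lemma gen_gen: "gen (gen S) = gen S"
  using gen_subset[of _ "gen S" S] gen.base[of _ "gen S"] by blast

text \<open>One subspace settles all properties \<open>P p\<close>, although each refinement settles only finitely many of them.
  The \<open>q\<close>-th block is the first block of a space \<open>Z q\<close> that was refined for the finitely many objects \<open>p\<close>
  which are determined by the earlier blocks; all later blocks are generated by \<open>Z q\<close>, so that heredity
  transfers the properties to the tail of the result.\<close>
theorem fusion:
  assumes X: "space N X" and her: "hereditary P"
    and fin: "\<And>q F. finite F \<Longrightarrow> finite (Ob q F)"
    and dense: "\<And>p M Z. Z \<in> subspaces M (spn X) \<Longrightarrow> \<exists>Y\<in>subspaces M (spn Z). P p M (spn Y)"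
  shows "\<exists>Y\<in>subspaces N (spn X). \<forall>q. \<forall>p\<in>Ob q (gen (Y ` {..<q})). P p (start (Y q)) (spn Y)"
proof -
  define good where "good q s \<longleftrightarrow> finite (fst s) \<and> fst s \<subseteq> spn X \<and>
      snd s \<in> subspaces (start (snd s 0)) (spn X) \<and>
      (q = 0 \<longrightarrow> fst s = {} \<and> start (snd s 0) = N) \<and>
      (\<forall>p\<in>Ob q (gen (fst s)). P p (start (snd s 0)) (spn (snd s)))"
    for q and s :: "'b lword set \<times> (nat \<Rightarrow> 'b lword)"
  define nxt where "nxt q s t \<longleftrightarrow> fst t = insert (snd s 0) (fst s) \<and>
      snd t \<in> subspaces (stop (snd s 0)) (spn (snd s))"
    for q :: nat and s t :: "'b lword set \<times> (nat \<Rightarrow> 'b lword)"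
  have refine: "\<exists>Y\<in>subspaces M (spn Z). \<forall>p\<in>Ob q (gen B). P p M (spn Y)"
    if "Z \<in> subspaces M (spn X)" "finite B" "B \<subseteq> spn X" for B M Z q
  proof (rule refine_finite[OF her _ dense gen_gen that(1)])
    show "finite (Ob q (gen B))"
      using that valid_spn[OF X] by (intro fin finite_gen) auto
  qed
  have "\<exists>f. \<forall>n. good n (f n) \<and> nxt n (f n) (f (Suc n))"
  proof (rule dependent_nat_choice)
    obtain Z where "Z \<in> subspaces N (spn X)" "\<forall>p\<in>Ob 0 (gen {}). P p N (spn Z)"
      using refine[OF subspaces_self[OF X], of "{}" 0] by auto
    then show "\<exists>s. good 0 s"
      by (intro exI[of _ "({}, Z)"]) (auto simp: good_def subspaces_def space_def)
  next
    fix s q assume s: "good q s"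
    define B Z where "B = insert (snd s 0) (fst s)" and "Z = snd s"
    have Z: "Z \<in> subspaces (start (Z 0)) (spn X)" using s by (simp add: good_def Z_def)
    have Z1: "(\<lambda>i. Z (1 + i)) \<in> subspaces (start (Z 1)) (spn X)"
      using subspaces_shift[OF Z] by blast
    have B: "finite B" "B \<subseteq> spn X" using s by (auto simp: good_def B_def subspaces_def)
    obtain Y where Y: "Y \<in> subspaces (start (Z 1)) (spn (\<lambda>i. Z (1 + i)))"
      "\<forall>p\<in>Ob (Suc q) (gen B). P p (start (Z 1)) (spn Y)"
      using refine[OF Z1 B] by blast
    have st: "stop (Z 0) = start (Z 1)" using space_stop subspaces_space[OF Z] by (metis One_nat_def)
    have "good (Suc q) (B, Y)"
      using Y B subspaces_trans[OF Z1 Y(1)] by (auto simp: good_def subspaces_def space_def)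
    moreover have "nxt q s (B, Y)"
      using Y(1) st gen_mono[of "range (\<lambda>i. Z (1 + i))" "range Z"]
      by (fastforce simp: nxt_def B_def Z_def subspaces_def)
    ultimately show "\<exists>t. good (Suc q) t \<and> nxt q s t" by blast
  qed
  then obtain f where f: "\<And>n. good n (f n)" "\<And>n. nxt n (f n) (f (Suc n))" by blast
  define Z where "Z n = snd (f n)" for n
  define Y where "Y n = Z n 0" for n
  have Z: "Z n \<in> subspaces (start (Y n)) (spn X)" for n
    using f(1)[of n] by (simp add: good_def Z_def Y_def)
  have Z_Suc: "Z (Suc n) \<in> subspaces (stop (Y n)) (spn (Z n))" for n
    using f(2)[of n] by (simp add: nxt_def Z_def Y_def)
  have blocks: "fst (f n) = Y ` {..<n}" for n
  proof (induction n)
    case (Suc n)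
    then show ?case
      using f(2)[of n] by (simp add: nxt_def Y_def Z_def lessThan_Suc)
  qed (use f(1)[of 0] in \<open>simp add: good_def\<close>)
  have mono: "spn (Z (n + k)) \<subseteq> spn (Z n)" for n k
    by (induction k) (use subspaces_spn[OF Z_Suc] in auto)
  have Y_in: "Y (n + k) \<in> spn (Z n)" for n k
    using mono[of n k] by (auto simp: Y_def intro: gen.base)
  have "stop (Y n) = start (Y (Suc n))" for n
    using space_start[OF subspaces_space[OF Z_Suc]] by (simp add: Y_def)
  moreover have "valid (Y n)" "isvar (Y n)" for n
    using space_valid space_isvar subspaces_space[OF Z] by (metis Y_def)+
  moreover have "start (Y 0) = N" using f(1)[of 0] by (simp add: good_def Y_def Z_def)
  ultimately have space: "space N Y" by (simp add: space_def)
  have "Y n \<in> spn X" for n using f(1)[of n] by (auto simp: good_def Y_def Z_def subspaces_def)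
  with space have "Y \<in> subspaces N (spn X)" by (auto simp: subspaces_def)
  moreover have "P p (start (Y q)) (spn Y)" if "p \<in> Ob q (gen (Y ` {..<q}))" for p q
  proof -
    have P: "P p (start (Y q)) (spn (Z q))"
      using f(1)[of q] that by (simp add: good_def blocks Y_def Z_def)
    have "u \<in> spn (Z q)" if "u \<in> spn Y" "start (Y q) \<le> start u" for u
    proof (rule gen_subset[OF spn_above[OF space that]])
      show "range (\<lambda>i. Y (q + i)) \<subseteq> spn (Z q)" using Y_in by auto
    qed
    with P her show ?thesis unfolding hereditary_def by blast
  qed
  ultimately show ?thesis by blast
qed

section \<open>The pigeonhole principle\<close>

definition constants :: "nat \<Rightarrow> 'b lword set \<Rightarrow> 'b lword set" where
  "constants N G = {u \<in> G. \<not> isvar u \<and> start u = N}"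

lemma const_split:
  assumes X: "space N X" and u: "u \<in> constants (start (X p)) (spn X)"
  obtains a where "a \<in> A (start (X p))"
    "u = linst (X p) a \<or> (\<exists>v\<in>constants (start (X (Suc p))) (spn X). u = linst (X p) a \<odot> v)"
proof -
  obtain x e where x: "x \<in> range X" "e = x \<or> (\<exists>a\<in>A (start x). e = linst x a)"
    "u = e \<or> (\<exists>v\<in>spn X. stop e = start v \<and> u = e \<odot> v)"
    using gen_split[of u "range X"] u unfolding constants_def by blast
  have "start x = start (X p)" using x u by (auto simp: constants_def)
  then have xp: "x = X p" using x(1) start_eq[OF X] by auto
  have "\<not> isvar e" using x(3) u by (auto simp: constants_def)
  then obtain a where a: "a \<in> A (start (X p))" "e = linst (X p) a"
    using x(2) space_isvar[OF X] xp by auto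
  show ?thesis
  proof (rule that[OF a(1)])
    show "u = linst (X p) a \<or> (\<exists>v\<in>constants (start (X (Suc p))) (spn X). u = linst (X p) a \<odot> v)"
      using x(3)
    proof
      assume "\<exists>v\<in>spn X. stop e = start v \<and> u = e \<odot> v"
      then obtain v where v: "v \<in> spn X" "stop e = start v" "u = e \<odot> v" by blast
      then have "v \<in> constants (start (X (Suc p))) (spn X)"
        using u a(2) space_stop[OF X, of p] by (simp add: constants_def)
      then show ?thesis using v(3) a(2) by blast
    qed (simp add: a(2))
  qed
qed

text \<open>Each set \<open>E i\<close> contains what has to be avoided after the first \<open>i\<close> blocks. The two constructions of
  spaces below, of one that avoids a set and of one that stays inside a set, both end with this induction.\<close>
lemma constants_avoid:
  assumes X: "space N X" and avoids: "\<And>i a. a \<in> A (start (X i)) \<Longrightarrow> linst (X i) a \<notin> E i"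
    and step: "\<And>i a v. a \<in> A (start (X i)) \<Longrightarrow> linst (X i) a \<odot> v \<in> E i \<Longrightarrow> v \<in> E (Suc i)"
  shows "constants N (spn X) \<inter> E 0 = {}"
proof -
  have "u \<notin> E p" if "u \<in> constants (start (X p)) (spn X)" for u p
    using that
  proof (induction "length (snd u)" arbitrary: u p rule: less_induct)
    case less
    obtain a where a: "a \<in> A (start (X p))"
      "u = linst (X p) a \<or> (\<exists>v\<in>constants (start (X (Suc p))) (spn X). u = linst (X p) a \<odot> v)"
      using const_split[OF X less.prems] .
    from a(2) show ?case
    proof
      assume "\<exists>v\<in>constants (start (X (Suc p))) (spn X). u = linst (X p) a \<odot> v"
      then obtain v where v: "v \<in> constants (start (X (Suc p))) (spn X)" "u = linst (X p) a \<odot> v" by blast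
      have "length (snd v) < length (snd u)"
        using v(2) space_valid[OF X, of p] by (simp add: lcat_def linst_def valid_def)
      then have "v \<notin> E (Suc p)" using less.hyps v(1) by blast
      then show ?thesis using step a(1) v(2) by blast
    qed (use avoids a(1) in simp)
  qed
  then show ?thesis using space_start[OF X] by blast
qed

fun assemble_from :: "(nat \<Rightarrow> 'b lword) \<Rightarrow> nat \<Rightarrow> 'b option list \<Rightarrow> 'b lword" where
  "assemble_from X p [] = (start (X p), [])"
| "assemble_from X p (x # w) =
     (case x of None \<Rightarrow> X p | Some a \<Rightarrow> linst (X p) a) \<odot> assemble_from X (Suc p) w"

lemma assemble_from_ends:
  assumes "space N X"
  shows "start (assemble_from X p w) = start (X p)" "stop (assemble_from X p w) = start (X (p + length w))"
proof -
  have "start (assemble_from X p w) = start (X p) \<and> stop (assemble_from X p w) = start (X (p + length w))"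
  proof (induction w arbitrary: p)
    case (Cons x w)
    have "start (case x of None \<Rightarrow> X p | Some a \<Rightarrow> linst (X p) a) = start (X p)"
      "stop (case x of None \<Rightarrow> X p | Some a \<Rightarrow> linst (X p) a) = start (X (Suc p))"
      using space_stop[OF assms] by (auto split: option.split)
    then show ?case using Cons[of "Suc p"] by simp
  qed (simp add: start_def stop_def)
  then show "start (assemble_from X p w) = start (X p)"
    "stop (assemble_from X p w) = start (X (p + length w))" by auto
qed

lemma linst_assemble_from: "linst (assemble_from X p w) a = assemble_from X p (fill a w)"
proof (induction w arbitrary: p)
  case (Cons x w)
  then show ?case by (cases x) auto
qed (simp add: linst_def)

lemma isvar_assemble_from:
  assumes "space N X"
  shows "isvar (assemble_from X p w) \<longleftrightarrow> None \<in> set w"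
proof (induction w arbitrary: p)
  case (Cons x w)
  then show ?case using space_isvar[OF assms] by (cases x) auto
qed (simp add: isvar_def)

lemma assemble_from_spn:
  assumes X: "space N X" and "w \<noteq> []" "set w \<subseteq> insert None (Some ` A N)"
  shows "assemble_from X p w \<in> spn X"
  using assms(2,3)
proof (induction w arbitrary: p)
  case (Cons x w)
  let ?e = "case x of None \<Rightarrow> X p | Some a \<Rightarrow> linst (X p) a"
  have "N \<le> start (X p)" using start_ge[OF X, of p] by simp
  then have e: "?e \<in> spn X"
  proof (cases x)
    case None
    then show ?thesis by (auto intro: gen.base)
  next
    case (Some a)
    then have "a \<in> A (start (X p))"
      using Cons.prems(2) alphabet_mono[OF \<open>N \<le> start (X p)\<close>] by auto
    then show ?thesis using Some by (auto intro: gen.base gen.inst)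
  qed
  have stop: "stop ?e = start (X (Suc p))" using space_stop[OF X] by (auto split: option.split)
  show ?case
  proof (cases "w = []")
    case True
    then show ?thesis using e by (simp add: lcat_def)
  next
    case False
    then have "assemble_from X (Suc p) w \<in> spn X" using Cons by auto
    then show ?thesis using e stop assemble_from_ends(1)[OF X] by (simp add: gen.cat)
  qed
qed simp

text \<open>The Hales-Jewett theorem, transferred to the words that consist of the first blocks of \<open>X\<close>. The color of
  a word is a subset of \<open>F\<close>.\<close>
lemma monochromatic_line:
  fixes f :: "'b lword \<Rightarrow> 'c set"
  assumes X: "space N X" and F: "finite F" "\<And>u. f u \<subseteq> F"
  obtains h where "h \<in> spn X" "isvar h" "start h = N"
    "\<forall>a\<in>A N. \<forall>a'\<in>A N. f (linst h a) = f (linst h a')"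
proof -
  have "finite (Pow F)" using F(1) by simp
  from finite_imp_inj_to_nat_seg[OF this]
  obtain e :: "'c set \<Rightarrow> nat" and r where e: "e ` Pow F = {i. i < r}" "inj_on e (Pow F)"
    by (elim exE conjE)
  obtain L where L: "line_bound (A N) r L" using hales_jewett[OF finite_alphabet] by blast
  define c where "c w = e (f (assemble_from X 0 w))" for w
  have "\<forall>w. c w < r"
    using e(1) F(2) unfolding c_def by (metis PowI imageI mem_Collect_eq)
  then obtain g where g: "template (A N) g"
    "\<forall>a\<in>A N. \<forall>a'\<in>A N. c (fill a g) = c (fill a' g)"
    using L unfolding line_bound_def by blast
  show ?thesis
  proof (rule that[of "assemble_from X 0 g"])
    have "g \<noteq> []" using g(1) by (auto simp: template_def)
    then show "assemble_from X 0 g \<in> spn X" "isvar (assemble_from X 0 g)" "start (assemble_from X 0 g) = N"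
      using g(1) assemble_from_spn[OF X, of g 0] isvar_assemble_from[OF X] assemble_from_ends[OF X]
        space_start[OF X]
      by (auto simp: template_def)
    show "\<forall>a\<in>A N. \<forall>a'\<in>A N. f (linst (assemble_from X 0 g) a) = f (linst (assemble_from X 0 g) a')"
      using g(2) e(2) F(2) unfolding c_def linst_assemble_from by (metis PowI inj_onD)
  qed
qed

definition large :: "nat \<Rightarrow> 'b lword set \<Rightarrow> 'b lword set \<Rightarrow> bool" where
  "large N D G \<longleftrightarrow> (\<forall>Y\<in>subspaces N G. constants N (spn Y) \<inter> D \<noteq> {})"

definition residual :: "'b lword \<Rightarrow> 'b lword set \<Rightarrow> 'b lword set" where
  "residual h D = {v. \<forall>a\<in>A (start h). linst h a \<odot> v \<in> D}"

text \<open>Suppose that for no \<open>g\<close> the residual set is large in a space after \<open>g\<close>. By fusion there is a space \<open>W\<close> such that for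
  every variable word \<open>g\<close> of \<open>W\<close> that starts at \<open>N\<close>, no constant word of \<open>W\<close> after \<open>g\<close> is in the
  residual set of \<open>g\<close>. Now blocks \<open>z\<close> can be chosen one after the other such that no constant word
  of the new space is in \<open>D\<close>. Let \<open>F\<close> be the finite set of constant words over the blocks chosen so far. A
  line \<open>h\<close> is monochromatic for the coloring of \<open>u\<close> by \<open>{w \<in> F. w \<odot> u \<odot> u0 \<in> D}\<close>, where \<open>u0\<close> is one
  constant word on the block after \<open>u\<close>. If this color contained some \<open>w\<close>, then \<open>u0\<close> would be in the
  residual set of \<open>w \<odot> h\<close>. So the color is empty, and \<open>z = h \<odot> u0\<close> is a possible next block. The space of
  all \<open>z\<close> contradicts that \<open>D\<close> is large.\<close>
lemma large_residual:
  assumes X: "space N X" and large: "large N D (spn X)"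
  obtains g X' where "g \<in> spn X" "isvar g" "start g = N" "X' \<in> subspaces (stop g) (spn X)"
    "large (stop g) (residual g D) (spn X')"
proof (rule ccontr)
  assume "\<not> thesis"
  with that have none: "\<not> large (stop g) (residual g D) (spn Z)"
    if "g \<in> spn X" "isvar g" "start g = N" "Z \<in> subspaces (stop g) (spn X)" for g Z
    using that by blast
  define P where "P g M G \<longleftrightarrow>
    (g \<in> spn X \<and> isvar g \<and> start g = N \<and> stop g = M \<longrightarrow> constants M G \<inter> residual g D = {})" for g M G
  have "hereditary P" by (auto simp: hereditary_def P_def constants_def)
  moreover have "\<exists>Y\<in>subspaces M (spn Z). P g M (spn Y)" if Z: "Z \<in> subspaces M (spn X)" for g M Z
  proof (cases "g \<in> spn X \<and> isvar g \<and> start g = N \<and> stop g = M")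
    case True
    then show ?thesis using none[of g Z] Z by (auto simp: large_def P_def)
  next
    case False
    then show ?thesis using subspaces_self[OF subspaces_space[OF Z]] unfolding P_def by blast
  qed
  ultimately obtain W where W: "W \<in> subspaces N (spn X)"
    and WP: "\<forall>q. \<forall>g\<in>gen (W ` {..<q}). P g (start (W q)) (spn W)"
    using fusion[OF X, of P "\<lambda>_ F. F"] by blast
  note sp = subspaces_space[OF W]
  \<comment> \<open>a letter that is allowed at all positions from \<open>N\<close> on\<close>
  obtain a0 where a0: "a0 \<in> A N" using alphabet_nonempty by blast
  have A_mono: "A N \<subseteq> A (start (W i))" for i
    using start_ge[OF sp, of i] by (intro alphabet_mono) simp
  \<comment> \<open>the empty word at \<open>N\<close> stands for the situation before the first block\<close>
  define good where "good q F \<longleftrightarrow> finite F \<and> (\<forall>w\<in>F. \<not> isvar w \<and> start w = N \<and>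
    stop w = start (W q) \<and> (w = (N, []) \<or> w \<in> spn W))" for q F
  have step: "\<exists>z q'. z \<in> spn W \<and> isvar z \<and> start z = start (W q) \<and> stop z = start (W q') \<and>
      (\<forall>w\<in>F. \<forall>a\<in>A (start z). w \<odot> linst z a \<notin> D)" if F: "good q F" for q F
  proof -
    \<comment> \<open>the constant word \<open>u0\<close> depends on the end of \<open>u\<close>, which is unknown until the line is found\<close>
    define tail where "tail u = linst (W (SOME j. start (W j) = stop u)) a0" for u :: "'b lword"
    define f where "f u = {w \<in> F. w \<odot> u \<odot> tail u \<in> D}" for u
    have fin: "finite F" and sub: "\<And>u. f u \<subseteq> F" using F by (auto simp: good_def f_def)
    have sp': "space (start (W q)) (\<lambda>i. W (q + i))" by (rule space_shift[OF sp])
    obtain h where h': "h \<in> spn (\<lambda>i. W (q + i))" and h: "isvar h" "start h = start (W q)"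
      and hf: "\<forall>a\<in>A (start (W q)). \<forall>a'\<in>A (start (W q)). f (linst h a) = f (linst h a')"
      using monochromatic_line[of _ _ F f, OF sp' fin sub] .
    have hW: "h \<in> spn W" using h' gen_mono[of "range (\<lambda>i. W (q + i))" "range W"] by blast
    obtain q' where q': "stop h = start (W q')" using spn_ends[OF sp hW] by metis
    have "(SOME j. start (W j) = stop h) = q'"
      using q' start_eq[OF sp] by (intro some_equality) auto
    then have tail: "tail (linst h a) = linst (W q') a0" for a by (simp add: tail_def)
    define u0 where "u0 = linst (W q') a0"
    have u0: "u0 \<in> constants (start (W q')) (spn W)"
      using a0 A_mono[of q'] by (auto simp: u0_def constants_def intro: gen.intros)
    have "h \<odot> u0 \<in> spn W" using hW q' u0 by (intro gen.cat) (auto simp: constants_def)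
    moreover have "stop (h \<odot> u0) = start (W (Suc q'))"
      using space_stop[OF sp] q' by (simp add: u0_def)
    moreover have "w \<odot> linst (h \<odot> u0) a \<notin> D" if w: "w \<in> F" and a: "a \<in> A (start (W q))" for w a
    proof
      assume D: "w \<odot> linst (h \<odot> u0) a \<in> D"
      then have "w \<in> f (linst h a)" using w by (simp add: f_def tail u0_def)
      then have "w \<in> f (linst h a')" if "a' \<in> A (start (W q))" for a' using hf a that by blast
      then have all: "w \<odot> linst h a' \<odot> u0 \<in> D" if "a' \<in> A N" for a'
        using that A_mono[of q] by (auto simp: f_def tail u0_def)
      have w': "\<not> isvar w" "start w = N" "stop w = start (W q)" "w = (N, []) \<or> w \<in> spn W"
        using F w by (auto simp: good_def)
      define g where "g = w \<odot> h"
      have g: "isvar g" "start g = N" "stop g = start (W q')"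
        using h w' q' by (auto simp: g_def)
      have "g \<in> spn W"
        using w'(4)
      proof
        assume "w = (N, [])"
        then have "g = h" using w' h by (simp add: g_def lcat_def prod_eq_iff start_def stop_def)
        then show ?thesis using hW by simp
      qed (use w' h hW in \<open>auto simp: g_def intro: gen.cat\<close>)
      then have "g \<in> gen (W ` {..<q'})" "g \<in> spn X"
        using spn_below[OF sp] g(3) subspaces_spn[OF W] by auto
      then have "constants (start (W q')) (spn W) \<inter> residual g D = {}"
        using WP g unfolding P_def by blast
      moreover have "u0 \<in> residual g D"
        using all by (simp add: residual_def g(2)) (simp add: g_def linst_const[OF w'(1)])
      ultimately show False using u0 by blast
    qed
    ultimately show ?thesis using h
      by (intro exI[of _ "h \<odot> u0"] exI[of _ "Suc q'"]) auto
  qed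
  define ok where "ok n s \<longleftrightarrow> (case s of (q, F, z) \<Rightarrow> good q F \<and> z \<in> spn W \<and> isvar z \<and>
      start z = start (W q) \<and> (\<forall>w\<in>F. \<forall>a\<in>A (start z). w \<odot> linst z a \<notin> D) \<and>
      (n = 0 \<longrightarrow> q = 0 \<and> F = {(N, [])}))" for n :: nat and s
  define nxt where "nxt n s t \<longleftrightarrow> (case s of (q, F, z) \<Rightarrow> case t of (q', F', z') \<Rightarrow>
      stop z = start (W q') \<and> F' = {w \<odot> linst z a |w a. w \<in> F \<and> a \<in> A (start z)})"
    for n :: nat and s t :: "nat \<times> 'b lword set \<times> 'b lword"
  have "\<exists>s. \<forall>n. ok n (s n) \<and> nxt n (s n) (s (Suc n))"
  proof (rule dependent_nat_choice)
    have "good 0 {(N, [])}"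
      using space_start[OF sp] by (simp add: good_def isvar_def start_def stop_def)
    then obtain z where "ok 0 (0, {(N, [])}, z)"
      using step[of 0 "{(N, [])}"] unfolding ok_def by auto
    then show "\<exists>s. ok 0 s" by blast
  next
    fix s n assume s: "ok n s"
    obtain q F z where s_eq: "s = (q, F, z)" by (cases s)
    have F: "good q F" and z: "z \<in> spn W" "isvar z" "start z = start (W q)"
      using s by (auto simp: ok_def s_eq)
    obtain q' where q': "stop z = start (W q')" using spn_ends[OF sp z(1)] by metis
    define F' where "F' = {w \<odot> linst z a |w a. w \<in> F \<and> a \<in> A (start z)}"
    have "F' = (\<lambda>(w, a). w \<odot> linst z a) ` (F \<times> A (start z))" by (auto simp: F'_def)
    then have fin: "finite F'" using F finite_alphabet by (auto simp: good_def)
    have zW: "linst z a \<in> spn W" if "a \<in> A (start z)" for a using z(1) that by (rule gen.inst)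
    have cat: "w \<odot> linst z a \<in> spn W" if "w \<in> F" "a \<in> A (start z)" for w a
    proof -
      have w: "start w = N" "stop w = start (W q)" "w = (N, []) \<or> w \<in> spn W"
        using F that by (auto simp: good_def)
      from w(3) show ?thesis
      proof
        assume "w = (N, [])"
        then have "w \<odot> linst z a = linst z a"
          using w z by (simp add: lcat_def prod_eq_iff start_def stop_def linst_def)
        then show ?thesis using zW that by simp
      qed (use zW that w z in \<open>auto intro: gen.cat\<close>)
    qed
    have "good q' F'"
      using F fin cat q' z by (auto simp: good_def F'_def)
    moreover from step[OF this] obtain z' where "z' \<in> spn W" "isvar z'" "start z' = start (W q')"
      "\<forall>w\<in>F'. \<forall>a\<in>A (start z'). w \<odot> linst z' a \<notin> D"
      by blast
    ultimately have "ok (Suc n) (q', F', z')" by (simp add: ok_def)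
    moreover have "nxt n s (q', F', z')" by (simp add: nxt_def s_eq q' F'_def)
    ultimately show "\<exists>t. ok (Suc n) t \<and> nxt n s t" by blast
  qed
  then obtain s where s: "\<And>n. ok n (s n)" "\<And>n. nxt n (s n) (s (Suc n))" by blast
  define F where "F n = fst (snd (s n))" for n
  define z where "z n = snd (snd (s n))" for n
  have z: "z n \<in> spn W" "isvar (z n)" "\<And>w a. w \<in> F n \<Longrightarrow> a \<in> A (start (z n)) \<Longrightarrow> w \<odot> linst (z n) a \<notin> D"
    "stop (z n) = start (z (Suc n))"
    "F (Suc n) = {w \<odot> linst (z n) a |w a. w \<in> F n \<and> a \<in> A (start (z n))}" for n
    using s(1)[of n] s(1)[of "Suc n"] s(2)[of n]
    by (auto simp: ok_def nxt_def F_def z_def split: prod.splits)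
  have "start (z 0) = N" "F 0 = {(N, [])}"
    using s(1)[of 0] space_start[OF sp] by (auto simp: ok_def F_def z_def split: prod.splits)
  then have spz: "space N z" using z(1,2,4) valid_spn[OF sp] by (auto simp: space_def)
  have "constants N (spn z) \<inter> {v. \<exists>w\<in>F 0. w \<odot> v \<in> D} = {}"
  proof (rule constants_avoid[OF spz, where E = "\<lambda>n. {v. \<exists>w\<in>F n. w \<odot> v \<in> D}"])
    show "linst (z i) a \<notin> {v. \<exists>w\<in>F i. w \<odot> v \<in> D}" if "a \<in> A (start (z i))" for i a
      using z(3) that by blast
    show "v \<in> {v. \<exists>w\<in>F (Suc i). w \<odot> v \<in> D}"
      if v: "a \<in> A (start (z i))" "linst (z i) a \<odot> v \<in> {v. \<exists>w\<in>F i. w \<odot> v \<in> D}" for i a v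
    proof -
      obtain w where "w \<in> F i" "(w \<odot> linst (z i) a) \<odot> v \<in> D" using v(2) unfolding lcat_assoc by blast
      then show ?thesis using v(1) unfolding z(5) by blast
    qed
  qed
  moreover have "(N, []) \<odot> v = v" if "v \<in> constants N (spn z)" for v
    using that by (auto simp: constants_def lcat_def start_def)
  ultimately have "constants N (spn z) \<inter> D = {}"
    using \<open>F 0 = {(N, [])}\<close> by auto
  moreover have "z \<in> subspaces N (spn X)"
    using spz z(1) subspaces_spn[OF W] by (auto simp: subspaces_def)
  ultimately show False using large by (auto simp: large_def)
qed

text \<open>Largeness of the residual set provides a constant word \<open>u\<close> in it. Appending \<open>u\<close> to the variable word puts
  all its instances into \<open>D\<close>, and largeness survives: attaching \<open>u\<close> to its first block turns a space that starts at
  the end of \<open>u\<close> into one that starts at the beginning of \<open>u\<close>.\<close>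
lemma large_extend:
  assumes X: "space N X" and large: "large N D (spn X)"
  obtains g X' where "g \<in> spn X" "isvar g" "start g = N" "\<And>a. a \<in> A N \<Longrightarrow> linst g a \<in> D"
    "X' \<in> subspaces (stop g) (spn X)" "large (stop g) (residual g D) (spn X')"
proof -
  obtain h Z where h: "h \<in> spn X" "isvar h" "start h = N" and Z: "Z \<in> subspaces (stop h) (spn X)"
    and lh: "large (stop h) (residual h D) (spn Z)"
    using large_residual[OF X large] .
  note sp = subspaces_space[OF Z]
  obtain u where u: "u \<in> spn Z" "\<not> isvar u" "start u = stop h" "u \<in> residual h D"
    using lh subspaces_self[OF sp] by (fastforce simp: large_def constants_def)
  obtain q where q: "stop u = start (Z q)" using spn_ends[OF sp u(1)] by metis
  let ?Z = "\<lambda>i. Z (q + i)"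
  have sub: "spn ?Z \<subseteq> spn Z" by (intro gen_mono) auto
  have u_sub: "start u \<le> stop u" by (simp add: start_def stop_def)
  have "large (stop u) (residual (h \<odot> u) D) (spn ?Z)"
    unfolding large_def
  proof (intro ballI)
    fix Y assume Y: "Y \<in> subspaces (stop u) (spn ?Z)"
    note spY = subspaces_space[OF Y]
    \<comment> \<open>\<open>Y\<close> with \<open>u\<close> attached to its first block; constant words from there on begin with \<open>u\<close>\<close>
    define Y' where "Y' i = (if i = 0 then u \<odot> Y 0 else Y i)" for i
    have "valid (Y' i)" for i
      using space_valid[OF spY] space_start[OF spY] valid_spn[OF sp u(1)] by (simp add: Y'_def valid_lcat)
    then have spY': "space (stop h) Y'"
      using spY u by (auto simp: space_def Y'_def)
    have "Y i \<in> spn Z" for i using Y sub by (auto simp: subspaces_def)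
    then have "Y' i \<in> spn Z" for i
      using u space_start[OF spY] by (auto simp: Y'_def intro: gen.cat)
    then have "Y' \<in> subspaces (stop h) (spn Z)" using spY' by (auto simp: subspaces_def)
    then have "constants (stop h) (spn Y') \<inter> residual h D \<noteq> {}"
      using lh unfolding large_def by blast
    then obtain v where v: "v \<in> constants (start (Y' 0)) (spn Y')" "v \<in> residual h D"
      using space_start[OF spY'] by (metis disjoint_iff)
    obtain a where a: "a \<in> A (start (Y' 0))"
      "v = linst (Y' 0) a \<or> (\<exists>w\<in>constants (start (Y' (Suc 0))) (spn Y'). v = linst (Y' 0) a \<odot> w)"
      using const_split[OF spY' v(1)] .
    have Y0: "linst (Y' 0) a = u \<odot> linst (Y 0) a" using linst_const[OF u(2)] by (simp add: Y'_def)
    have "start (Y' 0) = stop h" using space_start[OF spY'] .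
    then have "A (start (Y' 0)) \<subseteq> A (start (Y 0))"
      using u_sub u(3) space_start[OF spY] by (intro alphabet_mono) simp
    then have Y0_in: "linst (Y 0) a \<in> spn Y" using a(1) by (auto intro: gen.intros)
    have "\<exists>w\<in>constants (stop u) (spn Y). v = u \<odot> w"
      using a(2)
    proof
      assume "v = linst (Y' 0) a"
      then show ?thesis using Y0 Y0_in space_start[OF spY]
        by (intro bexI[of _ "linst (Y 0) a"]) (auto simp: constants_def)
    next
      assume "\<exists>w\<in>constants (start (Y' (Suc 0))) (spn Y'). v = linst (Y' 0) a \<odot> w"
      then obtain w where w: "w \<in> spn Y'" "\<not> isvar w" "start w = start (Y (Suc 0))" "v = linst (Y' 0) a \<odot> w"
        by (auto simp: constants_def Y'_def)
      have "w \<in> spn (\<lambda>i. Y' (Suc 0 + i))"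
        using spn_above[OF spY' w(1), of "Suc 0"] w(3) by (simp add: Y'_def)
      moreover have "spn (\<lambda>i. Y' (Suc 0 + i)) \<subseteq> spn Y" by (intro gen_mono) (auto simp: Y'_def)
      ultimately have "w \<in> spn Y" by blast
      then have "linst (Y 0) a \<odot> w \<in> constants (stop u) (spn Y)"
        using Y0_in w(2,3) space_start[OF spY] space_stop[OF spY] by (auto simp: constants_def intro: gen.cat)
      then show ?thesis using w(4) Y0 by (intro bexI[of _ "linst (Y 0) a \<odot> w"]) simp_all
    qed
    then obtain w where w: "w \<in> constants (stop u) (spn Y)" "v = u \<odot> w" by blast
    then have "w \<in> residual (h \<odot> u) D"
      using v(2) linst_const[OF u(2)] by (auto simp: residual_def)
    then show "constants (stop u) (spn Y) \<inter> residual (h \<odot> u) D \<noteq> {}" using w(1) by blast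
  qed
  moreover have "stop (h \<odot> u) = stop u" using u(3) by simp
  moreover have "h \<odot> u \<in> spn X"
    using h(1) u(1,3) subspaces_spn[OF Z] by (auto intro: gen.cat)
  moreover have "?Z \<in> subspaces (stop u) (spn X)" using subspaces_shift[OF Z] q by simp
  moreover have "linst (h \<odot> u) a \<in> D" if "a \<in> A N" for a
    using u(2,4) that h(3) linst_const[OF u(2)] by (simp add: residual_def)
  ultimately show ?thesis using that[of "h \<odot> u" ?Z] h by simp
qed

text \<open>The theorem of Carlson and Simpson for increasing alphabets. If \<open>C\<close> is large, the set \<open>D n\<close> below
  contains the words that may follow every choice of letters in the first \<open>n\<close> blocks.\<close>
theorem pigeonhole_words:
  assumes X: "space N X"
  obtains Y where "Y \<in> subspaces N (spn X)" "constants N (spn Y) \<subseteq> C \<or> constants N (spn Y) \<inter> C = {}"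
proof (cases "large N C (spn X)")
  case False
  then show ?thesis using that by (auto simp: large_def)
next
  case True
  define ok where "ok n s \<longleftrightarrow> (case s of (D, g, Z) \<Rightarrow> g \<in> spn X \<and> isvar g \<and>
      (\<forall>a\<in>A (start g). linst g a \<in> D) \<and> Z \<in> subspaces (stop g) (spn X) \<and>
      large (stop g) (residual g D) (spn Z) \<and> (n = 0 \<longrightarrow> D = C \<and> start g = N))" for n :: nat and s
  define nxt where "nxt n s t \<longleftrightarrow> (case s of (D, g, Z) \<Rightarrow> case t of (D', g', Z') \<Rightarrow>
      D' = residual g D \<and> start g' = stop g)"
    for n :: nat and s t :: "'b lword set \<times> 'b lword \<times> (nat \<Rightarrow> 'b lword)"
  have "\<exists>s. \<forall>n. ok n (s n) \<and> nxt n (s n) (s (Suc n))"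
  proof (rule dependent_nat_choice)
    obtain g Z where "g \<in> spn X" "isvar g" "start g = N" "\<And>a. a \<in> A N \<Longrightarrow> linst g a \<in> C"
      "Z \<in> subspaces (stop g) (spn X)" "large (stop g) (residual g C) (spn Z)"
      using large_extend[OF X True] by blast
    then have "ok 0 (C, g, Z)" by (simp add: ok_def)
    then show "\<exists>s. ok 0 s" by blast
  next
    fix s n assume s: "ok n s"
    obtain D g Z where s_eq: "s = (D, g, Z)" by (cases s)
    have Z: "Z \<in> subspaces (stop g) (spn X)" and l: "large (stop g) (residual g D) (spn Z)"
      using s by (auto simp: ok_def s_eq)
    obtain g' Z' where g': "g' \<in> spn Z" "isvar g'" "start g' = stop g"
      "\<And>a. a \<in> A (stop g) \<Longrightarrow> linst g' a \<in> residual g D"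
      "Z' \<in> subspaces (stop g') (spn Z)" "large (stop g') (residual g' (residual g D)) (spn Z')"
      using large_extend[OF subspaces_space[OF Z] l] by blast
    have "ok (Suc n) (residual g D, g', Z')"
      using g' subspaces_spn[OF Z] subspaces_trans[OF Z g'(5)] by (auto simp: ok_def)
    moreover have "nxt n s (residual g D, g', Z')" using g' by (simp add: nxt_def s_eq)
    ultimately show "\<exists>t. ok (Suc n) t \<and> nxt n s t" by blast
  qed
  then obtain s where s: "\<And>n. ok n (s n)" "\<And>n. nxt n (s n) (s (Suc n))" by blast
  define D where "D n = fst (s n)" for n
  define g where "g n = fst (snd (s n))" for n
  have g: "g n \<in> spn X" "isvar (g n)" "\<And>a. a \<in> A (start (g n)) \<Longrightarrow> linst (g n) a \<in> D n"
    "stop (g n) = start (g (Suc n))" "D (Suc n) = residual (g n) (D n)" for n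
    using s(1)[of n] s(2)[of n] by (auto simp: ok_def nxt_def D_def g_def split: prod.splits)
  have g0: "start (g 0) = N" "D 0 = C"
    using s(1)[of 0] by (auto simp: ok_def D_def g_def split: prod.splits)
  then have spg: "space N g" using g(1,2,4) valid_spn[OF X] by (auto simp: space_def)
  have "constants N (spn g) \<inter> - D 0 = {}"
  proof (rule constants_avoid[OF spg, where E = "\<lambda>n. - D n"])
    show "v \<in> - D (Suc i)" if "a \<in> A (start (g i))" "linst (g i) a \<odot> v \<in> - D i" for i a v
      using that by (auto simp: g(5) residual_def)
  qed (use g(3) in simp)
  moreover have "g \<in> subspaces N (spn X)" using spg g(1) by (auto simp: subspaces_def)
  ultimately show ?thesis using that g0(2) by blast
qed

end

section \<open>Sequences of constant words\<close>

definition prefix :: "nat \<Rightarrow> (nat \<Rightarrow> 'w) \<Rightarrow> 'w list" where "prefix n \<zeta> = map \<zeta> [0..<n]"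
definition tail :: "nat \<Rightarrow> (nat \<Rightarrow> 'w) \<Rightarrow> nat \<Rightarrow> 'w" where "tail n \<zeta> i = \<zeta> (n + i)"
definition prepend :: "'w list \<Rightarrow> (nat \<Rightarrow> 'w) \<Rightarrow> nat \<Rightarrow> 'w" where
  "prepend s \<zeta> n = (if n < length s then s ! n else \<zeta> (n - length s))"
definition sect :: "'w list \<Rightarrow> (nat \<Rightarrow> 'w) set \<Rightarrow> (nat \<Rightarrow> 'w) set" where
  "sect s U = {\<zeta>. prepend s \<zeta> \<in> U}"
text \<open>Open in the product of discrete spaces. All sequences are admitted, whether or not their members are
  adjacent.\<close>
definition seq_open :: "(nat \<Rightarrow> 'w) set \<Rightarrow> bool" where
  "seq_open U \<longleftrightarrow> (\<forall>\<zeta>\<in>U. \<exists>n. \<forall>\<eta>. prefix n \<eta> = prefix n \<zeta> \<longrightarrow> \<eta> \<in> U)"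

lemma length_prefix [simp]: "length (prefix n \<zeta>) = n" by (simp add: prefix_def)

lemma prefix_simps [simp]: "prefix 0 \<zeta> = []" "prefix (Suc n) \<zeta> = prefix n \<zeta> @ [\<zeta> n]"
  by (simp_all add: prefix_def)

lemma prefix_eq_iff: "prefix n \<zeta> = prefix n \<eta> \<longleftrightarrow> (\<forall>i<n. \<zeta> i = \<eta> i)"
  by (auto simp: prefix_def)

lemma prepend_Nil [simp]: "prepend [] \<zeta> = \<zeta>"
  by (simp add: prepend_def fun_eq_iff)

lemma prepend_append: "prepend (s @ t) \<zeta> = prepend s (prepend t \<zeta>)"
  by (auto simp: prepend_def fun_eq_iff nth_append)

lemma prepend_prefix_tail [simp]: "prepend (prefix n \<zeta>) (tail n \<zeta>) = \<zeta>"
  by (auto simp: prepend_def tail_def prefix_def fun_eq_iff)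

lemma prefix_prepend [simp]: "prefix (length s) (prepend s \<zeta>) = s"
  by (rule nth_equalityI) (auto simp: prefix_def prepend_def)

lemma sect_simps [simp]: "sect [] U = U" "sect s (- U) = - sect s U"
  "sect s (\<Union>i. V i) = (\<Union>i. sect s (V i))" "sect s (\<Inter>i. V i) = (\<Inter>i. sect s (V i))"
  by (auto simp: sect_def)

lemma sect_sect: "sect t (sect s U) = sect (s @ t) U"
  by (simp add: sect_def prepend_append)

lemma seq_open_sect:
  assumes "seq_open U"
  shows "seq_open (sect s U)"
  unfolding seq_open_def
proof
  fix \<zeta> assume "\<zeta> \<in> sect s U"
  then obtain n where n: "\<And>\<eta>. prefix n \<eta> = prefix n (prepend s \<zeta>) \<Longrightarrow> \<eta> \<in> U"
    using assms by (auto simp: sect_def seq_open_def)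
  have "\<eta> \<in> sect s U" if "prefix n \<eta> = prefix n \<zeta>" for \<eta>
    unfolding sect_def using that by (auto intro!: n simp: prefix_eq_iff prepend_def)
  then show "\<exists>n. \<forall>\<eta>. prefix n \<eta> = prefix n \<zeta> \<longrightarrow> \<eta> \<in> sect s U" by blast
qed

context alphabets
begin

definition pts :: "nat \<Rightarrow> 'b lword set \<Rightarrow> (nat \<Rightarrow> 'b lword) set" where
  "pts N G = {\<zeta>. (\<forall>n. \<zeta> n \<in> G \<and> \<not> isvar (\<zeta> n) \<and> stop (\<zeta> n) = start (\<zeta> (Suc n))) \<and> start (\<zeta> 0) = N}"

lemma start_mono_pts: "\<zeta> \<in> pts N G \<Longrightarrow> i \<le> j \<Longrightarrow> start (\<zeta> i) \<le> start (\<zeta> j)"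
proof (induction j)
  case (Suc j)
  have "start (\<zeta> j) \<le> stop (\<zeta> j)" by (simp add: start_def stop_def)
  moreover have "stop (\<zeta> j) = start (\<zeta> (Suc j))" using Suc.prems(1) by (simp add: pts_def)
  ultimately show ?case using Suc by (cases "i = Suc j") auto
qed simp

lemma pts_antimono:
  assumes "\<forall>u\<in>G'. M \<le> start u \<longrightarrow> u \<in> G"
  shows "pts M G' \<subseteq> pts M G"
proof
  fix \<zeta> assume z: "\<zeta> \<in> pts M G'"
  have "M \<le> start (\<zeta> n)" for n using start_mono_pts[OF z, of 0 n] z by (simp add: pts_def)
  then show "\<zeta> \<in> pts M G" using z assms by (simp add: pts_def)
qed

lemma pts_mono: "G' \<subseteq> G \<Longrightarrow> pts M G' \<subseteq> pts M G"
  by (rule pts_antimono) blast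

lemma tail_pts: "\<zeta> \<in> pts N G \<Longrightarrow> tail n \<zeta> \<in> pts (start (\<zeta> n)) G"
  by (simp add: pts_def tail_def)

lemma Cons_pts: "u \<in> constants N G \<Longrightarrow> \<zeta> \<in> pts (stop u) G \<Longrightarrow> prepend [u] \<zeta> \<in> pts N G"
  by (auto simp: pts_def constants_def prepend_def)

lemma prepend_pts: "\<zeta> \<in> pts N G \<Longrightarrow> \<eta> \<in> pts (start (\<zeta> n)) G \<Longrightarrow> prepend (prefix n \<zeta>) \<eta> \<in> pts N G"
proof (induction n arbitrary: \<eta>)
  case (Suc n)
  have "\<zeta> n \<in> constants (start (\<zeta> n)) G" "stop (\<zeta> n) = start (\<zeta> (Suc n))"
    using Suc.prems by (auto simp: pts_def constants_def)
  then have "prepend [\<zeta> n] \<eta> \<in> pts (start (\<zeta> n)) G" using Suc.prems by (intro Cons_pts) auto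
  then show ?case using Suc by (simp add: prepend_append)
qed (simp add: pts_def)

lemma pts_nonempty:
  assumes X: "space N X"
  shows "pts (start (X q)) (spn X) \<noteq> {}"
proof -
  obtain a where a: "a \<in> A N" using alphabet_nonempty by blast
  have "a \<in> A (start (X i))" for i
    using a alphabet_mono[of N "start (X i)"] start_ge[OF X, of i] by auto
  then have "(\<lambda>i. linst (X (q + i)) a) \<in> pts (start (X q)) (spn X)"
    using space_stop[OF X] by (auto simp: pts_def intro: gen.intros)
  then show ?thesis by blast
qed

text \<open>The members of a sequence in the span use up at least one block each, and they are among the finitely many
  words generated by the blocks that are used up.\<close>
lemma prefix_chain:
  assumes Y: "space N Y" and z: "\<zeta> \<in> pts N (spn Y)"
  obtains q where "n \<le> q" "start (\<zeta> n) = start (Y q)"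
    "set (prefix n \<zeta>) \<subseteq> gen (Y ` {..<q})" "distinct (prefix n \<zeta>)"
proof -
  have zn: "\<zeta> i \<in> spn Y" "stop (\<zeta> i) = start (\<zeta> (Suc i))" for i using z by (auto simp: pts_def)
  have "\<exists>q\<ge>n. start (\<zeta> n) = start (Y q)"
  proof (induction n)
    case 0
    show ?case using z space_start[OF Y] by (intro exI[of _ 0]) (simp add: pts_def)
  next
    case (Suc n)
    then obtain q where q: "q \<ge> n" "start (\<zeta> n) = start (Y q)" by blast
    obtain p r where p: "p < r" "start (\<zeta> n) = start (Y p)" "stop (\<zeta> n) = start (Y r)"
      using spn_ends[OF Y zn(1)] by metis
    then have "p = q" using q start_eq[OF Y] by metis
    then show ?case using p q zn(2) by (intro exI[of _ r]) auto
  qed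
  then obtain q where q: "n \<le> q" "start (\<zeta> n) = start (Y q)" by blast
  have "stop (\<zeta> i) \<le> start (Y q)" if "i < n" for i
    using start_mono_pts[OF z, of "Suc i" n] that zn(2) q(2) by simp
  then have "set (prefix n \<zeta>) \<subseteq> gen (Y ` {..<q})"
    using spn_below[OF Y zn(1)] by (auto simp: prefix_def)
  moreover have "distinct (prefix n \<zeta>)"
  proof -
    have "start (\<zeta> i) < start (\<zeta> (Suc i))" for i
      using valid_start_less_stop[OF valid_spn[OF Y zn(1)]] zn(2) by metis
    then have "strict_mono (\<lambda>i. start (\<zeta> i))" by (simp add: strict_mono_Suc_iff)
    then have "inj \<zeta>" by (metis injI strict_mono_eq)
    then show ?thesis by (auto simp: prefix_def distinct_map intro: inj_on_subset)
  qed
  ultimately show ?thesis using that q by blast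
qed

text \<open>Fusion for properties of finite initial segments: from the \<open>k\<close>-th stage on, property number \<open>k\<close> is taken
  care of for all initial segments that can be formed.\<close>
lemma fusion_prefix:
  assumes X: "space N X" and her: "\<And>k. hereditary (P k)"
    and dense: "\<And>k s M Z. Z \<in> subspaces M (spn X) \<Longrightarrow> \<exists>Y\<in>subspaces M (spn Z). P k s M (spn Y)"
  shows "\<exists>Y\<in>subspaces N (spn X).
    \<forall>\<zeta>\<in>pts N (spn Y). \<forall>n. \<forall>k\<le>n. P k (prefix n \<zeta>) (start (\<zeta> n)) (spn Y)"
proof -
  define Ob where "Ob q F = {..q} \<times> {s. set s \<subseteq> F \<and> distinct s}" for q :: nat and F :: "'b lword set"
  define Q where "Q p = P (fst p) (snd p)" for p
  have "finite (Ob q F)" if "finite F" for q F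
    using finite_subset_distinct[OF that] by (simp add: Ob_def)
  moreover have "hereditary Q"
    using her unfolding hereditary_def Q_def by blast
  moreover have "\<exists>Y\<in>subspaces M (spn Z). Q p M (spn Y)" if "Z \<in> subspaces M (spn X)" for p M Z
    using dense[OF that] by (simp add: Q_def)
  ultimately obtain Y where Y: "Y \<in> subspaces N (spn X)"
    and YP: "\<forall>q. \<forall>p\<in>Ob q (gen (Y ` {..<q})). Q p (start (Y q)) (spn Y)"
    using fusion[OF X, of Q Ob] by blast
  have "P k (prefix n \<zeta>) (start (\<zeta> n)) (spn Y)" if z: "\<zeta> \<in> pts N (spn Y)" "k \<le> n" for k n \<zeta>
  proof -
    obtain q where q: "n \<le> q" "start (\<zeta> n) = start (Y q)"
      "set (prefix n \<zeta>) \<subseteq> gen (Y ` {..<q})" "distinct (prefix n \<zeta>)"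
      using prefix_chain[OF subspaces_space[OF Y] z(1)] .
    then have "(k, prefix n \<zeta>) \<in> Ob q (gen (Y ` {..<q}))" using z(2) by (simp add: Ob_def)
    then show ?thesis using YP q(2) by (fastforce simp: Q_def)
  qed
  with Y show ?thesis by blast
qed

section \<open>Ramsey sets\<close>

definition homogeneous :: "(nat \<Rightarrow> 'b lword) set \<Rightarrow> nat \<Rightarrow> 'b lword set \<Rightarrow> bool" where
  "homogeneous U M G \<longleftrightarrow> pts M G \<subseteq> U \<or> pts M G \<inter> U = {}"

text \<open>The sequence \<open>s\<close> and the position \<open>N\<close> vary independently, so that the notion passes to sections.\<close>
definition ramsey :: "(nat \<Rightarrow> 'b lword) set \<Rightarrow> bool" where
  "ramsey U \<longleftrightarrow> (\<forall>s N X. space N X \<longrightarrow> (\<exists>Y\<in>subspaces N (spn X). homogeneous (sect s U) N (spn Y)))"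

lemma homogeneous_antimono:
  "homogeneous U M G \<Longrightarrow> \<forall>u\<in>G'. M \<le> start u \<longrightarrow> u \<in> G \<Longrightarrow> homogeneous U M G'"
  using pts_antimono[of G' M G] unfolding homogeneous_def by blast

lemma hereditary_homogeneous: "hereditary (\<lambda>s. homogeneous (V s))"
  unfolding hereditary_def using homogeneous_antimono by blast

lemma ramseyD: "ramsey U \<Longrightarrow> space N X \<Longrightarrow> \<exists>Y\<in>subspaces N (spn X). homogeneous (sect s U) N (spn Y)"
  by (simp add: ramsey_def)

lemma ramsey_sect: "ramsey U \<Longrightarrow> ramsey (sect s U)"
  by (simp add: ramsey_def sect_sect)

lemma ramsey_Compl: "ramsey U \<Longrightarrow> ramsey (- U)"
  unfolding ramsey_def homogeneous_def sect_simps by (simp add: disjoint_eq_subset_Compl disj_commute)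

lemma subspaces_antimono: "\<forall>u\<in>G'. M \<le> start u \<longrightarrow> u \<in> G \<Longrightarrow> Z \<in> subspaces M G' \<Longrightarrow> Z \<in> subspaces M G"
  using start_ge unfolding subspaces_def by (fastforce intro: le_trans[OF le_add1])

text \<open>The argument of Galvin and Prikry. A finite sequence \<open>s\<close> is accepted if all its continuations are in \<open>U\<close>,
  and rejected if no subspace accepts it. After a fusion, every \<open>s\<close> is accepted or rejected. If the
  empty sequence is rejected, then after a rejected \<open>s\<close> the pigeonhole principle gives a space in which all
  next words lead to rejected sequences, since accepting all of them would accept \<open>s\<close>. A second fusion
  makes all finite sequences rejected, and then no sequence is in the open set \<open>U\<close>.\<close>
lemma homogeneous_seq_open:
  assumes X: "space N X" and U: "seq_open U"
  shows "\<exists>Y\<in>subspaces N (spn X). homogeneous U N (spn Y)"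
proof -
  define acc where "acc s M G \<longleftrightarrow> pts M G \<subseteq> sect s U" for s M G
  define rej where "rej s M G \<longleftrightarrow> (\<forall>Z\<in>subspaces M G. \<not> acc s M (spn Z))" for s M G
  have rej_antimono: "rej s M G'" if "rej s M G" "\<forall>u\<in>G'. M \<le> start u \<longrightarrow> u \<in> G" for s M G G'
    using that subspaces_antimono unfolding rej_def by blast
  have "hereditary (\<lambda>s M G. acc s M G \<or> rej s M G)"
    unfolding hereditary_def
  proof (intro allI impI, elim disjE)
    fix s M G G' assume "acc s M G" "\<forall>u\<in>G'. M \<le> start u \<longrightarrow> u \<in> G"
    then show "acc s M G' \<or> rej s M G'" using pts_antimono[of G' M G] by (auto simp: acc_def)
  qed (use rej_antimono in blast)
  moreover have "\<exists>Y\<in>subspaces M (spn Z). acc s M (spn Y) \<or> rej s M (spn Y)"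
    if Z: "Z \<in> subspaces M (spn X)" for s M Z
    using subspaces_self[OF subspaces_space[OF Z]] unfolding rej_def by blast
  ultimately obtain Y where Y: "Y \<in> subspaces N (spn X)"
    and "\<forall>\<zeta>\<in>pts N (spn Y). \<forall>n. \<forall>k\<le>n.
      acc (prefix n \<zeta>) (start (\<zeta> n)) (spn Y) \<or> rej (prefix n \<zeta>) (start (\<zeta> n)) (spn Y)"
    using fusion_prefix[OF X, of "\<lambda>_ s M G. acc s M G \<or> rej s M G"] by blast
  then have dec: "acc (prefix n \<zeta>) (start (\<zeta> n)) (spn Y) \<or> rej (prefix n \<zeta>) (start (\<zeta> n)) (spn Y)"
    if "\<zeta> \<in> pts N (spn Y)" for \<zeta> n
    using that by blast
  note spY = subspaces_space[OF Y]
  show ?thesis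
  proof (cases "acc [] N (spn Y)")
    case True
    then show ?thesis using Y by (auto simp: homogeneous_def acc_def)
  next
    case False
    obtain \<zeta> where "\<zeta> \<in> pts N (spn Y)" using pts_nonempty[OF spY, of 0] space_start[OF spY] by auto
    then have rej0: "rej [] N (spn Y)" using dec[of \<zeta> 0] False by (simp add: pts_def)
    define P where "P s M G \<longleftrightarrow> ((\<exists>\<zeta>\<in>pts N (spn Y). \<exists>n. s = prefix n \<zeta> \<and> M = start (\<zeta> n)) \<and> rej s M (spn Y)
        \<longrightarrow> (\<forall>u\<in>constants M G. rej (s @ [u]) (stop u) (spn Y)))" for s M G
    have "hereditary P" by (auto simp: hereditary_def P_def constants_def)
    moreover have "\<exists>W\<in>subspaces M (spn Z). P s M (spn W)" if Z: "Z \<in> subspaces M (spn Y)" for s M Z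
    proof (cases "(\<exists>\<zeta>\<in>pts N (spn Y). \<exists>n. s = prefix n \<zeta> \<and> M = start (\<zeta> n)) \<and> rej s M (spn Y)")
      case True
      then obtain \<zeta> n where z: "\<zeta> \<in> pts N (spn Y)" "s = prefix n \<zeta>" "M = start (\<zeta> n)" by blast
      obtain W where W: "W \<in> subspaces M (spn Z)"
        and WC: "constants M (spn W) \<subseteq> {u. acc (s @ [u]) (stop u) (spn Y)} \<or>
          constants M (spn W) \<inter> {u. acc (s @ [u]) (stop u) (spn Y)} = {}"
        using pigeonhole_words[OF subspaces_space[OF Z]] by blast
      have WY: "W \<in> subspaces M (spn Y)" using subspaces_trans[OF Z W] .
      have "P s M (spn W)"
        using WC
      proof
        assume all: "constants M (spn W) \<subseteq> {u. acc (s @ [u]) (stop u) (spn Y)}"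
        have "acc s M (spn W)"
          unfolding acc_def
        proof
          fix \<eta> assume e: "\<eta> \<in> pts M (spn W)"
          have "\<eta> 0 \<in> constants M (spn W)" using e by (simp add: pts_def constants_def)
          then have "acc (s @ [\<eta> 0]) (stop (\<eta> 0)) (spn Y)" using all by blast
          moreover have "tail 1 \<eta> \<in> pts (stop (\<eta> 0)) (spn Y)"
            using tail_pts[OF e, of 1] pts_mono[OF subspaces_spn[OF WY]] e by (auto simp: pts_def)
          ultimately have "prepend (s @ prefix 1 \<eta>) (tail 1 \<eta>) \<in> U"
            by (auto simp: acc_def sect_def)
          then show "\<eta> \<in> sect s U" by (simp only: prepend_append prepend_prefix_tail sect_def mem_Collect_eq)
        qed
        then show ?thesis using True WY by (auto simp: rej_def)
      next
        assume none: "constants M (spn W) \<inter> {u. acc (s @ [u]) (stop u) (spn Y)} = {}"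
        have "rej (s @ [u]) (stop u) (spn Y)" if u: "u \<in> constants M (spn W)" for u
        proof -
          have uY: "u \<in> constants M (spn Y)"
            using u subspaces_spn[OF WY] by (auto simp: constants_def)
          then obtain q where "stop u = start (Y q)"
            using spn_ends[OF spY, of u] by (auto simp: constants_def)
          then obtain \<xi> where "\<xi> \<in> pts (stop u) (spn Y)" using pts_nonempty[OF spY, of q] by auto
          then have "prepend [u] \<xi> \<in> pts (start (\<zeta> n)) (spn Y)" "start (\<xi> 0) = stop u"
            using Cons_pts uY z(3) by (auto simp: pts_def)
          moreover have "prefix (Suc n) (prepend s (prepend [u] \<xi>)) = s @ [u]"
            using prefix_prepend[of "s @ [u]" \<xi>] z(2) by (simp only: prepend_append length_append length_prefix) simp
          moreover have "prepend s (prepend [u] \<xi>) (Suc n) = \<xi> 0"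
            using z(2) by (simp add: prepend_def)
          ultimately show ?thesis
            using dec[of "prepend s (prepend [u] \<xi>)" "Suc n"] prepend_pts[OF z(1)] z(2) none u by auto
        qed
        then show ?thesis by (simp add: P_def)
      qed
      then show ?thesis using W by blast
    next
      case False
      then show ?thesis using subspaces_self[OF subspaces_space[OF Z]] unfolding P_def by blast
    qed
    ultimately obtain V where V: "V \<in> subspaces N (spn Y)"
      and "\<forall>\<zeta>\<in>pts N (spn V). \<forall>n. \<forall>k\<le>n. P (prefix n \<zeta>) (start (\<zeta> n)) (spn V)"
      using fusion_prefix[OF spY, of "\<lambda>_. P"] by blast
    then have VP: "P (prefix n \<zeta>) (start (\<zeta> n)) (spn V)" if "\<zeta> \<in> pts N (spn V)" for \<zeta> n
      using that by blast
    have "\<zeta> \<notin> U" if z: "\<zeta> \<in> pts N (spn V)" for \<zeta>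
    proof
      assume "\<zeta> \<in> U"
      then obtain n where n: "\<And>\<eta>. prefix n \<eta> = prefix n \<zeta> \<Longrightarrow> \<eta> \<in> U" using U by (auto simp: seq_open_def)
      have zY: "\<zeta> \<in> pts N (spn Y)" using z pts_mono[OF subspaces_spn[OF V]] by blast
      have rej: "rej (prefix n \<zeta>) (start (\<zeta> n)) (spn Y)" for n
      proof (induction n)
        case 0
        show ?case using rej0 z by (simp add: pts_def)
      next
        case (Suc n)
        have "\<zeta> n \<in> constants (start (\<zeta> n)) (spn V)" "stop (\<zeta> n) = start (\<zeta> (Suc n))"
          using z by (auto simp: pts_def constants_def)
        moreover have "\<forall>u\<in>constants (start (\<zeta> n)) (spn V). rej (prefix n \<zeta> @ [u]) (stop u) (spn Y)"
          using VP[OF z, of n] Suc zY unfolding P_def by blast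
        ultimately have "rej (prefix n \<zeta> @ [\<zeta> n]) (stop (\<zeta> n)) (spn Y)" by blast
        then show ?case using \<open>stop (\<zeta> n) = start (\<zeta> (Suc n))\<close> by simp
      qed
      \<comment> \<open>the tail of \<open>Y\<close> accepts this initial segment, as all its continuations are in \<open>U\<close>\<close>
      obtain q where q: "start (\<zeta> n) = start (Y q)" using prefix_chain[OF spY zY] by metis
      have "(\<lambda>i. Y (q + i)) \<in> subspaces (start (\<zeta> n)) (spn Y)"
        using subspaces_shift[OF subspaces_self[OF spY]] q by simp
      moreover have "acc (prefix n \<zeta>) (start (\<zeta> n)) G" for G
        using prefix_prepend[of "prefix n \<zeta>"] by (auto simp: acc_def sect_def intro: n)
      ultimately show False using rej[of n] by (auto simp: rej_def)
    qed
    then have "homogeneous U N (spn V)" by (auto simp: homogeneous_def)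
    then show ?thesis using subspaces_trans[OF Y V] by blast
  qed
qed

lemma ramsey_seq_open: "seq_open U \<Longrightarrow> ramsey U"
  unfolding ramsey_def using homogeneous_seq_open seq_open_sect by blast

text \<open>If the space \<open>Y\<close> decides \<open>V k\<close> after all initial segments of length at least \<open>k\<close>, then within \<open>Y\<close> the
  union coincides with the open set \<open>W\<close>.\<close>
lemma ramsey_UN:
  fixes V :: "nat \<Rightarrow> (nat \<Rightarrow> 'b lword) set"
  assumes V: "\<And>k. ramsey (V k)"
  shows "ramsey (\<Union>k. V k)"
  unfolding ramsey_def
proof (intro allI impI)
  fix s0 N X assume X: "space N X"
  let ?V = "\<lambda>k. sect s0 (V k)"
  have dense: "\<exists>Y\<in>subspaces M (spn Z). homogeneous (sect s (?V k)) M (spn Y)"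
    if "Z \<in> subspaces M (spn X)" for k s M Z
    using ramseyD[OF ramsey_sect[OF V] subspaces_space[OF that]] .
  obtain Y where Y: "Y \<in> subspaces N (spn X)"
    and "\<forall>\<zeta>\<in>pts N (spn Y). \<forall>n. \<forall>k\<le>n. homogeneous (sect (prefix n \<zeta>) (?V k)) (start (\<zeta> n)) (spn Y)"
    using fusion_prefix[OF X, of "\<lambda>k s. homogeneous (sect s (?V k))", OF hereditary_homogeneous dense]
    by blast
  then have hom: "homogeneous (sect (prefix n \<zeta>) (?V k)) (start (\<zeta> n)) (spn Y)"
    if "\<zeta> \<in> pts N (spn Y)" "k \<le> n" for \<zeta> n k
    using that by blast
  note spY = subspaces_space[OF Y]
  define W where "W = {\<zeta>. \<exists>n. pts (start (\<zeta> n)) (spn Y) \<subseteq> sect (prefix n \<zeta>) (\<Union>k. ?V k)}"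
  have "seq_open W"
    unfolding seq_open_def
  proof
    fix \<zeta> assume "\<zeta> \<in> W"
    then obtain n where n: "pts (start (\<zeta> n)) (spn Y) \<subseteq> sect (prefix n \<zeta>) (\<Union>k. ?V k)"
      unfolding W_def by blast
    have "\<eta> \<in> W" if "prefix (Suc n) \<eta> = prefix (Suc n) \<zeta>" for \<eta>
    proof -
      have "prefix n \<eta> = prefix n \<zeta>" "\<eta> n = \<zeta> n" using that by auto
      then have "pts (start (\<eta> n)) (spn Y) \<subseteq> sect (prefix n \<eta>) (\<Union>k. ?V k)" using n by (simp only:)
      then show ?thesis unfolding W_def by blast
    qed
    then show "\<exists>n. \<forall>\<eta>. prefix n \<eta> = prefix n \<zeta> \<longrightarrow> \<eta> \<in> W" by blast
  qed
  then obtain Z where Z: "Z \<in> subspaces N (spn Y)" "homogeneous W N (spn Z)"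
    using homogeneous_seq_open[OF spY] by blast
  have "\<zeta> \<in> W \<longleftrightarrow> \<zeta> \<in> (\<Union>k. ?V k)" if z: "\<zeta> \<in> pts N (spn Y)" for \<zeta>
  proof
    assume "\<zeta> \<in> W"
    then obtain n where "pts (start (\<zeta> n)) (spn Y) \<subseteq> sect (prefix n \<zeta>) (\<Union>k. ?V k)"
      unfolding W_def by blast
    then have "tail n \<zeta> \<in> sect (prefix n \<zeta>) (\<Union>k. ?V k)" using tail_pts[OF z] by blast
    then show "\<zeta> \<in> (\<Union>k. ?V k)" unfolding sect_def[of "prefix n \<zeta>"] by simp
  next
    assume "\<zeta> \<in> (\<Union>k. ?V k)"
    then obtain k where k: "\<zeta> \<in> ?V k" by blast
    have "tail k \<zeta> \<in> pts (start (\<zeta> k)) (spn Y) \<inter> sect (prefix k \<zeta>) (?V k)"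
      using tail_pts[OF z] k unfolding sect_def[of "prefix k \<zeta>"] by simp
    then have "pts (start (\<zeta> k)) (spn Y) \<subseteq> sect (prefix k \<zeta>) (?V k)"
      using hom[OF z, of k k] unfolding homogeneous_def by blast
    then have "pts (start (\<zeta> k)) (spn Y) \<subseteq> sect (prefix k \<zeta>) (\<Union>k. ?V k)"
      unfolding sect_simps by blast
    then show "\<zeta> \<in> W" unfolding W_def by blast
  qed
  then have "homogeneous (\<Union>k. ?V k) N (spn Z)"
    using Z(2) pts_mono[OF subspaces_spn[OF Z(1)], of N] unfolding homogeneous_def by blast
  then show "\<exists>Y\<in>subspaces N (spn X). homogeneous (sect s0 (\<Union>k. V k)) N (spn Y)"
    using subspaces_trans[OF Y Z(1)] by auto
qed

lemma ramsey_INT: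
  fixes V :: "nat \<Rightarrow> (nat \<Rightarrow> 'b lword) set"
  assumes "\<And>k. ramsey (V k)"
  shows "ramsey (\<Inter>k. V k)"
  using ramsey_Compl[OF ramsey_UN[of "\<lambda>k. - V k"]] ramsey_Compl assms by simp

lemma ramsey_Int:
  assumes "ramsey U" "ramsey V"
  shows "ramsey (U \<inter> V)"
proof -
  have "(\<Inter>k::nat. if k = 0 then U else V) = U \<inter> V" by (auto split: if_splits)
  then show ?thesis using ramsey_INT[of "\<lambda>k. if k = 0 then U else V"] assms by simp
qed

lemma sect_souslin: "sect s (souslin_operation B) = souslin_operation (\<lambda>\<tau>. sect s (B \<tau>))"
  by (auto simp: souslin_operation_def sect_def)

text \<open>Let \<open>U \<tau>\<close> be the part of the result that is contributed by the branches through \<open>\<tau>\<close>, so that \<open>U \<tau>\<close> is the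
  union of the sets \<open>U (\<tau> @ [k])\<close>, and let \<open>B \<tau>\<close> be the intersection of \<open>V\<close> along \<open>\<tau>\<close>. A fusion gives a
  space \<open>Y\<close> in which every initial segment that is long in comparison with \<open>\<tau>\<close> either has no continuation
  in \<open>U \<tau>\<close>, or has one in every subspace. Removing from \<open>B \<tau>\<close> the sequences with an initial segment of
  the first kind leaves a Ramsey set \<open>\<Phi> \<tau>\<close>. Within \<open>Y\<close> it is a hull of \<open>U \<tau>\<close>: it contains \<open>U \<tau>\<close>, and
  \<open>\<Phi> \<tau> - U \<tau>\<close> does not contain all continuations of an initial segment in any subspace. So the Ramsey set
  \<open>\<Psi> \<tau> = \<Phi> \<tau> - (\<Union>k. \<Phi> (\<tau> @ [k]))\<close> can be avoided. On a space \<open>Z\<close> that avoids all \<open>\<Psi> \<tau>\<close>, a sequence in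
  \<open>\<Phi> []\<close> follows a branch of the sets \<open>\<Phi> \<tau> \<subseteq> V \<tau>\<close>, so \<open>\<Phi> []\<close> coincides with the result.\<close>
lemma homogeneous_souslin:
  fixes V :: "nat list \<Rightarrow> (nat \<Rightarrow> 'b lword) set"
  assumes V: "\<And>\<tau>. ramsey (V \<tau>)" and X: "space N X"
  shows "\<exists>Y\<in>subspaces N (spn X). homogeneous (souslin_operation V) N (spn Y)"
proof -
  define B where "B \<tau> = (\<Inter>k. V (take k \<tau>))" for \<tau>
  define U where "U \<tau> = {z. \<exists>\<sigma>. map \<sigma> [0..<length \<tau>] = \<tau> \<and> (\<forall>n. z \<in> V (map \<sigma> [0..<n]))}" for \<tau>
  have BV: "B \<tau> \<subseteq> V \<tau>" for \<tau> using INT_lower[of "length \<tau>" UNIV "\<lambda>k. V (take k \<tau>)"] by (simp add: B_def)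
  have UB: "U \<tau> \<subseteq> B \<tau>" for \<tau>
  proof
    fix z assume "z \<in> U \<tau>"
    then obtain \<sigma> where \<sigma>: "map \<sigma> [0..<length \<tau>] = \<tau>" "\<And>n. z \<in> V (map \<sigma> [0..<n])"
      by (auto simp: U_def)
    have "take k \<tau> = map \<sigma> [0..<min k (length \<tau>)]" for k
      using \<sigma>(1) by (metis add.left_neutral take_map take_upt min.cobounded2 min.commute take_all_iff
          nat_le_linear length_map length_upt diff_zero min_def)
    then show "z \<in> B \<tau>" using \<sigma>(2) by (simp add: B_def)
  qed
  have U_step: "U \<tau> \<subseteq> (\<Union>k. U (\<tau> @ [k]))" for \<tau>
  proof
    fix z assume "z \<in> U \<tau>"
    then obtain \<sigma> where \<sigma>: "map \<sigma> [0..<length \<tau>] = \<tau>" "\<And>n. z \<in> V (map \<sigma> [0..<n])"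
      by (auto simp: U_def)
    then have "z \<in> U (\<tau> @ [\<sigma> (length \<tau>)])" by (auto simp: U_def intro!: exI[of _ \<sigma>])
    then show "z \<in> (\<Union>k. U (\<tau> @ [k]))" by blast
  qed
  have U_Nil: "U [] = souslin_operation V" by (auto simp: U_def souslin_operation_def)
  define P where "P k s M G \<longleftrightarrow> pts M G \<inter> sect s (U (from_nat k)) = {} \<or>
      (\<forall>Z\<in>subspaces M G. pts M (spn Z) \<inter> sect s (U (from_nat k)) \<noteq> {})" for k :: nat and s M G
  have "hereditary (P k)" for k
    unfolding hereditary_def
  proof (intro allI impI)
    fix s M G G' assume P: "P k s M G" and sub: "\<forall>u\<in>G'. M \<le> start u \<longrightarrow> u \<in> G"
    show "P k s M G'"
      using P pts_antimono[OF sub] subspaces_antimono[OF sub] unfolding P_def by blast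
  qed
  moreover have "\<exists>W\<in>subspaces M (spn Z). P k s M (spn W)" if "Z \<in> subspaces M (spn X)" for k s M Z
    using subspaces_self[OF subspaces_space[OF that]] unfolding P_def by blast
  ultimately obtain Y where Y: "Y \<in> subspaces N (spn X)"
    and YP: "\<forall>\<zeta>\<in>pts N (spn Y). \<forall>n. \<forall>k\<le>n. P k (prefix n \<zeta>) (start (\<zeta> n)) (spn Y)"
    using fusion_prefix[OF X, of P] by blast
  note spY = subspaces_space[OF Y]
  define C where "C \<tau> = {\<zeta>. \<exists>n\<ge>to_nat \<tau>. pts (start (\<zeta> n)) (spn Y) \<inter> sect (prefix n \<zeta>) (U \<tau>) = {}}"
    for \<tau>
  have "seq_open (C \<tau>)" for \<tau>
    unfolding seq_open_def
  proof
    fix \<zeta> assume "\<zeta> \<in> C \<tau>"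
    then obtain n where n: "n \<ge> to_nat \<tau>" "pts (start (\<zeta> n)) (spn Y) \<inter> sect (prefix n \<zeta>) (U \<tau>) = {}"
      unfolding C_def by blast
    have "\<eta> \<in> C \<tau>" if "prefix (Suc n) \<eta> = prefix (Suc n) \<zeta>" for \<eta>
    proof -
      have "prefix n \<eta> = prefix n \<zeta>" "\<eta> n = \<zeta> n" using that by auto
      then have "pts (start (\<eta> n)) (spn Y) \<inter> sect (prefix n \<eta>) (U \<tau>) = {}" using n(2) by (simp only:)
      then show ?thesis using n(1) unfolding C_def by blast
    qed
    then show "\<exists>n. \<forall>\<eta>. prefix n \<eta> = prefix n \<zeta> \<longrightarrow> \<eta> \<in> C \<tau>" by blast
  qed
  note C_ramsey = ramsey_Compl[OF ramsey_seq_open[OF this]]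
  define \<Phi> where "\<Phi> \<tau> = B \<tau> \<inter> - C \<tau>" for \<tau>
  define \<Psi> where "\<Psi> \<tau> = \<Phi> \<tau> \<inter> - (\<Union>k. \<Phi> (\<tau> @ [k]))" for \<tau>
  have \<Phi>_ramsey: "ramsey (\<Phi> \<tau>)" for \<tau>
    unfolding \<Phi>_def B_def by (intro ramsey_Int ramsey_INT V C_ramsey)
  then have \<Psi>_ramsey: "ramsey (\<Psi> \<tau>)" for \<tau>
    unfolding \<Psi>_def by (intro ramsey_Int ramsey_Compl ramsey_UN)
  have U_\<Phi>: "\<zeta> \<in> \<Phi> \<tau>" if z: "\<zeta> \<in> pts N (spn Y)" "\<zeta> \<in> U \<tau>" for \<zeta> \<tau>
  proof -
    have "tail n \<zeta> \<in> pts (start (\<zeta> n)) (spn Y) \<inter> sect (prefix n \<zeta>) (U \<tau>)" for n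
      using tail_pts[OF z(1)] z(2) by (simp add: sect_def)
    then have "\<zeta> \<notin> C \<tau>" unfolding C_def by blast
    then show ?thesis using UB z(2) by (auto simp: \<Phi>_def)
  qed
  have dense: "\<exists>W\<in>subspaces M (spn Z). homogeneous (sect s (\<Psi> (from_nat k))) M (spn W)"
    if "Z \<in> subspaces M (spn Y)" for k s M Z
    using ramseyD[OF \<Psi>_ramsey subspaces_space[OF that]] .
  obtain Z where Z: "Z \<in> subspaces N (spn Y)"
    and ZP: "\<forall>\<zeta>\<in>pts N (spn Z). \<forall>n. \<forall>k\<le>n.
      homogeneous (sect (prefix n \<zeta>) (\<Psi> (from_nat k))) (start (\<zeta> n)) (spn Z)"
    using fusion_prefix[OF spY, of "\<lambda>k s. homogeneous (sect s (\<Psi> (from_nat k)))",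
        OF hereditary_homogeneous dense] by blast
  note spZ = subspaces_space[OF Z]
  have ZY: "pts M (spn Z) \<subseteq> pts M (spn Y)" for M by (rule pts_mono[OF subspaces_spn[OF Z]])
  have null: "\<zeta> \<notin> \<Psi> \<tau>" if z: "\<zeta> \<in> pts N (spn Z)" for \<zeta> \<tau>
  proof
    assume \<Psi>: "\<zeta> \<in> \<Psi> \<tau>"
    \<comment> \<open>the first length at which both fusions have taken care of \<open>\<tau>\<close>\<close>
    define n where "n = to_nat \<tau>"
    let ?M = "start (\<zeta> n)" and ?s = "prefix n \<zeta>"
    have "tail n \<zeta> \<in> pts ?M (spn Z) \<inter> sect ?s (\<Psi> \<tau>)"
      using tail_pts[OF z] \<Psi> by (simp add: sect_def)
    moreover have "homogeneous (sect ?s (\<Psi> \<tau>)) ?M (spn Z)"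
      using ZP z unfolding n_def by (metis from_nat_to_nat order_refl)
    ultimately have sub: "pts ?M (spn Z) \<subseteq> sect ?s (\<Psi> \<tau>)" unfolding homogeneous_def by blast
    have disj: "pts ?M (spn Z) \<inter> sect ?s (U \<tau>) = {}"
    proof (rule ccontr)
      assume "pts ?M (spn Z) \<inter> sect ?s (U \<tau>) \<noteq> {}"
      then obtain \<eta> where \<eta>: "\<eta> \<in> pts ?M (spn Z)" "prepend ?s \<eta> \<in> U \<tau>" by (auto simp: sect_def)
      have "prepend ?s \<eta> \<in> pts N (spn Y)" using prepend_pts[OF z \<eta>(1)] ZY by blast
      then have "prepend ?s \<eta> \<in> (\<Union>k. \<Phi> (\<tau> @ [k]))" using U_step[of \<tau>] \<eta>(2) U_\<Phi> by blast
      moreover have "prepend ?s \<eta> \<in> \<Psi> \<tau>" using sub \<eta>(1) by (auto simp: sect_def)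
      ultimately show False by (auto simp: \<Psi>_def)
    qed
    obtain q where q: "?M = start (Z q)" using prefix_chain[OF spZ z] by metis
    have "(\<lambda>i. Z (q + i)) \<in> subspaces ?M (spn Y)" using subspaces_shift[OF Z] q by simp
    moreover have "pts ?M (spn (\<lambda>i. Z (q + i))) \<subseteq> pts ?M (spn Z)" by (intro pts_mono gen_mono) auto
    moreover have "P n ?s ?M (spn Y)" using YP z ZY by blast
    ultimately have "pts ?M (spn Y) \<inter> sect ?s (U \<tau>) = {}"
      using disj unfolding P_def n_def from_nat_to_nat by blast
    then have "\<zeta> \<in> C \<tau>" unfolding C_def n_def by blast
    then show False using \<Psi> by (simp add: \<Psi>_def \<Phi>_def)
  qed
  have "\<zeta> \<in> souslin_operation V \<longleftrightarrow> \<zeta> \<in> \<Phi> []" if z: "\<zeta> \<in> pts N (spn Z)" for \<zeta>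
  proof
    assume "\<zeta> \<in> souslin_operation V"
    then show "\<zeta> \<in> \<Phi> []" using U_\<Phi> U_Nil z ZY by blast
  next
    assume \<Phi>: "\<zeta> \<in> \<Phi> []"
    have next_k: "\<exists>k. \<zeta> \<in> \<Phi> (\<tau> @ [k])" if "\<zeta> \<in> \<Phi> \<tau>" for \<tau>
      using null[OF z, of \<tau>] that by (auto simp: \<Psi>_def)
    have "\<exists>t. \<forall>n. (\<zeta> \<in> \<Phi> (t n) \<and> length (t n) = n) \<and> (\<exists>k. t (Suc n) = t n @ [k])"
    proof (rule dependent_nat_choice)
      show "\<exists>\<tau>. \<zeta> \<in> \<Phi> \<tau> \<and> length \<tau> = 0" using \<Phi> by auto
      show "\<exists>\<tau>'. (\<zeta> \<in> \<Phi> \<tau>' \<and> length \<tau>' = Suc n) \<and> (\<exists>k. \<tau>' = \<tau> @ [k])"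
        if "\<zeta> \<in> \<Phi> \<tau> \<and> length \<tau> = n" for \<tau> n
        using next_k[of \<tau>] that by auto
    qed
    then obtain t where t: "\<And>n. \<zeta> \<in> \<Phi> (t n)" "\<And>n. length (t n) = n" "\<And>n. \<exists>k. t (Suc n) = t n @ [k]"
      by blast
    have tn: "t n = map (\<lambda>i. last (t (Suc i))) [0..<n]" for n
    proof (induction n)
      case (Suc n)
      then show ?case using t(3)[of n] by auto
    qed (use t(2)[of 0] in simp)
    have "\<zeta> \<in> V (map (\<lambda>i. last (t (Suc i))) [0..<n])" for n
    proof -
      have "\<zeta> \<in> V (t n)" using t(1)[of n] BV[of "t n"] unfolding \<Phi>_def by blast
      then show ?thesis using tn by metis
    qed
    then show "\<zeta> \<in> souslin_operation V"
      unfolding souslin_operation_def by blast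
  qed
  note eq = this
  obtain W where W: "W \<in> subspaces N (spn Z)" "homogeneous (\<Phi> []) N (spn W)"
    using ramseyD[OF \<Phi>_ramsey spZ, of "[]" "[]"] by auto
  have "homogeneous (souslin_operation V) N (spn W)"
    using W(2) eq pts_mono[OF subspaces_spn[OF W(1)], of N] unfolding homogeneous_def by blast
  then show ?thesis using subspaces_trans[OF Y subspaces_trans[OF Z W(1)]] by blast
qed

lemma ramsey_souslin: "(\<And>\<tau>. ramsey (V \<tau>)) \<Longrightarrow> ramsey (souslin_operation V)"
  unfolding ramsey_def[of "souslin_operation V"] sect_souslin
  using homogeneous_souslin[of "\<lambda>\<tau>. sect _ (V \<tau>)"] ramsey_sect by blast

lemma ramsey_coloring:
  assumes X: "space N X" and fin: "finite K" and U: "\<And>k. k \<in> K \<Longrightarrow> ramsey (U k)"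
  shows "\<exists>Y\<in>subspaces N (spn X). \<forall>k\<in>K. homogeneous (U k) N (spn Y)"
proof -
  define P where "P k M G \<longleftrightarrow> k \<in> K \<longrightarrow> homogeneous (U k) M G" for k M G
  have "hereditary P"
    unfolding hereditary_def P_def using homogeneous_antimono by blast
  moreover have "\<exists>Y\<in>subspaces N (spn Z). P k N (spn Y)" if Z: "Z \<in> subspaces N (spn X)" for k Z
  proof (cases "k \<in> K")
    case True
    then show ?thesis using ramseyD[OF U subspaces_space[OF Z], of k "[]"] by (simp add: P_def)
  next
    case False
    then show ?thesis using subspaces_self[OF subspaces_space[OF Z]] by (auto simp: P_def)
  qed
  ultimately obtain Y where "Y \<in> subspaces N (spn X)" "\<forall>k\<in>K. P k N (spn Y)"
    using refine_finite[OF _ fin _ gen_gen subspaces_self[OF X], of P] by blast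
  then show ?thesis by (auto simp: P_def)
qed

end

section \<open>Levels of trees\<close>

lemma tree_order:
  assumes "tree T"
  shows tree_refl: "x \<in> Field T \<Longrightarrow> (x, x) \<in> T"
    and tree_trans: "(x, y) \<in> T \<Longrightarrow> (y, z) \<in> T \<Longrightarrow> (x, z) \<in> T"
    and tree_antisym: "(x, y) \<in> T \<Longrightarrow> (y, x) \<in> T \<Longrightarrow> x = y"
    and tree_finite_underS: "x \<in> Field T \<Longrightarrow> finite (underS T x)"
  using assms unfolding tree_def partial_order_on_def preorder_on_def refl_on_def
  by (auto dest: antisymD transD)

lemma card_underS_less:
  assumes T: "tree T" and xy: "(x, y) \<in> T" "x \<noteq> y"
  shows "card (underS T x) < card (underS T y)"
proof (rule psubset_card_mono)
  show "finite (underS T y)" using xy by (intro tree_finite_underS[OF T]) (auto simp: Field_def)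
  have "underS T x \<subseteq> underS T y"
    using tree_trans[OF T] tree_antisym[OF T] xy unfolding underS_def by blast
  moreover have "x \<in> underS T y" "x \<notin> underS T x" using xy by (auto simp: underS_def)
  ultimately show "underS T x \<subset> underS T y" by blast
qed

lemma level_eqI: "tree T \<Longrightarrow> x \<in> level T n \<Longrightarrow> y \<in> level T n \<Longrightarrow> (x, y) \<in> T \<Longrightarrow> x = y"
  using card_underS_less[of T x y] by (auto simp: level_def)

text \<open>A maximal element of the finite chain below \<open>x\<close> is the immediate predecessor of \<open>x\<close>.\<close>
lemma level_predecessor:
  assumes T: "tree T" and x: "x \<in> level T (Suc n)"
  obtains y where "y \<in> level T n" "x \<in> imm_succs T y"
proof -
  have xF: "x \<in> Field T" and c: "card (underS T x) = Suc n" using x by (auto simp: level_def)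
  have fin: "finite (underS T x)" and ne: "underS T x \<noteq> {}"
    using c card_gt_0_iff[of "underS T x"] by auto
  define h where "h z = card (underS T z)" for z
  have "Max (h ` underS T x) \<in> h ` underS T x" using fin ne by (intro Max_in) auto
  then obtain y where y: "y \<in> underS T x" "h y = Max (h ` underS T x)" by auto
  have ymax: "h z \<le> h y" if "z \<in> underS T x" for z
    unfolding y(2) using fin that by (intro Max_ge) auto
  have yx: "(y, x) \<in> T" "y \<noteq> x" "y \<in> Field T" using y(1) by (auto simp: underS_def Field_def)
  have under: "underS T x \<subseteq> insert y (underS T y)"
  proof
    fix z assume z: "z \<in> underS T x"
    then have "(y, z) \<in> T \<or> (z, y) \<in> T"
      using tree_under_total[OF T yx(1)] by (auto simp: underS_def)
    then show "z \<in> insert y (underS T y)"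
      using ymax[OF z] card_underS_less[OF T, of y z] by (auto simp: underS_def h_def)
  qed
  moreover have "insert y (underS T y) \<subseteq> underS T x"
    using y(1) tree_trans[OF T] tree_antisym[OF T] unfolding underS_def by blast
  ultimately have "underS T x = insert y (underS T y)" by blast
  then have "Suc n = Suc (card (underS T y))"
    using c tree_finite_underS[OF T yx(3)] by (simp add: underS_def)
  then have "y \<in> level T n" using yx by (simp add: level_def)
  moreover have "x \<in> imm_succs T y"
  proof -
    have "\<not> (u \<in> aboveS T y \<and> u \<noteq> x \<and> (u, x) \<in> T)" for u
    proof
      assume u: "u \<in> aboveS T y \<and> u \<noteq> x \<and> (u, x) \<in> T"
      then have "u \<in> insert y (underS T y)" using under by (auto simp: underS_def)
      then show False using u tree_antisym[OF T] by (auto simp: underS_def aboveS_def)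
    qed
    then show ?thesis using yx by (auto simp: imm_succs_def aboveS_def)
  qed
  ultimately show ?thesis using that by blast
qed

lemma finite_level:
  assumes T: "tree T"
  shows "finite (level T n)"
proof (induction n)
  case 0
  obtain r where r: "r \<in> Field T" "\<And>t. t \<in> Field T \<Longrightarrow> (r, t) \<in> T"
    using T by (auto simp: tree_def)
  have "x = r" if "x \<in> level T 0" for x
  proof (rule ccontr)
    assume "x \<noteq> r"
    have "x \<in> Field T" "underS T x = {}"
      using that tree_finite_underS[OF T] by (auto simp: level_def)
    moreover have "r \<in> underS T x" using r(2)[OF \<open>x \<in> Field T\<close>] \<open>x \<noteq> r\<close> by (simp add: underS_def)
    ultimately show False by blast
  qed
  then have "level T 0 \<subseteq> {r}" by blast
  then show ?case by (rule finite_subset) simp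
next
  case (Suc n)
  have "level T (Suc n) \<subseteq> (\<Union>y\<in>level T n \<inter> {y. aboveS T y \<noteq> {}}. imm_succs T y)"
  proof
    fix x assume "x \<in> level T (Suc n)"
    then obtain y where "y \<in> level T n" "x \<in> imm_succs T y" using level_predecessor[OF T] by metis
    then show "x \<in> (\<Union>y\<in>level T n \<inter> {y. aboveS T y \<noteq> {}}. imm_succs T y)"
      by (auto simp: imm_succs_def)
  qed
  moreover have "finite (imm_succs T y)" if "y \<in> level T n" "aboveS T y \<noteq> {}" for y
    using T that by (auto simp: tree_def level_def)
  ultimately show ?case using Suc by (auto intro: finite_subset)
qed

text \<open>A maximal node would be the end of a finite maximal chain. So there are nodes above \<open>t\<close>, and a lowest
  one of them is on the next level.\<close>
lemma level_extend_Suc: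
  assumes T: "tree T" and inf: "infinite_height T" and t: "t \<in> level T n"
  obtains s where "s \<in> level T (Suc n)" "(t, s) \<in> T"
proof -
  have tF: "t \<in> Field T" using t by (simp add: level_def)
  have ne: "aboveS T t \<noteq> {}"
  proof
    assume max: "aboveS T t = {}"
    let ?C = "insert t (underS T t)"
    have "?C \<in> Chains T"
    proof -
      have "(x, y) \<in> T \<or> (y, x) \<in> T" if "x \<in> ?C" "y \<in> ?C" for x y
      proof (rule tree_under_total[OF T])
        show "(x, t) \<in> T" "(y, t) \<in> T" using that tree_refl[OF T tF] by (auto simp: underS_def)
      qed
      then show ?thesis by (simp only: Chains_def mem_Collect_eq) blast
    qed
    moreover have "\<forall>D\<in>Chains T. ?C \<subseteq> D \<longrightarrow> D = ?C"
    proof (intro ballI impI)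
      fix D assume D: "D \<in> Chains T" "?C \<subseteq> D"
      have "x \<in> ?C" if "x \<in> D" for x
      proof -
        have "(x, t) \<in> T \<or> (t, x) \<in> T" using D that unfolding Chains_def by blast
        then show ?thesis using max by (auto simp: underS_def aboveS_def)
      qed
      then show "D = ?C" using D(2) by blast
    qed
    ultimately have "?C \<in> max_chains T" unfolding max_chains_def by blast
    then have "?C \<approx> (UNIV :: nat set)" using inf by (simp add: infinite_height_def)
    then have "infinite ?C" using eqpoll_finite_iff by auto
    then show False using tree_finite_underS[OF T tF] by simp
  qed
  obtain s where s: "s \<in> aboveS T t" "\<And>z. z \<in> aboveS T t \<Longrightarrow> card (underS T s) \<le> card (underS T z)"
    using ex_has_least_nat[of "\<lambda>s. s \<in> aboveS T t" _ "\<lambda>s. card (underS T s)"] ne by blast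
  have ts: "(t, s) \<in> T" "s \<noteq> t" "s \<in> Field T" using s(1) by (auto simp: aboveS_def Field_def)
  have "underS T s \<subseteq> insert t (underS T t)"
  proof
    fix z assume z: "z \<in> underS T s"
    then have zs: "(z, s) \<in> T" "z \<noteq> s" by (auto simp: underS_def)
    have "z \<notin> aboveS T t" using s(2)[of z] card_underS_less[OF T zs] by force
    then show "z \<in> insert t (underS T t)"
      using tree_under_total[OF T ts(1) zs(1)] by (auto simp: aboveS_def underS_def)
  qed
  moreover have "insert t (underS T t) \<subseteq> underS T s"
    using ts tree_trans[OF T] tree_antisym[OF T] unfolding underS_def by blast
  ultimately have "underS T s = insert t (underS T t)" by blast
  then have "card (underS T s) = Suc (card (underS T t))"
    using tree_finite_underS[OF T tF] by (simp add: underS_def)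
  then have "s \<in> level T (Suc n)" using t ts(3) by (simp add: level_def)
  then show ?thesis using that ts(1) by blast
qed

lemma level_extend:
  assumes T: "tree T" and inf: "infinite_height T" and t: "t \<in> level T m" and "m \<le> n"
  obtains s where "s \<in> level T n" "(t, s) \<in> T"
proof -
  have "\<exists>s\<in>level T n. (t, s) \<in> T"
    using \<open>m \<le> n\<close>
  proof (induction rule: dec_induct)
    case base
    then show ?case using t tree_refl[OF T, of t] by (auto simp: level_def)
  next
    case (step n)
    then show ?case using level_extend_Suc[OF T inf] tree_trans[OF T] by metis
  qed
  then show ?thesis using that by blast
qed

section \<open>Threads through the wildcard sets of a subspace\<close>

text \<open>A subspace \<open>X\<close> together with the data that its definition only asserts to exist: the wildcard set \<open>Ds i\<close> of the
  \<open>i\<close>-th word lies on level \<open>lev i\<close>, and the word itself occupies the levels from \<open>bnd i\<close> up to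
  \<open>bnd (Suc i)\<close>. The letter \<open>l0\<close> is written wherever the choice of a letter is immaterial.\<close>
locale blocks =
  fixes \<Lambda> :: "'l set" and \<T> :: "'a rel list" and X :: "nat \<Rightarrow> ('l, 'a) vword"
    and Ds :: "nat \<Rightarrow> 'a set list" and lev bnd :: "nat \<Rightarrow> nat" and l0 :: 'l
  assumes finite_letters: "finite \<Lambda>" and l0: "l0 \<in> \<Lambda>"
    and vtree: "vector_tree \<T>" and vinf: "vector_infinite_height \<T>"
    and bnd0: "bnd 0 = 0" and lev: "\<And>i. bnd i \<le> lev i" "\<And>i. lev i < bnd (Suc i)"
    and Ds: "\<And>i. vector_level_subset_at \<T> (lev i) (Ds i)"
    and X: "\<And>i. X i \<in> vwords_between \<Lambda> \<T> (Ds i) (bnd i) (bnd (Suc i))"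
    and dom_Ds: "\<And>i. vdominates \<T> (Ds i) (vlevel \<T> i)"
begin

abbreviation L :: "nat \<Rightarrow> 'a list set" where "L i \<equiv> listset (vlevel \<T> i)"

lemma tree_nth: "c < length \<T> \<Longrightarrow> tree (\<T> ! c)" "c < length \<T> \<Longrightarrow> infinite_height (\<T> ! c)"
  using vtree vinf by (auto simp: vector_tree_def vector_infinite_height_def)

lemma in_L_iff: "\<tau> \<in> L i \<longleftrightarrow> length \<tau> = length \<T> \<and> (\<forall>c<length \<T>. \<tau> ! c \<in> level (\<T> ! c) i)"
  by (simp add: in_listset_iff vlevel_def)

lemma finite_L: "finite (L i)"
proof -
  have "L i \<subseteq> {\<tau>. set \<tau> \<subseteq> (\<Union>c<length \<T>. level (\<T> ! c) i) \<and> length \<tau> = length \<T>}"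
    by (fastforce simp: in_L_iff in_set_conv_nth)
  moreover have "finite (\<Union>c<length \<T>. level (\<T> ! c) i)" using tree_nth finite_level by auto
  ultimately show ?thesis using finite_lists_length_eq finite_subset by blast
qed

lemma bnd_less: "i < j \<Longrightarrow> bnd i < bnd j"
  using lev by (metis le_less_trans lift_Suc_mono_less)

lemma bnd_le: "i \<le> j \<Longrightarrow> bnd i \<le> bnd j"
  using bnd_less by (metis le_neq_implies_less order_refl less_imp_le)

lemma bnd_ge: "i \<le> bnd i"
  using bnd_less by (simp add: strict_mono_imp_increasing strict_monoI)

lemma length_Ds: "length (Ds i) = length \<T>"
  using Ds[of i] by (simp add: vector_level_subset_at_def list_all2_lengthD)

lemma Ds_nth: "c < length \<T> \<Longrightarrow> Ds i ! c \<subseteq> level (\<T> ! c) (lev i)" 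
  using Ds[of i] by (auto simp: vector_level_subset_at_def list_all2_conv_all_nth)

lemma above_in_Ds:
  assumes c: "c < length \<T>" and t: "t \<in> level (\<T> ! c) n" "n \<le> i"
  shows "\<exists>y\<in>Ds i ! c. (t, y) \<in> \<T> ! c"
proof -
  obtain s where s: "s \<in> level (\<T> ! c) i" "(t, s) \<in> \<T> ! c"
    using level_extend[OF tree_nth[OF c] t] .
  obtain y where "y \<in> Ds i ! c" "(s, y) \<in> \<T> ! c"
    using dom_Ds[of i] s(1) c by (auto simp: vdominates_def dominates_def vlevel_def)
  then show ?thesis using tree_trans[OF tree_nth(1)[OF c] s(2)] by blast
qed

text \<open>The selected blocks. The wildcard set of block \<open>i\<close> dominates level \<open>i\<close>, so the one of block \<open>J (Suc p)\<close> dominates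
  \<open>Ds (J p)\<close>, which lies one level below.\<close>
primrec J :: "nat \<Rightarrow> nat" where
  "J 0 = 0"
| "J (Suc p) = Suc (lev (J p))"

lemma J_strict_mono: "strict_mono J"
proof -
  have "J p < J (Suc p)" for p using bnd_ge[of "J p"] lev(1)[of "J p"] by simp
  then show ?thesis by (simp add: strict_mono_Suc_iff)
qed

lemma thread_ex:
  assumes c: "c < length \<T>" and t: "t \<in> level (\<T> ! c) i"
  shows "\<exists>b. \<forall>p. i \<le> J p \<longrightarrow> b p \<in> Ds (J p) ! c \<and> (t, b p) \<in> \<T> ! c \<and> (b p, b (Suc p)) \<in> \<T> ! c"
proof -
  define P where "P p x \<longleftrightarrow> (if i \<le> J p then x \<in> Ds (J p) ! c \<and> (t, x) \<in> \<T> ! c else x = t)" for p x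
  have "\<exists>b. \<forall>p. P p (b p) \<and> (i \<le> J p \<longrightarrow> (b p, b (Suc p)) \<in> \<T> ! c)"
  proof (rule dependent_nat_choice)
    show "\<exists>x. P 0 x" using above_in_Ds[OF c t, of "J 0"] by (auto simp: P_def)
    fix x p assume x: "P p x"
    show "\<exists>y. P (Suc p) y \<and> (i \<le> J p \<longrightarrow> (x, y) \<in> \<T> ! c)"
    proof (cases "i \<le> J p")
      case True
      then have "x \<in> level (\<T> ! c) (lev (J p))" "(t, x) \<in> \<T> ! c"
        using x Ds_nth[OF c] by (auto simp: P_def)
      moreover have "i \<le> J (Suc p)" using True strict_monoD[OF J_strict_mono, of p "Suc p"] by linarith
      ultimately show ?thesis
        using above_in_Ds[OF c, of x "lev (J p)" "J (Suc p)"] tree_trans[OF tree_nth(1)[OF c]]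
        unfolding P_def by fastforce
    next
      case False
      then show ?thesis using above_in_Ds[OF c t, of "J (Suc p)"] unfolding P_def by auto
    qed
  qed
  then show ?thesis unfolding P_def by metis
qed

text \<open>The level of \<open>t\<close> is written as the number of its predecessors. The thread has values in the wildcard sets
  from the first selected block on whose index is at least this level.\<close>
definition thread :: "nat \<Rightarrow> 'a \<Rightarrow> nat \<Rightarrow> 'a" where
  "thread c t = (SOME b. \<forall>p. card (underS (\<T> ! c) t) \<le> J p \<longrightarrow>
     b p \<in> Ds (J p) ! c \<and> (t, b p) \<in> \<T> ! c \<and> (b p, b (Suc p)) \<in> \<T> ! c)"

lemma thread:
  assumes "c < length \<T>" "t \<in> level (\<T> ! c) i" "i \<le> J p"
  shows "thread c t p \<in> Ds (J p) ! c" "(t, thread c t p) \<in> \<T> ! c"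
    "(thread c t p, thread c t (Suc p)) \<in> \<T> ! c"
proof -
  have "\<exists>b. \<forall>p. card (underS (\<T> ! c) t) \<le> J p \<longrightarrow>
       b p \<in> Ds (J p) ! c \<and> (t, b p) \<in> \<T> ! c \<and> (b p, b (Suc p)) \<in> \<T> ! c"
    using thread_ex[OF assms(1), of t "card (underS (\<T> ! c) t)"] assms(2) by (simp add: level_def)
  from someI_ex[OF this, folded thread_def]
show "thread c t p \<in> Ds (J p) ! c" "(t, thread c t p) \<in> \<T> ! c"
    "(thread c t p, thread c t (Suc p)) \<in> \<T> ! c"
    using assms(2,3) by (auto simp: level_def)
qed

text \<open>The copy of \<open>\<otimes>T(i)\<close> in the wildcards of block \<open>J p\<close> is the image of \<open>L i\<close> under
  \<open>\<lambda>\<tau>. vthread \<tau> p\<close>, provided that \<open>i \<le> J p\<close>.\<close>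
definition vthread :: "'a list \<Rightarrow> nat \<Rightarrow> 'a list" where
  "vthread \<tau> p = map (\<lambda>c. thread c (\<tau> ! c) p) [0..<length \<T>]"

lemma vthread_nth: "c < length \<T> \<Longrightarrow> vthread \<tau> p ! c = thread c (\<tau> ! c) p"
  and length_vthread: "length (vthread \<tau> p) = length \<T>"
  by (simp_all add: vthread_def)

lemma vthread_in_Ds:
  assumes "\<tau> \<in> L i" "i \<le> J p"
  shows "vthread \<tau> p \<in> listset (Ds (J p))"
  using assms(1)[unfolded in_L_iff] thread(1)[OF _ _ assms(2)]
  by (simp add: in_listset_iff[of _ "Ds _"] length_Ds vthread_nth length_vthread)

text \<open>Two nodes of the same level below a common node are equal.\<close>
lemma vthread_inj:
  assumes "\<tau> \<in> L i" "\<tau>' \<in> L i" "i \<le> J p" "vthread \<tau> p = vthread \<tau>' p"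
  shows "\<tau> = \<tau>'"
proof (rule nth_equalityI)
  show "length \<tau> = length \<tau>'" using assms by (simp add: in_L_iff)
  fix c assume "c < length \<tau>"
  then have c: "c < length \<T>" using assms by (simp add: in_L_iff)
  have lv: "\<tau> ! c \<in> level (\<T> ! c) i" "\<tau>' ! c \<in> level (\<T> ! c) i" using assms c by (auto simp: in_L_iff)
  have eq: "thread c (\<tau> ! c) p = thread c (\<tau>' ! c) p"
    using assms(4) vthread_nth[OF c] by metis
  have "(\<tau> ! c, \<tau>' ! c) \<in> \<T> ! c \<or> (\<tau>' ! c, \<tau> ! c) \<in> \<T> ! c"
    using tree_under_total[OF tree_nth(1)[OF c] thread(2)[OF c lv(1) assms(3)]]
      thread(2)[OF c lv(2) assms(3)] eq by simp
  then show "\<tau> ! c = \<tau>' ! c"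
    using level_eqI[OF tree_nth(1)[OF c]] lv by metis
qed

lemma vthread_mono:
  assumes \<tau>: "\<tau> \<in> L i" "i \<le> J p" and "p \<le> q" "c < length \<T>"
  shows "(vthread \<tau> p ! c, vthread \<tau> q ! c) \<in> \<T> ! c"
  using \<open>p \<le> q\<close>
proof (induction q rule: dec_induct)
  case base
  have "thread c (\<tau> ! c) p \<in> Field (\<T> ! c)"
    using thread(2)[OF assms(4), of "\<tau> ! c" i p] \<tau> assms(4) by (auto simp: in_L_iff Field_def)
  then show ?case using tree_refl[OF tree_nth(1)] assms(4) by (simp add: vthread_nth)
next
  case (step q)
  have "i \<le> J q" using \<tau>(2) strict_mono_leD[OF J_strict_mono step(1)] by simp
  then have "(thread c (\<tau> ! c) q, thread c (\<tau> ! c) (Suc q)) \<in> \<T> ! c"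
    using thread(3)[OF assms(4)] \<tau> assms(4) by (auto simp: in_L_iff)
  then show ?case using step(3) tree_trans[OF tree_nth(1)[OF assms(4)]] assms(4) vthread_nth by metis
qed

section \<open>Decoding\<close>

text \<open>The coded letter \<open>(i, a)\<close> stands for the function \<open>a : \<otimes>T(i) \<rightarrow> \<Lambda>\<close>. Keeping the level \<open>i\<close> in the letter makes
  the alphabets increase by inclusion.\<close>
abbreviation letters :: "nat \<Rightarrow> (nat \<times> ('a list \<Rightarrow> 'l)) set" where
  "letters j \<equiv> (SIGMA i:{..j}. PiE (L i) (\<lambda>_. \<Lambda>))"

sublocale alphabets letters
proof
  show "finite (letters n)" for n
    using finite_letters finite_L by (intro finite_SigmaI finite_PiE) auto
  show "letters n \<noteq> {}" for n
  proof -
    have "(0, \<lambda>\<tau>\<in>L 0. l0) \<in> letters n" using l0 by auto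
    then show ?thesis by blast
  qed
  show "letters m \<subseteq> letters n" if "m \<le> n" for m n
    using that by auto
qed

text \<open>The element of \<open>\<otimes>T(i)\<close> whose copy in block \<open>j\<close> is \<open>s\<close>, if \<open>j\<close> is selected and \<open>s\<close> is in the copy.\<close>
definition locate :: "nat \<Rightarrow> nat \<Rightarrow> 'a list \<Rightarrow> 'a list option" where
  "locate i j s =
     (if j \<in> range J \<and> s \<in> (\<lambda>\<tau>. vthread \<tau> (inv J j)) ` L i
      then Some (inv_into (L i) (\<lambda>\<tau>. vthread \<tau> (inv J j)) s) else None)"

lemma inv_J [simp]: "inv J (J p) = p"
  using J_strict_mono by (simp add: strict_mono_imp_inj_on)

lemma J_le_iff: "J p \<le> J q \<longleftrightarrow> p \<le> q"
  using J_strict_mono by (simp add: strict_mono_less_eq)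

lemma locate_vthread:
  assumes "\<tau> \<in> L i" "i \<le> J p"
  shows "locate i (J p) (vthread \<tau> p) = Some \<tau>"
proof -
  have "inj_on (\<lambda>\<tau>. vthread \<tau> p) (L i)" using vthread_inj assms(2) by (intro inj_onI) blast
  then have "inv_into (L i) (\<lambda>\<tau>. vthread \<tau> p) (vthread \<tau> p) = \<tau>"
    using assms(1) by (rule inv_into_f_eq) simp
  then show ?thesis using assms(1) by (simp add: locate_def)
qed

lemma locate_SomeD:
  assumes "locate i j s = Some \<tau>"
  obtains p where "j = J p" "\<tau> \<in> L i" "s = vthread \<tau> p"
proof -
  have j: "j \<in> range J" "s \<in> (\<lambda>\<tau>. vthread \<tau> (inv J j)) ` L i"
    "\<tau> = inv_into (L i) (\<lambda>\<tau>. vthread \<tau> (inv J j)) s"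
    using assms by (auto simp: locate_def split: if_splits)
  then obtain p where p: "j = J p" by blast
  have "\<tau> \<in> L i" unfolding j(3) by (rule inv_into_into[OF j(2)])
  moreover have "s = vthread \<tau> (inv J j)" unfolding j(3) using f_inv_into_f[OF j(2)] by simp
  ultimately show ?thesis using that[OF p] by (simp add: p)
qed

definition letter_at :: "nat \<Rightarrow> nat \<times> ('a list \<Rightarrow> 'l) \<Rightarrow> 'a list \<Rightarrow> 'l" where
  "letter_at j x s = (case locate (fst x) j s of None \<Rightarrow> l0 | Some \<tau> \<Rightarrow> snd x \<tau>)"

lemma letter_at_in: "x \<in> letters n \<Longrightarrow> letter_at j x s \<in> \<Lambda>"
  using l0 by (auto simp: letter_at_def split: option.split elim!: locate_SomeD)

definition first_var :: "(nat \<times> ('a list \<Rightarrow> 'l)) lword \<Rightarrow> nat" where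
  "first_var u = start u + (LEAST i. i < length (snd u) \<and> snd u ! i = None)"

text \<open>What the decoded word has at the positions of the variable \<open>s\<close> of block \<open>j\<close>. Where the coded word has its
  variable, the variables on a thread are replaced by the one at which the thread meets the first
  variable block: it is the minimum of all positions it gets.\<close>
definition symbol_at :: "(nat \<times> ('a list \<Rightarrow> 'l)) lword \<Rightarrow> nat \<Rightarrow> 'a list \<Rightarrow> ('l, 'a) symbol" where
  "symbol_at u j s = (case snd u ! (j - start u) of
       Some x \<Rightarrow> Letter (letter_at j x s)
     | None \<Rightarrow> (case locate (start u) j s of
           None \<Rightarrow> Letter l0 | Some \<tau> \<Rightarrow> Var (vthread \<tau> (inv J (first_var u)))))"

definition block_of :: "'a list \<Rightarrow> nat" where
  "block_of t = (THE j. t \<in> dom (X j))"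

definition decode :: "(nat \<times> ('a list \<Rightarrow> 'l)) lword \<Rightarrow> ('l, 'a) vword" where
  "decode u t = (if start u \<le> block_of t \<and> block_of t < stop u
     then map_option (case_symbol Letter (symbol_at u (block_of t))) (X (block_of t) t) else None)"

definition decode_const :: "(nat \<times> ('a list \<Rightarrow> 'l)) lword \<Rightarrow> ('l, 'a) word" where
  "decode_const u = subst_word (decode u) (\<lambda>_. l0)"

lemma dom_X: "dom (X j) = segment \<T> (bnd j) (bnd (Suc j))"
  using X[of j] by (simp add: vwords_between_def)

lemma L_unique:
  assumes "t \<in> L i" "t \<in> L j"
  shows "i = j"
proof -
  have "0 < length \<T>" using vtree by (simp add: vector_tree_def)
  then have "t ! 0 \<in> level (\<T> ! 0) i" "t ! 0 \<in> level (\<T> ! 0) j" using assms by (auto simp: in_L_iff)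
  then show ?thesis by (simp add: level_def)
qed

lemma block_of_eq: "t \<in> dom (X j) \<Longrightarrow> block_of t = j"
  unfolding block_of_def
proof (rule the_equality)
  fix i assume t: "t \<in> dom (X j)" "t \<in> dom (X i)"
  then obtain k k' where k: "t \<in> L k" "bnd j \<le> k" "k < bnd (Suc j)"
    and k': "t \<in> L k'" "bnd i \<le> k'" "k' < bnd (Suc i)"
    unfolding dom_X segment_def by auto
  have "k' = k" using L_unique k(1) k'(1) by blast
  then show "i = j"
    using k k' bnd_le[of "Suc i" j] bnd_le[of "Suc j" i] by linarith
qed

lemma segment_bnd:
  assumes "m \<le> n"
  shows "segment \<T> (bnd m) (bnd n) = {t. m \<le> block_of t \<and> block_of t < n \<and> t \<in> dom (X (block_of t))}"
proof (intro equalityI subsetI)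
  fix t assume "t \<in> segment \<T> (bnd m) (bnd n)"
  then obtain k where k: "t \<in> L k" "bnd m \<le> k" "k < bnd n" by (auto simp: segment_def)
  \<comment> \<open>the index of the block that contains level \<open>k\<close>\<close>
  define j where "j = (LEAST j. k < bnd (Suc j))"
  have "k < bnd (Suc k)" using bnd_ge[of "Suc k"] by simp
  then have j1: "k < bnd (Suc j)" unfolding j_def by (rule LeastI)
  have j2: "bnd j \<le> k"
  proof (cases j)
    case (Suc i)
    then have "\<not> k < bnd (Suc i)" using not_less_Least[of i "\<lambda>j. k < bnd (Suc j)"] by (simp add: j_def)
    then show ?thesis using Suc by simp
  qed (simp add: bnd0)
  have t: "t \<in> dom (X j)" using k(1) j1 j2 by (auto simp: dom_X segment_def)
  have "m \<le> j" using bnd_le[of "Suc j" m] j1 k by linarith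
  moreover have "j < n" using bnd_le[of n j] j2 k by linarith
  ultimately show "t \<in> {t. m \<le> block_of t \<and> block_of t < n \<and> t \<in> dom (X (block_of t))}"
    using t block_of_eq[OF t] by simp
next
  fix t assume t: "t \<in> {t. m \<le> block_of t \<and> block_of t < n \<and> t \<in> dom (X (block_of t))}"
  then show "t \<in> segment \<T> (bnd m) (bnd n)"
    using bnd_le[of m "block_of t"] bnd_le[of "Suc (block_of t)" n]
    by (auto simp: dom_X segment_def intro: bexI[rotated])
qed

lemma start_le_stop: "start u \<le> stop u" by (simp add: start_def stop_def)

lemma dom_decode: "dom (decode u) = segment \<T> (bnd (start u)) (bnd (stop u))"
  unfolding segment_bnd[OF start_le_stop] by (auto simp: decode_def dom_def)

lemma decode_const_apply: "decode_const u t = (if start u \<le> block_of t \<and> block_of t < stop u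
   then map_option (\<lambda>x. case x of Letter l \<Rightarrow> l | Var s \<Rightarrow>
      (case symbol_at u (block_of t) s of Letter l \<Rightarrow> l | Var _ \<Rightarrow> l0)) (X (block_of t) t) else None)"
  by (simp add: decode_const_def subst_word_def decode_def option.map_comp o_def split: symbol.split)
    (auto intro!: option.map_cong split: symbol.split)

lemma dom_decode_const: "dom (decode_const u) = segment \<T> (bnd (start u)) (bnd (stop u))"
  unfolding segment_bnd[OF start_le_stop] by (auto simp: decode_const_apply dom_def)

lemma const_nth: "\<not> isvar u \<Longrightarrow> start u \<le> j \<Longrightarrow> j < stop u \<Longrightarrow> \<exists>x. snd u ! (j - start u) = Some x"
proof -
  assume u: "\<not> isvar u" "start u \<le> j" "j < stop u"
  then have "snd u ! (j - start u) \<in> set (snd u)" by (intro nth_mem) (auto simp: start_def stop_def)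
  then have "snd u ! (j - start u) \<noteq> None" using u(1) unfolding isvar_def by metis
  then show ?thesis by blast
qed

lemma decode_const_lcat:
  assumes "\<not> isvar u" "\<not> isvar v" "stop u = start v"
  shows "decode_const (u \<odot> v) = decode_const u ++ decode_const v"
proof
  fix t
  let ?j = "block_of t"
  have st: "start (u \<odot> v) = start u" "stop (u \<odot> v) = stop v" using assms(3) by auto
  consider "?j < start u" | "start u \<le> ?j" "?j < stop u" | "stop u \<le> ?j" "?j < stop v" | "stop v \<le> ?j"
    by linarith
  then show "decode_const (u \<odot> v) t = (decode_const u ++ decode_const v) t"
  proof cases
    case 1
    then have "\<not> start v \<le> ?j" using assms(3) start_le_stop[of u] by linarith
    then show ?thesis using 1 by (simp add: decode_const_apply map_add_def)
  next
    case 2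
    obtain x where x: "snd u ! (?j - start u) = Some x" using const_nth[OF assms(1) 2] by blast
    have "?j - start u < length (snd u)" using 2 by (auto simp: start_def stop_def)
    then have "snd (u \<odot> v) ! (?j - start u) = Some x" using x by (simp add: lcat_def nth_append)
    moreover have "?j < stop v" "\<not> start v \<le> ?j" using 2 assms(3) start_le_stop[of v] by auto
    ultimately show ?thesis
      using 2 x st by (simp add: decode_const_apply map_add_def symbol_at_def)
  next
    case 3
    have jv: "start v \<le> ?j" using 3 assms(3) by simp
    obtain x where x: "snd v ! (?j - start v) = Some x" using const_nth[OF assms(2) jv 3(2)] by blast
    have "\<not> ?j - start u < length (snd u)" "?j - start u - length (snd u) = ?j - start v"
      using 3 assms(3) by (auto simp: start_def stop_def)
    then have "snd (u \<odot> v) ! (?j - start u) = Some x" using x by (simp add: lcat_def nth_append)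
    moreover have "start u \<le> ?j" "\<not> ?j < stop u" using 3 start_le_stop[of u] by auto
    ultimately show ?thesis
      using 3 x st jv by (simp add: decode_const_apply map_add_def symbol_at_def split: option.split)
  next
    case 4
    then have "\<not> ?j < stop u" "\<not> ?j < stop v" using assms(3) start_le_stop[of v] by auto
    then show ?thesis using st by (simp add: decode_const_apply map_add_def)
  qed
qed

text \<open>Substituting letters of \<open>\<Lambda>\<close> in the decoded word corresponds to substituting one coded letter in the coded
  word.\<close>
lemma subst_decode:
  assumes "isvar u"
  shows "subst_word (decode u) b =
    decode_const (linst u (start u, \<lambda>\<tau>\<in>L (start u). b (vthread \<tau> (inv J (first_var u)))))"
proof
  fix t
  let ?j = "block_of t"
  let ?x = "(start u, \<lambda>\<tau>\<in>L (start u). b (vthread \<tau> (inv J (first_var u))))"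
  show "subst_word (decode u) b t = decode_const (linst u ?x) t"
  proof (cases "start u \<le> ?j \<and> ?j < stop u")
    case True
    then have i: "?j - start u < length (snd u)" by (auto simp: start_def stop_def)
    have nth: "snd (linst u ?x) ! (?j - start u) =
      Some (case snd u ! (?j - start u) of None \<Rightarrow> ?x | Some y \<Rightarrow> y)"
      using i by (simp add: linst_def fill_def)
    have "(case symbol_at u ?j s of Letter l \<Rightarrow> l | Var s' \<Rightarrow> b s') =
      (case symbol_at (linst u ?x) ?j s of Letter l \<Rightarrow> l | Var _ \<Rightarrow> l0)" for s
    proof (cases "snd u ! (?j - start u)")
      case (Some y)
      then show ?thesis using nth by (simp add: symbol_at_def)
    next
      case None
      then show ?thesis
        using nth by (auto simp: symbol_at_def letter_at_def split: option.split elim!: locate_SomeD)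
    qed
    then show ?thesis
      using True by (cases "X ?j t")
        (auto simp: subst_word_def decode_def decode_const_apply split: symbol.split)
  qed (auto simp: subst_word_def decode_def decode_const_apply)
qed

text \<open>Only selected blocks carry threads, so the variable must be confined to them; \<open>base_space\<close> below ensures it.\<close>
definition vars_in_J :: "(nat \<times> ('a list \<Rightarrow> 'l)) lword \<Rightarrow> bool" where
  "vars_in_J u \<longleftrightarrow> (\<forall>i<length (snd u). snd u ! i = None \<longrightarrow> start u + i \<in> range J)"

text \<open>The wildcard set of the decoded word: the nodes at which the threads from level \<open>start u\<close> meet the first
  variable block.\<close>
definition wild :: "(nat \<times> ('a list \<Rightarrow> 'l)) lword \<Rightarrow> 'a set list" where
  "wild u = map (\<lambda>c. (\<lambda>t. thread c t (inv J (first_var u))) ` level (\<T> ! c) (start u)) [0..<length \<T>]"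

lemma first_var:
  assumes "isvar u" "vars_in_J u"
  obtains p where "first_var u = J p" "start u \<le> J p" "J p < stop u" "snd u ! (J p - start u) = None"
    "\<forall>i<length (snd u). snd u ! i = None \<longrightarrow> J p \<le> start u + i"
proof -
  let ?P = "\<lambda>i. i < length (snd u) \<and> snd u ! i = None"
  define i where "i = (LEAST i. ?P i)"
  have "\<exists>i. ?P i" using assms(1) by (auto simp: isvar_def in_set_conv_nth)
  then have i: "?P i" unfolding i_def by (rule LeastI_ex)
  then obtain p where p: "start u + i = J p" using assms(2) by (auto simp: vars_in_J_def)
  show ?thesis
  proof (rule that[of p])
    show "first_var u = J p" using p by (simp add: first_var_def i_def)
    show "start u \<le> J p" using p by simp
    show "J p < stop u" using i p by (simp add: stop_def start_def)
    show "snd u ! (J p - start u) = None" using i p[symmetric] by simp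
    show "\<forall>i'<length (snd u). snd u ! i' = None \<longrightarrow> J p \<le> start u + i'"
    proof (intro allI impI)
      fix i' assume "i' < length (snd u)" "snd u ! i' = None"
      then have "i \<le> i'" unfolding i_def by (intro Least_le) simp
      then show "J p \<le> start u + i'" using p by simp
    qed
  qed
qed

lemma listset_wild: "listset (wild u) = (\<lambda>\<tau>. vthread \<tau> (inv J (first_var u))) ` L (start u)"
proof (intro equalityI subsetI)
  fix s assume s: "s \<in> listset (wild u)"
  then have len: "length s = length \<T>"
    and sc: "\<And>c. c < length \<T> \<Longrightarrow> \<exists>t. t \<in> level (\<T> ! c) (start u) \<and> s ! c = thread c t (inv J (first_var u))"
    by (auto simp: in_listset_iff wild_def)
  then obtain t where t: "\<And>c. c < length \<T> \<Longrightarrow> t c \<in> level (\<T> ! c) (start u) \<and>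
      s ! c = thread c (t c) (inv J (first_var u))" by metis
  have "map t [0..<length \<T>] \<in> L (start u)" using t by (simp add: in_L_iff)
  moreover have "s = vthread (map t [0..<length \<T>]) (inv J (first_var u))"
    using len t by (intro nth_equalityI) (auto simp: vthread_nth length_vthread)
  ultimately show "s \<in> (\<lambda>\<tau>. vthread \<tau> (inv J (first_var u))) ` L (start u)" by blast
next
  fix s assume "s \<in> (\<lambda>\<tau>. vthread \<tau> (inv J (first_var u))) ` L (start u)"
  then obtain \<tau> where "\<tau> \<in> L (start u)" "s = vthread \<tau> (inv J (first_var u))" by blast
  then show "s \<in> listset (wild u)"
    unfolding in_L_iff in_listset_iff[of _ "wild u"] by (auto simp: wild_def vthread_nth length_vthread)
qed

text \<open>The sets of occurrences for different \<open>\<tau>\<close> are unions over the same set of blocks. Therefore they have the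
  same levels, as required of a variable word.\<close>
lemma occurrences_decode:
  assumes u: "isvar u" "vars_in_J u" and \<tau>: "\<tau> \<in> L (start u)"
  shows "occurrences (decode u) (vthread \<tau> (inv J (first_var u))) =
    (\<Union>p\<in>{p. start u \<le> J p \<and> J p < stop u \<and> snd u ! (J p - start u) = None}.
       occurrences (X (J p)) (vthread \<tau> p))"
proof (intro equalityI subsetI)
  obtain p0 where p0: "first_var u = J p0" "start u \<le> J p0"
    using first_var[OF u] by metis
  {
    fix t assume "t \<in> occurrences (decode u) (vthread \<tau> (inv J (first_var u)))"
    then have dt: "decode u t = Some (Var (vthread \<tau> p0))" by (simp add: occurrences_def p0(1))
    define j where "j = block_of t"
    have j: "start u \<le> j" "j < stop u" using dt by (auto simp: decode_def j_def split: if_splits)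
    obtain y where y: "X j t = Some y" "case_symbol Letter (symbol_at u j) y = Var (vthread \<tau> p0)"
      using dt j by (cases "X j t") (auto simp: decode_def j_def[symmetric])
    then obtain s where s: "X j t = Some (Var s)" "symbol_at u j s = Var (vthread \<tau> p0)"
      by (cases y) auto
    then have none: "snd u ! (j - start u) = None"
      by (cases "snd u ! (j - start u)") (auto simp: symbol_at_def)
    then obtain \<tau>' where \<tau>': "locate (start u) j s = Some \<tau>'" "vthread \<tau>' p0 = vthread \<tau> p0"
      using s(2) by (cases "locate (start u) j s") (auto simp: symbol_at_def p0(1))
    obtain p where p: "j = J p" "\<tau>' \<in> L (start u)" "s = vthread \<tau>' p" using locate_SomeD[OF \<tau>'(1)] .
    have "\<tau>' = \<tau>" using vthread_inj[OF p(2) \<tau> p0(2) \<tau>'(2)] .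
    then show "t \<in> (\<Union>p\<in>{p. start u \<le> J p \<and> J p < stop u \<and> snd u ! (J p - start u) = None}.
       occurrences (X (J p)) (vthread \<tau> p))"
      using s(1) none j p by (auto simp: occurrences_def)
  next
    fix t assume "t \<in> (\<Union>p\<in>{p. start u \<le> J p \<and> J p < stop u \<and> snd u ! (J p - start u) = None}.
       occurrences (X (J p)) (vthread \<tau> p))"
    then obtain p where p: "start u \<le> J p" "J p < stop u" "snd u ! (J p - start u) = None"
      "X (J p) t = Some (Var (vthread \<tau> p))" by (auto simp: occurrences_def)
    have "block_of t = J p" using p(4) by (intro block_of_eq) auto
    moreover have "symbol_at u (J p) (vthread \<tau> p) = Var (vthread \<tau> p0)"
      using p(3) locate_vthread[OF \<tau> p(1)] by (simp add: symbol_at_def p0(1))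
    ultimately show "t \<in> occurrences (decode u) (vthread \<tau> (inv J (first_var u)))"
      using p by (simp add: occurrences_def decode_def p0(1))
  }
qed

lemma X_vword: "s \<in> listset (Ds j) \<Longrightarrow> s \<in> occurrences (X j) s"
  "s \<in> listset (Ds j) \<Longrightarrow> t \<in> occurrences (X j) s \<Longrightarrow> (s, t) \<in> product_order \<T>"
  "s \<in> listset (Ds j) \<Longrightarrow> s' \<in> listset (Ds j) \<Longrightarrow>
     product_levels \<T> (occurrences (X j) s) = product_levels \<T> (occurrences (X j) s')"
  "ran (X j) \<subseteq> Letter ` \<Lambda> \<union> Var ` listset (Ds j)"
  using X[of j] unfolding vwords_between_def by blast+

lemma product_levels_UN: "product_levels \<T> (\<Union>i\<in>I. B i) = (\<Union>i\<in>I. product_levels \<T> (B i))"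
  by (auto simp: product_levels_def)

lemma ran_decode:
  assumes u: "valid u" "isvar u" "vars_in_J u"
  shows "ran (decode u) \<subseteq> Letter ` \<Lambda> \<union> Var ` listset (wild u)"
proof
  fix x assume "x \<in> ran (decode u)"
  then obtain t where t: "decode u t = Some x" by (auto simp: ran_def)
  define j where "j = block_of t"
  have j: "start u \<le> j" "j < stop u" using t by (auto simp: decode_def j_def split: if_splits)
  obtain y where y: "X j t = Some y" "x = case_symbol Letter (symbol_at u j) y"
    using t j by (cases "X j t") (auto simp: decode_def j_def[symmetric])
  show "x \<in> Letter ` \<Lambda> \<union> Var ` listset (wild u)"
  proof (cases y)
    case (Letter l)
    then have "l \<in> \<Lambda>" using X_vword(4)[of j] y(1) by (auto dest: ranI)
    then show ?thesis using Letter y(2) by simp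
  next
    case (Var s)
    then have x: "x = symbol_at u j s" using y(2) by simp
    show ?thesis
    proof (cases "snd u ! (j - start u)")
      case None
      then show ?thesis
        using l0 unfolding x symbol_at_def listset_wild
        by (cases "locate (start u) j s") (auto elim!: locate_SomeD)
    next
      case (Some z)
      have "j - start u < length (snd u)" using j by (auto simp: start_def stop_def)
      then have "z \<in> letters (start u + (j - start u))" using u(1) Some unfolding valid_def by blast
      then show ?thesis unfolding x symbol_at_def using Some letter_at_in by simp
    qed
  qed
qed

lemma decode_vword:
  assumes u: "valid u" "isvar u" "vars_in_J u"
  shows "is_vword_with \<Lambda> \<T> (wild u) (decode u)"
proof -
  obtain p0 where p0: "first_var u = J p0" "start u \<le> J p0" "J p0 < stop u"
    "snd u ! (J p0 - start u) = None"
    "\<forall>i<length (snd u). snd u ! i = None \<longrightarrow> J p0 \<le> start u + i"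
    using first_var[OF u(2,3)] .
  let ?ps = "{p. start u \<le> J p \<and> J p < stop u \<and> snd u ! (J p - start u) = None}"
  have p0_le: "p0 \<le> p" if "p \<in> ?ps" for p
  proof -
    have "J p - start u < length (snd u)" using that by (auto simp: start_def stop_def)
    then have "J p0 \<le> J p" using p0(5) that by force
    then show ?thesis by (simp add: J_le_iff)
  qed
  have in_Ds: "vthread \<tau> p \<in> listset (Ds (J p))" if "\<tau> \<in> L (start u)" "p \<in> ?ps" for \<tau> p
    using vthread_in_Ds[OF that(1)] that(2) by simp
  have occ: "occurrences (decode u) (vthread \<tau> p0) = (\<Union>p\<in>?ps. occurrences (X (J p)) (vthread \<tau> p))"
    if "\<tau> \<in> L (start u)" for \<tau>
    using occurrences_decode[OF u(2,3) that] p0(1) by simp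
  have "decode u \<in> vwords_between \<Lambda> \<T> (wild u) (bnd (start u)) (bnd (stop u))"
    unfolding vwords_between_def mem_Collect_eq listset_wild p0(1) inv_J
  proof (intro conjI ballI)
    show "dom (decode u) = segment \<T> (bnd (start u)) (bnd (stop u))" by (rule dom_decode)
    show "ran (decode u) \<subseteq> Letter ` \<Lambda> \<union> Var ` (\<lambda>\<tau>. vthread \<tau> p0) ` L (start u)"
      using ran_decode[OF u] by (simp add: listset_wild p0(1))
    fix s assume "s \<in> (\<lambda>\<tau>. vthread \<tau> p0) ` L (start u)"
    then obtain \<tau> where \<tau>: "\<tau> \<in> L (start u)" "s = vthread \<tau> p0" by blast
    have "p0 \<in> ?ps" using p0 by simp
    then show s: "s \<in> occurrences (decode u) s"
      using X_vword(1)[OF in_Ds[OF \<tau>(1)]] unfolding occ[OF \<tau>(1)] \<tau>(2) by blast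
    then show "occurrences (decode u) s \<noteq> {}" by blast
    have "s \<in> level_product \<T>"
      using X_vword(2)[OF in_Ds X_vword(1)[OF in_Ds], OF \<tau>(1) \<open>p0 \<in> ?ps\<close> \<tau>(1) \<open>p0 \<in> ?ps\<close>] \<tau>(2)
      by (simp add: product_order_def)
    show "(s, t) \<in> product_order \<T>" if "t \<in> occurrences (decode u) s" for t
    proof -
      obtain p where p: "p \<in> ?ps" "t \<in> occurrences (X (J p)) (vthread \<tau> p)"
        using \<open>t \<in> occurrences (decode u) s\<close> unfolding occ[OF \<tau>(1)] \<tau>(2) by blast
      have "(vthread \<tau> p, t) \<in> product_order \<T>" using X_vword(2)[OF in_Ds[OF \<tau>(1) p(1)] p(2)] .
      moreover have "(s ! c, vthread \<tau> p ! c) \<in> \<T> ! c" if "c < length \<T>" for c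
        unfolding \<tau>(2) using vthread_mono[OF \<tau>(1) p0(2) p0_le[OF p(1)] that] .
      ultimately show ?thesis
        using \<open>s \<in> level_product \<T>\<close> tree_trans[OF tree_nth(1)] unfolding product_order_def by blast
    qed
    fix s' assume "s' \<in> (\<lambda>\<tau>. vthread \<tau> p0) ` L (start u)"
    then obtain \<tau>' where \<tau>': "\<tau>' \<in> L (start u)" "s' = vthread \<tau>' p0" by blast
    show "product_levels \<T> (occurrences (decode u) s) = product_levels \<T> (occurrences (decode u) s')"
      unfolding \<tau>(2) \<tau>'(2) occ[OF \<tau>(1)] occ[OF \<tau>'(1)] product_levels_UN
      using X_vword(3)[OF in_Ds in_Ds, OF \<tau>(1) _ \<tau>'(1)] by (intro SUP_cong) auto
  qed
  moreover have "vector_level_subset_at \<T> (lev (J p0)) (wild u)"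
    unfolding vector_level_subset_at_def list_all2_conv_all_nth
  proof (intro conjI allI impI)
    show "length (wild u) = length \<T>" by (simp add: wild_def)
    fix c assume "c < length (wild u)"
    then have c: "c < length \<T>" by (simp add: wild_def)
    then show "wild u ! c \<noteq> {}"
      using level_nonempty[OF tree_nth] by (simp add: wild_def)
    show "wild u ! c \<subseteq> level (\<T> ! c) (lev (J p0))"
      using c thread(1)[OF c _ p0(2)] Ds_nth[OF c, of "J p0"] by (auto simp: wild_def p0(1))
  qed
  moreover have "bnd (start u) \<le> lev (J p0)" "lev (J p0) < bnd (stop u)"
    using bnd_le[OF p0(2)] bnd_le[of "Suc (J p0)" "stop u"] p0(3) lev[of "J p0"] by auto
  ultimately show ?thesis
    unfolding is_vword_with_def
    by (intro exI[of _ "bnd (start u)"] exI[of _ "bnd (stop u)"] conjI bexI[of _ "lev (J p0)"]) auto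
qed

text \<open>The threads start from all nodes of level \<open>start u\<close>, which lie above those of level \<open>i\<close>.\<close>
lemma wild_dominates:
  assumes u: "isvar u" "vars_in_J u" and "i \<le> start u"
  shows "vdominates \<T> (wild u) (vlevel \<T> i)"
  unfolding vdominates_def dominates_def
proof (intro allI impI ballI)
  obtain p0 where p0: "first_var u = J p0" "start u \<le> J p0" using first_var[OF u] by metis
  fix c t assume c: "c < length \<T>" and "t \<in> vlevel \<T> i ! c"
  then have t: "t \<in> level (\<T> ! c) i" by (simp add: vlevel_def)
  obtain s where s: "s \<in> level (\<T> ! c) (start u)" "(t, s) \<in> \<T> ! c"
    using level_extend[OF tree_nth[OF c] t assms(3)] .
  have "thread c s p0 \<in> wild u ! c" using s(1) c by (simp add: wild_def p0(1))
  moreover have "(t, thread c s p0) \<in> \<T> ! c"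
    using tree_trans[OF tree_nth(1)[OF c] s(2) thread(2)[OF c s(1) p0(2)]] .
  ultimately show "\<exists>s\<in>wild u ! c. (t, s) \<in> \<T> ! c" by blast
qed

lemma span1_decode:
  assumes u: "valid u" "isvar u" "vars_in_J u" and w: "w \<in> span1 \<Lambda> \<T> (decode u)"
  obtains x where "x \<in> letters (start u)" "w = decode_const (linst u x)"
proof -
  obtain b where b: "b \<in> listset (wild u) \<rightarrow> \<Lambda>" "w = subst_word (decode u) b"
    using w ws_eq[OF decode_vword[OF u]] by (auto simp: span1_def)
  let ?x = "(start u, \<lambda>\<tau>\<in>L (start u). b (vthread \<tau> (inv J (first_var u))))"
  have "b (vthread \<tau> (inv J (first_var u))) \<in> \<Lambda>" if "\<tau> \<in> L (start u)" for \<tau>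
    using b(1) that unfolding listset_wild by blast
  then have "?x \<in> letters (start u)" by auto
  moreover have "w = decode_const (linst u ?x)" using subst_decode[OF u(2), of b] b(2) by (rule trans[rotated])
  ultimately show ?thesis by (rule that)
qed

section \<open>Monochromatic subspaces\<close>

definition default_letter :: "nat \<times> ('a list \<Rightarrow> 'l)" where
  "default_letter = (0, \<lambda>\<tau>\<in>L 0. l0)"

definition base_start :: "nat \<Rightarrow> nat" where
  "base_start p = (case p of 0 \<Rightarrow> 0 | Suc q \<Rightarrow> Suc (J q))"

text \<open>The \<open>p\<close>-th block ends at the selected position \<open>J p\<close> and has its variable there.\<close>
definition base_space :: "nat \<Rightarrow> (nat \<times> ('a list \<Rightarrow> 'l)) lword" where
  "base_space p = (base_start p, replicate (J p - base_start p) (Some default_letter) @ [None])"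

lemma base_start_le: "base_start p \<le> J p"
  using strict_monoD[OF J_strict_mono, of "p - 1" p] by (cases p) (auto simp: base_start_def simp del: J.simps(2))

lemma space_base: "space 0 base_space"
proof -
  have default: "default_letter \<in> letters n" for n using l0 by (auto simp: default_letter_def)
  have "valid (base_space p)" for p
    unfolding valid_def
  proof (intro conjI allI impI)
    fix i b assume "i < length (snd (base_space p))" "snd (base_space p) ! i = Some b"
    then have "b = default_letter" by (auto simp: base_space_def nth_append split: if_splits)
    then show "b \<in> letters (start (base_space p) + i)" using default by (simp only:)
  qed (simp add: base_space_def)
  moreover have "stop (base_space p) = start (base_space (Suc p))" for p
    using base_start_le[of p] by (simp add: base_space_def stop_def start_def) (simp add: base_start_def)
  ultimately show ?thesis
    by (simp add: space_def isvar_def base_space_def start_def base_start_def)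
qed

lemma vars_in_J_base: "u \<in> spn base_space \<Longrightarrow> vars_in_J u"
proof (induction rule: gen.induct)
  case (base u)
  then obtain p where u: "u = base_space p" by blast
  have "base_start p + i = J p" if "i < length (snd u)" "snd u ! i = None" for i
    using that base_start_le[of p] unfolding u by (auto simp: base_space_def nth_append split: if_splits)
  then show ?case by (simp add: vars_in_J_def u base_space_def start_def)
next
  case (inst u a)
  then show ?case by (auto simp: vars_in_J_def linst_def fill_def)
next
  case (cat u v)
  have "start u + i \<in> range J" if "i < length (snd u) + length (snd v)" "(snd u @ snd v) ! i = None" for i
  proof (cases "i < length (snd u)")
    case True
    then show ?thesis using that cat by (auto simp: vars_in_J_def nth_append)
  next
    case False
    then have "start u + i = start v + (i - length (snd u))"
      using cat(3) by (simp add: start_def stop_def)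
    moreover have "snd v ! (i - length (snd u)) = None" "i - length (snd u) < length (snd v)"
      using that False by (auto simp: nth_append)
    ultimately show ?thesis using cat.IH(2) by (auto simp: vars_in_J_def)
  qed
  then show ?case by (simp add: vars_in_J_def lcat_def start_def)
qed

primrec lconcat :: "(nat \<Rightarrow> (nat \<times> ('a list \<Rightarrow> 'l)) lword) \<Rightarrow> nat \<Rightarrow> nat \<Rightarrow> (nat \<times> ('a list \<Rightarrow> 'l)) lword" where
  "lconcat e p 0 = e p"
| "lconcat e p (Suc n) = lconcat e p n \<odot> e (p + Suc n)"

lemma lconcat_split: "lconcat e p (m + Suc n) = lconcat e p m \<odot> lconcat e (p + Suc m) n"
  by (induction n) (auto simp: add.assoc)

lemma lconcat_constants:
  assumes Y: "space N Y" and \<alpha>: "\<And>i. \<alpha> i \<in> letters (start (Y i))"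
  defines "e \<equiv> \<lambda>i. linst (Y i) (\<alpha> i)"
  shows "lconcat e p n \<in> spn Y" "\<not> isvar (lconcat e p n)" "start (lconcat e p n) = start (Y p)"
    "stop (lconcat e p n) = start (Y (p + Suc n))"
proof -
  have e: "e i \<in> spn Y" "\<not> isvar (e i)" "start (e i) = start (Y i)" "stop (e i) = start (Y (Suc i))" for i
    using gen.inst[OF gen.base \<alpha>[of i]] space_stop[OF Y, of i] by (auto simp: e_def)
  have "lconcat e p n \<in> spn Y \<and> \<not> isvar (lconcat e p n) \<and> start (lconcat e p n) = start (Y p) \<and>
    stop (lconcat e p n) = start (Y (p + Suc n))"
    by (induction n) (use e in \<open>auto intro: gen.cat\<close>)
  then show "lconcat e p n \<in> spn Y" "\<not> isvar (lconcat e p n)" "start (lconcat e p n) = start (Y p)"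
    "stop (lconcat e p n) = start (Y (p + Suc n))" by auto
qed

lemma join_decode:
  assumes Y: "space 0 Y" and \<alpha>: "\<And>i. \<alpha> i \<in> letters (start (Y i))"
    and g: "\<And>i. i \<le> n \<Longrightarrow> g i = decode_const (linst (Y i) (\<alpha> i))"
  shows "join g (Suc n) = decode_const (lconcat (\<lambda>i. linst (Y i) (\<alpha> i)) 0 n)"
  using g
proof (induction n)
  case 0
  then show ?case by simp
next
  case (Suc n)
  have "stop (lconcat (\<lambda>i. linst (Y i) (\<alpha> i)) 0 n) = start (linst (Y (Suc n)) (\<alpha> (Suc n)))"
    using lconcat_constants(4)[OF Y \<alpha>, of 0 n] by simp
  then have "decode_const (lconcat (\<lambda>i. linst (Y i) (\<alpha> i)) 0 (Suc n)) =
      decode_const (lconcat (\<lambda>i. linst (Y i) (\<alpha> i)) 0 n) ++ decode_const (linst (Y (Suc n)) (\<alpha> (Suc n)))"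
    using lconcat_constants(2)[OF Y \<alpha>, of 0 n] by (simp add: decode_const_lcat)
  then show ?case using Suc by simp
qed

lemma join_blocks:
  assumes "\<And>j. j < n \<Longrightarrow> dom (g j) \<subseteq> dom (X j)"
  shows "join g n t = (if block_of t < n then g (block_of t) t else None)"
  using assms
proof (induction n)
  case (Suc n)
  have IH: "join g n t = (if block_of t < n then g (block_of t) t else None)" using Suc by simp
  show ?case
  proof (cases "g n t")
    case None
    then show ?thesis using IH by (auto simp: map_add_def less_Suc_eq)
  next
    case (Some x)
    then have "block_of t = n" using Suc.prems[of n] by (intro block_of_eq) auto
    then show ?thesis using Some by (simp add: map_add_def)
  qed
qed simp

lemma decode_const_in_span:
  assumes u: "valid u" "\<not> isvar u" "start u = 0"
  shows "decode_const u \<in> word_span \<Lambda> \<T> X"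
proof -
  define g where "g j = subst_word (X j) (letter_at j (the (snd u ! j)))" for j
  have len: "stop u = length (snd u)" using u(3) by (simp add: stop_def start_def)
  have nth: "\<exists>x\<in>letters j. snd u ! j = Some x" if "j < stop u" for j
    using const_nth[OF u(2), of j] u(1,3) that len unfolding valid_def by fastforce
  have "g j \<in> span1 \<Lambda> \<T> (X j)" if "j < stop u" for j
    using nth[OF that] letter_at_in by (fastforce simp: span1_def g_def)
  moreover have "decode_const u = join g (stop u)"
  proof
    fix t
    have "dom (g j) \<subseteq> dom (X j)" for j by (auto simp: g_def subst_word_def)
    then have "join g (stop u) t = (if block_of t < stop u then g (block_of t) t else None)"
      by (rule join_blocks)
    also have "\<dots> = decode_const u t"
    proof (cases "block_of t < stop u")
      case True
      then obtain x where "snd u ! block_of t = Some x" using nth by blast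
      then show ?thesis using True u(3)
        by (auto simp: decode_const_apply g_def subst_word_def symbol_at_def intro!: option.map_cong split: symbol.split)
    qed (simp add: decode_const_apply)
    finally show "decode_const u t = join g (stop u) t" by simp
  qed
  moreover have "1 \<le> stop u" using u(1) len by (cases "snd u") (auto simp: valid_def)
  ultimately show ?thesis unfolding word_span_def word_span_upto_def by blast
qed

lemma word_span_decode:
  assumes Y: "Y \<in> subspaces 0 (spn base_space)" and w: "w \<in> word_span \<Lambda> \<T> (\<lambda>i. decode (Y i))"
  obtains n \<alpha> where "\<forall>i. \<alpha> i \<in> letters (start (Y i))" "w = decode_const (lconcat (\<lambda>i. linst (Y i) (\<alpha> i)) 0 n)"
proof -
  note spY = subspaces_space[OF Y]
  have Yi: "valid (Y i)" "isvar (Y i)" "vars_in_J (Y i)" for i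
    using space_valid[OF spY] space_isvar[OF spY] vars_in_J_base Y unfolding subspaces_def by blast+
  obtain q g where q: "1 \<le> q" "w = join g q" "\<And>i. i < q \<Longrightarrow> g i \<in> span1 \<Lambda> \<T> (decode (Y i))"
    using w by (auto simp: word_span_def word_span_upto_def)
  then obtain n where n: "q = Suc n" by (cases q) auto
  have "\<exists>x. x \<in> letters (start (Y i)) \<and> (i \<le> n \<longrightarrow> g i = decode_const (linst (Y i) x))" for i
  proof (cases "i \<le> n")
    case True
    then show ?thesis using span1_decode[OF Yi q(3)] n by (metis le_imp_less_Suc)
  next
    case False
    then show ?thesis using alphabet_nonempty[of "start (Y i)"] by blast
  qed
  then obtain \<alpha> where \<alpha>: "\<And>i. \<alpha> i \<in> letters (start (Y i))"
    "\<And>i. i \<le> n \<Longrightarrow> g i = decode_const (linst (Y i) (\<alpha> i))" by metis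
  show ?thesis
    using that[of \<alpha> n] \<alpha>(1) join_decode[OF spY \<alpha>] q(2) n by blast
qed

lemma decode_subspace:
  assumes Y: "Y \<in> subspaces 0 (spn base_space)"
  shows "word_subspace \<Lambda> \<T> (\<lambda>i. decode (Y i))" "subspace_le \<Lambda> \<T> (\<lambda>i. decode (Y i)) X"
proof -
  note spY = subspaces_space[OF Y]
  have Yi: "valid (Y i)" "isvar (Y i)" "vars_in_J (Y i)" for i
    using space_valid[OF spY] space_isvar[OF spY] vars_in_J_base Y unfolding subspaces_def by blast+
  have less: "bnd (start (Y i)) < bnd (stop (Y i))" for i
    using valid_start_less_stop[OF Yi(1)] by (rule bnd_less)
  note bot = word_bot_eq[OF vtree vinf less dom_decode] and top = word_top_eq[OF vtree vinf less dom_decode]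
  show "word_subspace \<Lambda> \<T> (\<lambda>i. decode (Y i))"
    unfolding word_subspace_def
  proof (intro conjI allI)
    show "decode (Y i) \<in> vwords \<Lambda> \<T>" for i using decode_vword[OF Yi] by (auto simp: vwords_def)
    show "compatible \<T> (\<lambda>i. decode (Y i))"
      using space_stop[OF spY] by (simp add: compatible_def bot top)
    show "word_bot \<T> (decode (Y 0)) = 0" using space_start[OF spY] bnd0 by (simp add: bot)
    show "vdominates \<T> (ws \<Lambda> \<T> (decode (Y i))) (vlevel \<T> i)" for i
      using wild_dominates[OF Yi(2,3), of i i] start_ge[OF spY, of i] ws_eq[OF decode_vword[OF Yi]] by simp
  qed
  show "subspace_le \<Lambda> \<T> (\<lambda>i. decode (Y i)) X"
    unfolding subspace_le_def
  proof
    fix w assume "w \<in> word_span \<Lambda> \<T> (\<lambda>i. decode (Y i))"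
    then obtain n \<alpha> where \<alpha>: "\<forall>i. \<alpha> i \<in> letters (start (Y i))"
      and w: "w = decode_const (lconcat (\<lambda>i. linst (Y i) (\<alpha> i)) 0 n)"
      by (rule word_span_decode[OF Y])
    note c = lconcat_constants[OF spY \<alpha>[rule_format], of 0 n]
    show "w \<in> word_span \<Lambda> \<T> X"
      unfolding w using valid_spn[OF spY c(1)] c(2,3) space_start[OF spY] by (intro decode_const_in_span) auto
  qed
qed

text \<open>An initial segment \<open>join f n\<close> is decoded from a concatenation of instances of the first \<open>q n\<close> blocks, but
  decoding is not injective, and the instances chosen for different \<open>n\<close> may disagree. The word \<open>f n\<close> is therefore
  taken from the choice for \<open>Suc n\<close>, restricted to the blocks from \<open>q n\<close> on; agreement of the positions is
  enough for the words to be adjacent.\<close>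
lemma span_seqs_decode:
  assumes Y: "Y \<in> subspaces 0 (spn base_space)" and f: "f \<in> span_seqs \<Lambda> \<T> (\<lambda>i. decode (Y i))"
  shows "\<exists>\<zeta>\<in>pts 0 (spn Y). f = (\<lambda>n. decode_const (\<zeta> n))"
proof -
  note spY = subspaces_space[OF Y]
  have fw: "f n \<in> words \<Lambda> \<T>" "f n \<noteq> Map.empty" for n
    using f by (auto simp: span_seqs_def word_seqs_def)
  have fc: "compatible \<T> f" and f0: "word_bot \<T> (f 0) = 0"
    using f by (auto simp: span_seqs_def word_seqs_def)
  define b where "b n = word_bot \<T> (f n)" for n
  have b: "b n < b (Suc n) \<and> dom (f n) = segment \<T> (b n) (b (Suc n))" for n
  proof -
    obtain k l where kl: "k \<le> l" "dom (f n) = segment \<T> k l"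
      using fw(1)[of n] by (auto simp: words_def words_between_def)
    have "k < l"
    proof (rule ccontr)
      assume "\<not> k < l"
      then have "dom (f n) = {}" using kl by (simp add: segment_def)
      then show False using fw(2) by simp
    qed
    moreover have "b n = k" unfolding b_def using word_bot_eq[OF vtree vinf \<open>k < l\<close> kl(2)] .
    moreover have "b (Suc n) = l"
      using fc word_top_eq[OF vtree vinf \<open>k < l\<close> kl(2)] by (simp add: b_def compatible_def)
    ultimately show ?thesis using kl by simp
  qed
  have b0: "b 0 = 0" using f0 by (simp add: b_def)
  have dom_join: "dom (join f n) = segment \<T> 0 (b n)" for n
  proof (induction n)
    case 0
    then show ?case by (simp add: b0 segment_def)
  next
    case (Suc n)
    have "{0..<b (Suc n)} = {0..<b n} \<union> {b n..<b (Suc n)}" using b[of n] by auto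
    then show ?case using Suc b[of n] by (simp add: segment_def Un_commute)
  qed
  define Q where "Q n q \<alpha> \<longleftrightarrow> b n = bnd (start (Y q)) \<and> (\<forall>i. \<alpha> i \<in> letters (start (Y i))) \<and>
      (n = 0 \<longrightarrow> q = 0) \<and>
      (0 < n \<longrightarrow> join f n = decode_const (lconcat (\<lambda>i. linst (Y i) (\<alpha> i)) 0 (q - 1)))" for n q \<alpha>
  have "\<exists>q \<alpha>. Q n q \<alpha>" for n
  proof (cases "n = 0")
    case True
    have "\<exists>\<alpha>. \<forall>i. \<alpha> i \<in> letters (start (Y i))" using alphabet_nonempty by (intro choice) blast
    then show ?thesis using True b0 bnd0 space_start[OF spY] unfolding Q_def by (intro exI[of _ 0]) auto
  next
    case False
    then have "join f n \<in> word_span \<Lambda> \<T> (\<lambda>i. decode (Y i))" using f by (simp add: span_seqs_def)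
    then obtain r \<alpha> where \<alpha>': "\<forall>i. \<alpha> i \<in> letters (start (Y i))"
      and j: "join f n = decode_const (lconcat (\<lambda>i. linst (Y i) (\<alpha> i)) 0 r)"
      by (rule word_span_decode[OF Y])
    note \<alpha> = \<alpha>'[rule_format]
    have "segment \<T> 0 (b n) = segment \<T> 0 (bnd (start (Y (Suc r))))"
      using dom_join[of n] lconcat_constants(3,4)[OF spY \<alpha>, of 0 r] space_start[OF spY] bnd0
      unfolding j dom_decode_const by simp
    moreover have "0 < b n" using b[of "n - 1"] False by simp
    moreover have "0 < bnd (start (Y (Suc r)))"
      using bnd_ge[of "start (Y (Suc r))"] start_ge[OF spY, of "Suc r"] by simp
    ultimately have "b n = bnd (start (Y (Suc r)))" using segment_eqD[OF vtree vinf] by blast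
    then show ?thesis using False \<alpha> j unfolding Q_def by (intro exI[of _ "Suc r"] exI[of _ \<alpha>]) simp
  qed
  then obtain q \<alpha> where "\<And>n. Q n (q n) (\<alpha> n)" by metis
  then have q: "\<And>n. b n = bnd (start (Y (q n)))" "q 0 = 0"
    and \<alpha>: "\<And>n i. \<alpha> n i \<in> letters (start (Y i))"
    and j: "\<And>n. 0 < n \<Longrightarrow> join f n = decode_const (lconcat (\<lambda>i. linst (Y i) (\<alpha> n i)) 0 (q n - 1))"
    unfolding Q_def by blast+
  have q_less: "q n < q (Suc n)" for n
  proof (rule ccontr)
    assume "\<not> q n < q (Suc n)"
    then have "start (Y (q (Suc n))) \<le> start (Y (q n))" using start_le[OF spY] by simp
    then show False using b[of n] bnd_le unfolding q(1) by (simp add: leD)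
  qed
  define \<zeta> where "\<zeta> n = lconcat (\<lambda>i. linst (Y i) (\<alpha> (Suc n) i)) (q n) (q (Suc n) - Suc (q n))" for n
  have \<zeta>: "\<zeta> n \<in> spn Y" "\<not> isvar (\<zeta> n)" "start (\<zeta> n) = start (Y (q n))" "stop (\<zeta> n) = start (Y (q (Suc n)))" for n
    using lconcat_constants[OF spY \<alpha>] q_less[of n] by (auto simp: \<zeta>_def)
  have "f n = decode_const (\<zeta> n)" for n
  proof
    fix t
    have dz: "dom (decode_const (\<zeta> n)) = dom (f n)"
      using b[of n] unfolding dom_decode_const \<zeta>(3,4) q(1) by simp
    show "f n t = decode_const (\<zeta> n) t"
    proof (cases "t \<in> dom (f n)")
      case False
      then show ?thesis using dz by (metis domIff)
    next
      case True
      have "f n t = join f (Suc n) t" using True by (auto simp: map_add_def)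
      also have "\<dots> = decode_const (\<zeta> n) t"
      proof (cases "q n")
        case 0
        then show ?thesis using j[of "Suc n"] by (simp add: \<zeta>_def)
      next
        case (Suc r)
        let ?e = "\<lambda>i. linst (Y i) (\<alpha> (Suc n) i)"
        have len: "q (Suc n) - 1 = r + Suc (q (Suc n) - Suc (q n))" using Suc q_less[of n] by simp
        have "lconcat ?e 0 (q (Suc n) - 1) = lconcat ?e 0 r \<odot> \<zeta> n"
          unfolding len lconcat_split \<zeta>_def Suc by simp
        then have "join f (Suc n) = decode_const (lconcat ?e 0 r \<odot> \<zeta> n)"
          using j[of "Suc n"] by (simp del: join.simps)
        moreover have "stop (lconcat ?e 0 r) = start (\<zeta> n)"
          using lconcat_constants(4)[OF spY \<alpha>[of "Suc n"], of 0 r] \<zeta>(3)[of n] Suc by simp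
        ultimately have "join f (Suc n) = decode_const (lconcat ?e 0 r) ++ decode_const (\<zeta> n)"
          using decode_const_lcat[OF lconcat_constants(2)[OF spY \<alpha>[of "Suc n"]] \<zeta>(2)] by simp
        moreover have "t \<in> dom (decode_const (\<zeta> n))" using True dz by simp
        ultimately show ?thesis by (auto simp del: join.simps)
      qed
      finally show ?thesis .
    qed
  qed
  moreover have "\<zeta> \<in> pts 0 (spn Y)"
    using \<zeta> q(2) space_start[OF spY] by (simp add: pts_def)
  ultimately show ?thesis by blast
qed

text \<open>The sets whose preimage under decoding is Ramsey form an algebra that contains the open sets and is closed
  under the Souslin operation. The preimage of the space \<open>word_seqs \<Lambda> \<T>\<close> itself is closed, since membership is a
  condition on pairs of consecutive words.\<close>
lemma ramsey_decode:
  assumes "V \<in> souslin_sets (word_seq_topology \<Lambda> \<T>)"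
  shows "ramsey {\<zeta>. (\<lambda>n. decode_const (\<zeta> n)) \<in> V}"
proof -
  define dec where "dec \<zeta> = (\<lambda>n. decode_const (\<zeta> n))" for \<zeta> :: "nat \<Rightarrow> (nat \<times> ('a list \<Rightarrow> 'l)) lword"
  define S where "S V = {\<zeta>. dec \<zeta> \<in> V}" for V
  let ?W = "word_seqs \<Lambda> \<T>"
  define M where "M = {V. V \<subseteq> ?W \<and> ramsey (S V)}"
  have "seq_open (- S ?W)"
    unfolding seq_open_def
  proof
    fix \<zeta> assume "\<zeta> \<in> - S ?W"
    then have "\<not> (\<forall>n. dec \<zeta> n \<in> words \<Lambda> \<T> - {Map.empty} \<and>
      word_top \<T> (dec \<zeta> n) = word_bot \<T> (dec \<zeta> (Suc n)) \<and> word_bot \<T> (dec \<zeta> 0) = 0)"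
      unfolding S_def word_seqs_def compatible_def by blast
    then obtain n where n: "dec \<zeta> n \<notin> words \<Lambda> \<T> - {Map.empty} \<or>
      word_top \<T> (dec \<zeta> n) \<noteq> word_bot \<T> (dec \<zeta> (Suc n)) \<or> word_bot \<T> (dec \<zeta> 0) \<noteq> 0"
      by blast
    have "\<eta> \<in> - S ?W" if "prefix (Suc (Suc n)) \<eta> = prefix (Suc (Suc n)) \<zeta>" for \<eta>
    proof -
      have "dec \<eta> i = dec \<zeta> i" if "i \<le> Suc n" for i
        using \<open>prefix (Suc (Suc n)) \<eta> = prefix (Suc (Suc n)) \<zeta>\<close> that
        unfolding prefix_eq_iff dec_def by simp
      then have "dec \<eta> n = dec \<zeta> n" "dec \<eta> (Suc n) = dec \<zeta> (Suc n)" "dec \<eta> 0 = dec \<zeta> 0" by auto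
      then have "dec \<eta> n \<notin> words \<Lambda> \<T> - {Map.empty} \<or>
        word_top \<T> (dec \<eta> n) \<noteq> word_bot \<T> (dec \<eta> (Suc n)) \<or> word_bot \<T> (dec \<eta> 0) \<noteq> 0"
        using n by (simp only:)
      then show ?thesis unfolding S_def word_seqs_def compatible_def by blast
    qed
    then show "\<exists>n. \<forall>\<eta>. prefix n \<eta> = prefix n \<zeta> \<longrightarrow> \<eta> \<in> - S ?W" by blast
  qed
  then have W: "ramsey (S ?W)" using ramsey_Compl[OF ramsey_seq_open] by fastforce
  have "algebra ?W M"
    unfolding algebra_iff_Int
  proof (intro conjI ballI)
    show "M \<subseteq> Pow ?W" "{} \<in> M"
      using ramsey_seq_open[of "{}"] by (auto simp: M_def S_def seq_open_def)
    fix V assume V: "V \<in> M"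
    have "S (?W - V) = S ?W \<inter> - S V" by (auto simp: S_def)
    then show "?W - V \<in> M" using V W ramsey_Int ramsey_Compl by (simp add: M_def)
    fix V' assume V': "V' \<in> M"
    have "S (V \<inter> V') = S V \<inter> S V'" by (auto simp: S_def)
    then show "V \<inter> V' \<in> M" using V V' ramsey_Int by (auto simp: M_def)
  qed
  moreover have "{U. openin (word_seq_topology \<Lambda> \<T>) U} \<subseteq> M"
  proof
    fix U assume "U \<in> {U. openin (word_seq_topology \<Lambda> \<T>) U}"
    then obtain U' where U': "openin (product_topology (\<lambda>_. discrete_topology (words \<Lambda> \<T>)) UNIV) U'" "U = U' \<inter> ?W"
      by (auto simp: word_seq_topology_def openin_subtopology)
    have cone: "\<exists>n. \<forall>g\<in>?W. (\<forall>i<n. g i = f i) \<longrightarrow> g \<in> U" if f: "f \<in> U" for f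
    proof -
      obtain B where B: "finite {i. B i \<noteq> words \<Lambda> \<T>}" "f \<in> PiE UNIV B" "PiE UNIV B \<subseteq> U'"
        using U' f unfolding openin_product_topology_alt by fastforce
      obtain n where n: "\<And>i. B i \<noteq> words \<Lambda> \<T> \<Longrightarrow> i < n"
        using B(1) unfolding finite_nat_set_iff_bounded by blast
      have "g \<in> U" if g: "g \<in> ?W" "\<forall>i<n. g i = f i" for g
      proof -
        have "g i \<in> B i" for i
        proof (cases "B i = words \<Lambda> \<T>")
          case True
          then show ?thesis using g(1) by (auto simp: word_seqs_def)
        next
          case False
          then have "g i = f i" using n g(2) by blast
          then show ?thesis using B(2) by (auto simp: PiE_iff)
        qed
        then show ?thesis using B(3) U'(2) g(1) by (auto simp: PiE_iff)
      qed
      then show ?thesis by blast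
    qed
    define O' where "O' = {\<zeta>. \<exists>n. \<forall>\<eta>. prefix n \<eta> = prefix n \<zeta> \<longrightarrow> dec \<eta> \<in> ?W \<longrightarrow> dec \<eta> \<in> U}"
    have "seq_open O'"
      unfolding seq_open_def
    proof
      fix \<zeta> assume "\<zeta> \<in> O'"
      then obtain n where n: "\<forall>\<eta>. prefix n \<eta> = prefix n \<zeta> \<longrightarrow> dec \<eta> \<in> ?W \<longrightarrow> dec \<eta> \<in> U"
        unfolding O'_def by blast
      have "\<eta> \<in> O'" if "prefix n \<eta> = prefix n \<zeta>" for \<eta>
        using n unfolding O'_def mem_Collect_eq that[symmetric] by blast
      then show "\<exists>n. \<forall>\<eta>. prefix n \<eta> = prefix n \<zeta> \<longrightarrow> \<eta> \<in> O'" by blast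
    qed
    moreover have "S U = S ?W \<inter> O'"
    proof (intro equalityI subsetI)
      fix \<zeta> assume z: "\<zeta> \<in> S U"
      then obtain n where n: "\<forall>g\<in>?W. (\<forall>i<n. g i = dec \<zeta> i) \<longrightarrow> g \<in> U" using cone[of "dec \<zeta>"] unfolding S_def by blast
      have "\<zeta> \<in> O'"
        unfolding O'_def mem_Collect_eq
      proof (intro exI[of _ n] allI impI)
        fix \<eta> assume "prefix n \<eta> = prefix n \<zeta>" "dec \<eta> \<in> ?W"
        then show "dec \<eta> \<in> U" using n by (simp add: prefix_eq_iff dec_def)
      qed
      then show "\<zeta> \<in> S ?W \<inter> O'" using z U'(2) by (auto simp: S_def)
    next
      fix \<zeta> assume "\<zeta> \<in> S ?W \<inter> O'"
      then show "\<zeta> \<in> S U" unfolding O'_def S_def by blast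
    qed
    ultimately have "ramsey (S U)" using W ramsey_Int ramsey_seq_open by simp
    then show "U \<in> M" using U'(2) by (simp add: M_def)
  qed
  moreover have "souslin_operation B \<in> M" if B: "range B \<subseteq> M" for B
  proof -
    have "S (souslin_operation B) = souslin_operation (\<lambda>\<tau>. S (B \<tau>))"
      by (auto simp: S_def souslin_operation_def)
    moreover have "ramsey (S (B \<tau>))" for \<tau> using B by (auto simp: M_def)
    moreover have "souslin_operation B \<subseteq> ?W" using B by (auto simp: M_def souslin_operation_def)
    ultimately show ?thesis using ramsey_souslin[of "\<lambda>\<tau>. S (B \<tau>)"] by (simp add: M_def)
  qed
  ultimately have "souslin_sets (word_seq_topology \<Lambda> \<T>) \<subseteq> M"
    unfolding souslin_sets_def topspace_word_seq_topology by (intro Inter_lower) blast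
  then show ?thesis using assms by (auto simp: M_def S_def dec_def)
qed

lemma monochromatic_subspace:
  fixes c :: "(nat \<Rightarrow> ('l, 'a) word) \<Rightarrow> 'c"
  assumes fin: "finite (c ` word_seqs \<Lambda> \<T>)" and c: "souslin_coloring (word_seq_topology \<Lambda> \<T>) c"
  shows "\<exists>X'. word_subspace \<Lambda> \<T> X' \<and> subspace_le \<Lambda> \<T> X' X \<and> c constant_on span_seqs \<Lambda> \<T> X'"
proof -
  define U where "U k = {\<zeta>. (\<lambda>n. decode_const (\<zeta> n)) \<in> {f \<in> word_seqs \<Lambda> \<T>. c f = k}}" for k
  have "ramsey (U k)" for k
    unfolding U_def using c by (intro ramsey_decode) (simp add: souslin_coloring_def)
  then obtain Y where Y: "Y \<in> subspaces 0 (spn base_space)"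
    and hom: "\<And>k. k \<in> c ` word_seqs \<Lambda> \<T> \<Longrightarrow> homogeneous (U k) 0 (spn Y)"
    using ramsey_coloring[OF space_base fin, of U] by blast
  have "c f = c g" if f: "f \<in> span_seqs \<Lambda> \<T> (\<lambda>i. decode (Y i))" and g: "g \<in> span_seqs \<Lambda> \<T> (\<lambda>i. decode (Y i))" for f g
  proof -
    obtain \<zeta> \<eta> where \<zeta>: "\<zeta> \<in> pts 0 (spn Y)" "f = (\<lambda>n. decode_const (\<zeta> n))"
      and \<eta>: "\<eta> \<in> pts 0 (spn Y)" "g = (\<lambda>n. decode_const (\<eta> n))"
      using span_seqs_decode[OF Y f] span_seqs_decode[OF Y g] by blast
    have fW: "f \<in> word_seqs \<Lambda> \<T>" using f by (simp add: span_seqs_def)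
    then have "\<zeta> \<in> U (c f)" using \<zeta>(2) by (simp add: U_def)
    moreover have "homogeneous (U (c f)) 0 (spn Y)" using hom fW by blast
    ultimately have "\<eta> \<in> U (c f)" using \<zeta>(1) \<eta>(1) unfolding homogeneous_def by blast
    then show ?thesis using \<eta>(2) by (simp add: U_def)
  qed
  then have "c constant_on span_seqs \<Lambda> \<T> (\<lambda>i. decode (Y i))" unfolding constant_on_def by metis
  then show ?thesis using decode_subspace[OF Y] by blast
qed

end

theorem theorem15:
  fixes \<Lambda> :: "'l set" and \<T> :: "'a rel list"
    and c :: "(nat \<Rightarrow> ('l, 'a) word) \<Rightarrow> 'c"
    and X :: "nat \<Rightarrow> ('l, 'a) vword"
  assumes "finite \<Lambda>"
    and "vector_tree \<T>" and "vector_infinite_height \<T>"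
    and "finite (c ` word_seqs \<Lambda> \<T>)"
    and "souslin_coloring (word_seq_topology \<Lambda> \<T>) c"
    and "word_subspace \<Lambda> \<T> X"
  shows "\<exists>X'. word_subspace \<Lambda> \<T> X' \<and> subspace_le \<Lambda> \<T> X' X \<and> c constant_on span_seqs \<Lambda> \<T> X'"
proof (cases "\<Lambda> = {}")
  case True
  \<comment> \<open>the empty word is the only constant word, so the span contains no sequences at all\<close>
  have "f = Map.empty" if "f \<in> words \<Lambda> \<T>" for f :: "('l, 'a) word"
    using that True by (auto simp: words_def words_between_def ran_def fun_eq_iff)
  then have "span_seqs \<Lambda> \<T> X = {}" by (auto simp: span_seqs_def word_seqs_def)
  then show ?thesis using assms(6) by (intro exI[of _ X]) (auto simp: subspace_le_def constant_on_def)
next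
  case False
  then obtain l0 where l0: "l0 \<in> \<Lambda>" by blast
  define bnd where "bnd i = word_bot \<T> (X i)" for i
  have "\<exists>D k. bnd i \<le> k \<and> k < bnd (Suc i) \<and> vector_level_subset_at \<T> k D \<and>
      X i \<in> vwords_between \<Lambda> \<T> D (bnd i) (bnd (Suc i)) \<and> vdominates \<T> D (vlevel \<T> i)" for i
  proof -
    obtain D where D: "is_vword_with \<Lambda> \<T> D (X i)"
      using assms(6) by (auto simp: word_subspace_def vwords_def)
    then obtain m n k where mn: "m < n" "m \<le> k" "k < n" "vector_level_subset_at \<T> k D"
      "X i \<in> vwords_between \<Lambda> \<T> D m n" by (auto simp: is_vword_with_def)
    have dom: "dom (X i) = segment \<T> m n" using mn(5) by (simp add: vwords_between_def)
    have "bnd i = m" unfolding bnd_def using word_bot_eq[OF assms(2,3) mn(1) dom] .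
    moreover have "bnd (Suc i) = n"
      using word_top_eq[OF assms(2,3) mn(1) dom] assms(6) by (simp add: bnd_def word_subspace_def compatible_def)
    moreover have "vdominates \<T> D (vlevel \<T> i)"
      using assms(6) ws_eq[OF D] by (metis word_subspace_def)
    ultimately show ?thesis using mn by blast
  qed
  then obtain Ds lev where D: "\<And>i. bnd i \<le> lev i" "\<And>i. lev i < bnd (Suc i)"
    "\<And>i. vector_level_subset_at \<T> (lev i) (Ds i)"
    "\<And>i. X i \<in> vwords_between \<Lambda> \<T> (Ds i) (bnd i) (bnd (Suc i))"
    "\<And>i. vdominates \<T> (Ds i) (vlevel \<T> i)" by metis
  have "bnd 0 = 0" using assms(6) by (simp add: bnd_def word_subspace_def)
  then interpret blocks \<Lambda> \<T> X Ds lev bnd l0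
    using assms(1-3) l0 D by unfold_locales
  show ?thesis using monochromatic_subspace[OF assms(4,5)] .
qed

end
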